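(* Let $N=4$ (so $p=3$), let $1<q<m$, let $\mathbf l=(l_0,\dots,l_q)$ be a $q$-decomposition of $m$ with associated groups $I_1,\dots,I_q$, and suppose that for every $h=1,\dots,q$ there are numbers $c_i>0$, $i\in I_h$, with $$\sum_{j\in I_h}\beta_{ij}c_ic_j^2=c_i,\qquad i\in I_h.$$ Suppose that for every $h=1,\dots,q$ the matrix $\mathcal B_h:=(\beta_{ij})_{(i,j)\in I_h\times I_h}$ is invertible and has only positive elements. Then, for every $h=1,\dots,q$, the linear system $$-\Delta v_i=\Bigg[\Big(3\beta_{ii}c_i^2+\sum_{j\in I_h,\,j\neq i}\beta_{ij}c_j^2\Big)v_i+2\sum_{j\in I_h,\,j\neq i}\beta_{ij}c_ic_jv_j\Bigg]U^2\quad\text{in }\mathbb R^4,\qquad v_i\in\mathcal D^{1,2}(\mathbb R^4),\ i\in I_h,$$ has an $(N+1)$-dimensional (i.e. $5$-dimensional) set of solutions.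
   Context: $m\in\mathbb N$, $\mu_1,\dots,\mu_m>0$, $\beta_{ij}=\beta_{ji}\in\mathbb R$ for $i\neq j$ in $\{1,\dots,m\}$, and $\beta_{ii}:=\mu_i$. A $q$-decomposition of $m$ is a vector $\mathbf l=(l_0,\dots,l_q)\in\mathbb N^{q+1}$ with $0=l_0<l_1<\dots<l_{q-1}<l_q=m$; then $I_h:=\{i\in\{1,\dots,m\}:l_{h-1}<i\le l_h\}$ for $h=1,\dots,q$. $U=U_{1,0}$ is the standard bubble in $\mathbb R^4$, $U(x)=\alpha_4\frac{1}{1+|x|^2}$, with $\alpha_4>0$ the constant for which $-\Delta U=U^3$ in $\mathbb R^4$. $\mathcal D^{1,2}(\mathbb R^4)$ is the completion of $C_c^\infty(\mathbb R^4)$ with respect to $\|\nabla u\|_{L^2(\mathbb R^4)}$. *)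

theory Defs
  imports "HOL-Analysis.Analysis" "Jordan_Normal_Form.Matrix"
begin

definition partial_deriv :: "'n::finite \<Rightarrow> (real^'n \<Rightarrow> real) \<Rightarrow> real^'n \<Rightarrow> real" where
  "partial_deriv i f x = frechet_derivative f (at x) (axis i 1)"

definition grad :: "(real^'n::finite \<Rightarrow> real) \<Rightarrow> real^'n \<Rightarrow> real^'n" where
  "grad f x = (\<chi> i. partial_deriv i f x)"

definition laplacian :: "(real^'n::finite \<Rightarrow> real) \<Rightarrow> real^'n \<Rightarrow> real" where
  "laplacian f x = (\<Sum>i\<in>UNIV. partial_deriv i (partial_deriv i f) x)"

primrec Ck :: "nat \<Rightarrow> (real^'n::finite \<Rightarrow> real) \<Rightarrow> bool" where
  "Ck 0 f \<longleftrightarrow> continuous_on UNIV f"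
| "Ck (Suc k) f \<longleftrightarrow> f differentiable_on UNIV \<and> (\<forall>i. Ck k (partial_deriv i f))"

definition Cc_infty :: "(real^'n::finite \<Rightarrow> real) set" where
  "Cc_infty = {f. (\<forall>k. Ck k f) \<and> compact (closure {x. f x \<noteq> 0})}"

text \<open>The completion of \<^const>\<open>Cc_infty\<close> for the gradient norm is realised as a
  space of functions (modulo equality almost everywhere). By the Sobolev inequality a sequence
  in \<^const>\<open>Cc_infty\<close> that is Cauchy for the gradient norm also converges in $L^4$
  (4 is the critical exponent $2N/(N-2)$ for $N = 4$); the element of the
  completion is identified with that limit \<open>u\<close>, and the $L^2$ limit \<open>G\<close> of the gradients is its
  weak gradient. The measure is the complete Lebesgue measure, so the relation below
  is stable under changing \<open>u\<close> and \<open>G\<close> on null sets.\<close>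

definition D12_gradient :: "(real^4 \<Rightarrow> real) \<Rightarrow> (real^4 \<Rightarrow> real^4) \<Rightarrow> bool" where
  "D12_gradient u G \<longleftrightarrow>
     u \<in> borel_measurable lebesgue \<and> G \<in> borel_measurable lebesgue \<and>
     (\<exists>\<phi> :: nat \<Rightarrow> real^4 \<Rightarrow> real. (\<forall>n. \<phi> n \<in> Cc_infty) \<and>
        (\<lambda>n. \<integral>\<^sup>+x. ennreal (\<bar>\<phi> n x - u x\<bar> ^ 4) \<partial>lebesgue) \<longlonglongrightarrow> 0 \<and>
        (\<lambda>n. \<integral>\<^sup>+x. ennreal (norm (grad (\<phi> n) x - G x) ^ 2) \<partial>lebesgue) \<longlonglongrightarrow> 0)"

definition D12 :: "(real^4 \<Rightarrow> real) set" where
  "D12 = {u. \<exists>G. D12_gradient u G}"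

text \<open>Weak form of $-\Delta u = f$. In the system below \<open>f\<close> is a sum of products of a function
  in $L^4$ and a bounded function, so both integrands are integrable and no Bochner
  integral takes its default value 0.\<close>

definition weak_solution_D12 :: "(real^4 \<Rightarrow> real) \<Rightarrow> (real^4 \<Rightarrow> real) \<Rightarrow> bool" where
  "weak_solution_D12 u f \<longleftrightarrow>
     (\<exists>G. D12_gradient u G \<and>
        (\<forall>\<phi>\<in>Cc_infty. (\<integral>x. inner (G x) (grad \<phi> x) \<partial>lebesgue) = (\<integral>x. f x * \<phi> x \<partial>lebesgue)))"

text \<open>Elements of $D^{1,2}(R^4)$ are classes modulo equality almost everywhere, hence so are
  linear independence and span. A set \<open>S\<close> of families indexed by \<open>I\<close> is an \<open>n\<close>-dimensional
  vector space if it has a basis \<open>w 0, \<dots>, w (n - 1)\<close>; the values of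
  a family outside \<open>I\<close> play no role.\<close>

definition ae_vector_space_of_dim ::
    "'i set \<Rightarrow> ('i \<Rightarrow> real^4 \<Rightarrow> real) set \<Rightarrow> nat \<Rightarrow> bool" where
  "ae_vector_space_of_dim I S n \<longleftrightarrow>
     (\<exists>w :: nat \<Rightarrow> 'i \<Rightarrow> real^4 \<Rightarrow> real.
        (\<forall>a :: nat \<Rightarrow> real.
           (\<forall>i\<in>I. AE x in lebesgue. (\<Sum>k<n. a k * w k i x) = 0) \<longrightarrow> (\<forall>k<n. a k = 0)) \<and>
        S = {v. \<exists>a :: nat \<Rightarrow> real. \<forall>i\<in>I. AE x in lebesgue. v i x = (\<Sum>k<n. a k * w k i x)})"

text \<open>The constant for which the bubble satisfies $-\Delta U = U^3$.\<close>

definition alpha4 :: real where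
  "alpha4 = (THE a. a > 0 \<and>
     (\<forall>x::real^4. - laplacian (\<lambda>y::real^4. a / (1 + (norm y)\<^sup>2)) x = (a / (1 + (norm x)\<^sup>2)) ^ 3))"

definition bubble :: "real^4 \<Rightarrow> real" where
  "bubble x = alpha4 * (1 / (1 + (norm x)\<^sup>2))"

lemma partial_deriv_eq: "(f has_derivative f') (at x) \<Longrightarrow> partial_deriv i f x = f' (axis i 1)"
  unfolding partial_deriv_def by (metis frechet_derivative_at)

lemma laplacian_bubble:
  fixes x :: "real^4"
  shows "laplacian (\<lambda>y::real^4. a / (1 + (norm y)\<^sup>2)) x = - 8 * a / (1 + (norm x)\<^sup>2) ^ 3"
proof -
  have pos: "1 + inner y y \<noteq> 0" for y :: "real^4"
    using inner_ge_zero[of y] by linarith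
  have r: "((\<lambda>y::real^4. 1 + inner y y) has_derivative (\<lambda>h. 2 * inner y h)) (at y)" for y
    by (auto intro!: derivative_eq_intros simp: inner_commute)
  have d1: "((\<lambda>y::real^4. a / (1 + inner y y)) has_derivative
      (\<lambda>h. 2 * inner y h * (- a / (1 + inner y y)\<^sup>2))) (at y)" for y
    using pos[of y]
    by (intro DERIV_compose_FDERIV[OF _ r, where f = "\<lambda>t. a / t"])
       (auto intro!: derivative_eq_intros simp: power2_eq_square)
  have d2: "((\<lambda>y::real^4. 1 / (1 + inner y y)\<^sup>2) has_derivative
      (\<lambda>h. 2 * inner y h * (- 2 / (1 + inner y y) ^ 3))) (at y)" for y
    using pos[of y]
    by (intro DERIV_compose_FDERIV[OF _ r, where f = "\<lambda>t. 1 / t\<^sup>2"])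
       (auto intro!: derivative_eq_intros simp: divide_simps power2_eq_square power3_eq_cube)
  have d3: "((\<lambda>y::real^4. (- 2 * a * inner y e) * (1 / (1 + inner y y)\<^sup>2)) has_derivative
      (\<lambda>h. (- 2 * a * inner y e) * (2 * inner y h * (- 2 / (1 + inner y y) ^ 3))
         + (- 2 * a * inner h e) * (1 / (1 + inner y y)\<^sup>2))) (at y)" for y e
    by (rule has_derivative_mult[OF _ d2]) (auto intro!: derivative_eq_intros)
  have p1: "partial_deriv i (\<lambda>y::real^4. a / (1 + inner y y))
      = (\<lambda>y. (- 2 * a * inner y (axis i 1)) * (1 / (1 + inner y y)\<^sup>2))" for i
    by (rule ext) (simp add: partial_deriv_eq[OF d1])
  have p2: "partial_deriv i (\<lambda>y::real^4. (- 2 * a * inner y (axis i 1)) * (1 / (1 + inner y y)\<^sup>2)) y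
      = - 2 * a / (1 + inner y y)\<^sup>2 + 8 * a / (1 + inner y y) ^ 3 * (inner y (axis i 1))\<^sup>2" for i y
    by (simp only: partial_deriv_eq[OF d3]) (simp add: inner_axis_axis power2_eq_square)
  have sq: "(\<Sum>i\<in>UNIV. (inner x (axis i 1))\<^sup>2) = inner x x"
    unfolding inner_axis by (simp add: inner_vec_def power2_eq_square)
  have alg: "- 8 * a / t ^ 2 + 8 * a / t ^ 3 * (t - 1) = - 8 * a / t ^ 3" if "t \<noteq> 0" for t :: real
    using that by (simp add: field_simps power2_eq_square power3_eq_cube)
  have "laplacian (\<lambda>y::real^4. a / (1 + (norm y)\<^sup>2)) x
      = (\<Sum>i\<in>(UNIV::4 set). - 2 * a / (1 + inner x x)\<^sup>2
            + 8 * a / (1 + inner x x) ^ 3 * (inner x (axis i 1))\<^sup>2)"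
    unfolding laplacian_def power2_norm_eq_inner p1 p2 ..
  also have "\<dots> = - 8 * a / (1 + inner x x)\<^sup>2 + 8 * a / (1 + inner x x) ^ 3 * inner x x"
    by (simp only: sum.distrib sum_distrib_left[symmetric] sq) simp
  also have "\<dots> = - 8 * a / (1 + inner x x) ^ 3"
    using alg[OF pos[of x]] by simp
  finally show ?thesis
    by (simp only: power2_norm_eq_inner)
qed

lemma alpha4_eq: "alpha4 = sqrt 8"
  unfolding alpha4_def
proof (rule the_equality)
  show "sqrt 8 > 0 \<and> (\<forall>x::real^4. - laplacian (\<lambda>y::real^4. sqrt 8 / (1 + (norm y)\<^sup>2)) x
      = (sqrt 8 / (1 + (norm x)\<^sup>2)) ^ 3)"
    by (simp add: laplacian_bubble power_divide power3_eq_cube)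
next
  fix a :: real
  assume a: "a > 0 \<and> (\<forall>x::real^4. - laplacian (\<lambda>y::real^4. a / (1 + (norm y)\<^sup>2)) x
      = (a / (1 + (norm x)\<^sup>2)) ^ 3)"
  from a have "- laplacian (\<lambda>y::real^4. a / (1 + (norm y)\<^sup>2)) (0::real^4)
      = (a / (1 + (norm (0::real^4))\<^sup>2)) ^ 3"
    by blast
  then have "8 * a = a ^ 3"
    by (simp add: laplacian_bubble)
  with a have "a\<^sup>2 = 8"
    by (simp add: power3_eq_cube power2_eq_square)
  with a show "a = sqrt 8"
    by (metis abs_of_pos real_sqrt_abs)
qed

definition q_decomposition :: "nat \<Rightarrow> nat \<Rightarrow> (nat \<Rightarrow> nat) \<Rightarrow> bool" where
  "q_decomposition q m l \<longleftrightarrow> l 0 = 0 \<and> l q = m \<and> (\<forall>h<q. l h < l (Suc h))"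

definition group_of :: "nat \<Rightarrow> (nat \<Rightarrow> nat) \<Rightarrow> nat \<Rightarrow> nat set" where
  "group_of m l h = {i\<in>{1..m}. l (h - 1) < i \<and> i \<le> l h}"

text \<open>The matrix of all \<open>\<beta> i j\<close> with \<open>i\<close>, \<open>j\<close> in the \<open>h\<close>-th group; matrix indices start at 0,
  whereas the group is \<open>{l (h - 1) + 1..l h}\<close>.\<close>

definition group_matrix :: "(nat \<Rightarrow> nat \<Rightarrow> real) \<Rightarrow> (nat \<Rightarrow> nat) \<Rightarrow> nat \<Rightarrow> real mat" where
  "group_matrix \<beta> l h = mat (l h - l (h - 1)) (l h - l (h - 1))
     (\<lambda>(r, s). \<beta> (l (h - 1) + 1 + r) (l (h - 1) + 1 + s))"

definition linearized_solutions ::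
    "(nat \<Rightarrow> nat \<Rightarrow> real) \<Rightarrow> (nat \<Rightarrow> real) \<Rightarrow> nat set \<Rightarrow> (nat \<Rightarrow> real^4 \<Rightarrow> real) set" where
  "linearized_solutions \<beta> c I = {v. \<forall>i\<in>I. v i \<in> D12 \<and>
     weak_solution_D12 (v i) (\<lambda>x.
       ((3 * \<beta> i i * (c i)\<^sup>2 + (\<Sum>j\<in>I - {i}. \<beta> i j * (c j)\<^sup>2)) * v i x
        + 2 * (\<Sum>j\<in>I - {i}. \<beta> i j * c i * c j * v j x)) * (bubble x)\<^sup>2)}"

end

theory Submission
  imports Defs
begin

text \<open>Stereographic projection turns $U^{-3}\Delta U$ into the conformal Laplacian of the sphere: for
  $p = a \cdot \sigma(x)$, with $\sigma$ the inverse projection and $a \in R^5$, the functions $U p^k$ satisfy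
  $-\Delta (U p^k) = U^3 (\lambda_k p^k - \frac12 k(k-1)|a|^2 p^{k-2})$ with $\lambda_k = (k+1)(k+2)/2$.
  Testing the system, whose coefficient matrix is $1 + 2C$ with $C_{ij} = \beta_{ij}c_ic_j$, with these functions
  gives a triangular recursion for the moments $m_i(k) = \int v_i U^3 p^k$:
  $\lambda_k m(k) - \frac12 k(k-1)|a|^2 m(k-2) = (1 + 2C)\, m(k)$.
  As $C$ is a positive symmetric matrix with $Cc = c$, its spectrum lies in $[-1,1]$ and the fixed space is spanned by
  $c$; as it is invertible, $m(0) = 0$. Moreover $m(1)$ is a multiple of $c$, which is removed by subtracting
  a solution $c_i U (d \cdot \sigma)$, and then all $m(k)$ vanish because $\lambda_k \ge 6 > 3$ for $k \ge 2$.
  Powers of linear forms sum to exponentials, which span a dense algebra on the sphere, so $v = 0$.\<close>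

subsection \<open>A smooth cutoff profile\<close>

text \<open>The unknowns are only weak solutions, so all derivatives are moved onto explicit test
  functions; each component then enters through its L^4 integrability alone. The obstacle is that
  the weak equation is tested with compactly supported functions, whereas U p^k decays just like
  |x|^-2. The truncation is therefore a function of the conformal factor 1/(1+|x|^2) itself: its
  derivatives decay as scaling requires, and truncated and untruncated functions lie in one algebra
  closed under partial derivatives, so smoothness of every order is a single induction. The number 5
  arises by comparing lambda_k = 1, 3, 6, ... with the spectrum of 1 + 2C, which lies in [-1, 3].
  The value 1 would be met by the eigenvalue 0 of C; the value 3 is met by the eigenvalue 1 of C and
  by it alone. Since that eigenvalue is simple, the only freedom left is one linear functional of a
  in R^5.\<close>

lemma power_le_fact_exp:
  fixes y :: real
  assumes "0 \<le> y"
  shows "y ^ k \<le> fact k * exp y"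
proof -
  obtain t where t: "exp y = (\<Sum>m<Suc k. y ^ m / fact m) + exp t / fact (Suc k) * y ^ Suc k"
    using Maclaurin_exp_le by blast
  have "y ^ k / fact k \<le> (\<Sum>m<Suc k. y ^ m / fact m)"
    using assms by (simp add: sum_nonneg)
  also have "\<dots> \<le> exp y"
    unfolding t using assms by (simp del: sum.lessThan_Suc)
  finally show ?thesis
    by (simp add: field_simps)
qed

text \<open>Dividing by powers of t keeps the derivatives of exp(-1/t) inside one family: each
  derivative is a combination of two members. Member 0 tends to 1 at infinity and serves as cutoff
  profile.\<close>

definition flat :: "nat \<Rightarrow> real \<Rightarrow> real" where
  "flat k t = (if t > 0 then exp (- 1 / t) / t ^ k else 0)"

lemma flat_nonneg: "0 \<le> flat k t"
  by (simp add: flat_def)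

text \<open>The power bound for exp, taken at 1/t. It is uniform in t, which later makes the cutoff
  estimates independent of the truncation radius.\<close>

lemma flat_le_fact: "flat k t \<le> fact k"
proof (cases "t > 0")
  case True
  then have "(1 / t) ^ k \<le> fact k * exp (1 / t)"
    by (intro power_le_fact_exp) simp
  with True show ?thesis
    by (simp add: flat_def exp_minus field_simps)
qed (simp add: flat_def)

lemma flat_eq_mult: "flat k t = t * flat (Suc k) t"
  by (simp add: flat_def)

lemma flat_has_real_derivative:
  "(flat k has_real_derivative flat (k + 2) t - real k * flat (k + 1) t) (at t)"
proof (cases t "0 :: real" rule: linorder_cases)
  case less
  have "((\<lambda>_. 0) has_real_derivative 0) (at t)" by simp
  then have "(flat k has_real_derivative 0) (at t)"
    by (rule has_field_derivative_transform_within_open[where S = "{..<0}"]) (use less in \<open>auto simp: flat_def\<close>)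
  then show ?thesis using less by (simp add: flat_def)
next
  case greater
  have "((\<lambda>t. exp (- 1 / t) / t ^ k) has_real_derivative
      exp (- 1 / t) / t ^ (k + 2) - real k * (exp (- 1 / t) / t ^ (k + 1))) (at t)"
  proof -
    \<comment> \<open>The exponent is truncated at k = 0, where the factor \<open>real k\<close>
      vanishes.\<close>
    have "real k * t ^ (k - Suc 0) = real k * t ^ k / t"
      using greater by (cases k) auto
    with greater show ?thesis
      by (auto intro!: derivative_eq_intros simp: divide_simps power2_eq_square) (simp add: algebra_simps)
  qed
  then have "(flat k has_real_derivative
      exp (- 1 / t) / t ^ (k + 2) - real k * (exp (- 1 / t) / t ^ (k + 1))) (at t)"
    by (rule has_field_derivative_transform_within_open[where S = "{0<..}"]) (use greater in \<open>auto simp: flat_def\<close>)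
  then show ?thesis using greater by (simp add: flat_def)
next
  case equal
  have "((\<lambda>h. (flat k (0 + h) - flat k 0) / h) \<longlongrightarrow> 0) (at 0)"
  proof (rule Lim_null_comparison)
    \<comment> \<open>The quotient is \<open>flat (Suc k) h\<close>, that is h times
      \<open>flat (k + 2) h\<close>; boundedness of the latter makes it vanish linearly.\<close>
    have "norm ((flat k (0 + h) - flat k 0) / h) \<le> fact (k + 2) * \<bar>h\<bar>" for h
    proof -
      have "(flat k (0 + h) - flat k 0) / h = flat (Suc k) h"
        by (simp add: flat_def)
      also have "norm \<dots> = \<bar>h\<bar> * flat (k + 2) h"
        using flat_nonneg[of "k + 2" h] by (simp add: flat_eq_mult[of "Suc k"] abs_mult)
      also have "\<dots> \<le> \<bar>h\<bar> * fact (k + 2)"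
        by (intro mult_left_mono flat_le_fact) simp
      finally show ?thesis by (simp only: mult.commute)
    qed
    then show "\<forall>\<^sub>F h in at 0. norm ((flat k (0 + h) - flat k 0) / h) \<le> fact (k + 2) * \<bar>h\<bar>"
      by simp
    show "((\<lambda>h. fact (k + 2) * \<bar>h\<bar>) \<longlongrightarrow> (0::real)) (at 0)"
      by (auto intro!: tendsto_eq_intros)
  qed
  then show ?thesis
    using equal by (simp add: DERIV_def flat_def)
qed

lemma flat_tendsto: "(flat k \<longlongrightarrow> (if k = 0 then 1 else 0)) at_top"
proof -
  have e: "((\<lambda>t::real. exp (- (1 / t))) \<longlongrightarrow> 1) at_top"
    by (rule tendsto_eq_intros tendsto_divide_0 filterlim_at_top_imp_at_infinity filterlim_ident | simp)+
  have i: "((\<lambda>t::real. (1 / t) ^ k) \<longlongrightarrow> (if k = 0 then 1 else 0)) at_top"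
  proof (cases "k = 0")
    case False
    have "((\<lambda>t::real. 1 / t) \<longlongrightarrow> 0) at_top"
      by (rule tendsto_divide_0 filterlim_at_top_imp_at_infinity filterlim_ident tendsto_const)+
    from tendsto_power[OF this, of k] False show ?thesis
      by (simp add: power_0_left)
  qed simp
  have "((\<lambda>t::real. exp (- (1 / t)) * (1 / t) ^ k) \<longlongrightarrow> (if k = 0 then 1 else 0)) at_top"
    using tendsto_mult[OF e i] by (simp only: mult_1_left)
  moreover have "\<forall>\<^sub>F t in at_top. exp (- (1 / t)) * (1 / t) ^ k = flat k t"
    using eventually_gt_at_top[of "0::real"]
    by eventually_elim (simp add: flat_def power_one_over field_simps)
  ultimately show ?thesis
    by (rule Lim_transform_eventually)
qed

subsection \<open>Differentiation rules\<close>

lemma grad_nth: "vec_nth (grad f x) i = partial_deriv i f x"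
  by (simp add: grad_def)

lemma inner_grad: "inner (grad f x) v = (\<Sum>i\<in>UNIV. partial_deriv i f x * vec_nth v i)"
  by (simp add: inner_vec_def grad_def)

lemma has_derivative_frechet:
  "f differentiable_on UNIV \<Longrightarrow> (f has_derivative frechet_derivative f (at x)) (at x)"
  by (metis UNIV_I differentiable_on_def frechet_derivative_works)

lemma partial_deriv_add:
  assumes "f differentiable_on UNIV" "g differentiable_on UNIV"
  shows "partial_deriv i (\<lambda>x. f x + g x) = (\<lambda>x. partial_deriv i f x + partial_deriv i g x)"
  by (rule ext) (simp add: partial_deriv_eq[OF has_derivative_add[OF assms[THEN has_derivative_frechet]]]
      partial_deriv_def)

lemma partial_deriv_mult:
  assumes "f differentiable_on UNIV" "g differentiable_on UNIV"
  shows "partial_deriv i (\<lambda>x. f x * g x)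
    = (\<lambda>x. f x * partial_deriv i g x + partial_deriv i f x * g x)"
  by (rule ext) (simp add: partial_deriv_eq[OF has_derivative_mult[OF assms[THEN has_derivative_frechet]]]
      partial_deriv_def)

lemma partial_deriv_compose:
  assumes h: "\<And>t. (h has_real_derivative h' t) (at t)" and "g differentiable_on UNIV"
  shows "partial_deriv i (\<lambda>x. h (g x)) = (\<lambda>x. h' (g x) * partial_deriv i g x)"
  by (rule ext) (simp add: partial_deriv_eq[OF DERIV_compose_FDERIV[OF h has_derivative_frechet[OF assms(2)]]]
      partial_deriv_def)

lemma differentiable_compose_real:
  assumes h: "\<And>t. (h has_real_derivative h' t) (at t)" and "g differentiable_on UNIV"
  shows "(\<lambda>x. h (g x)) differentiable_on UNIV"
  using DERIV_compose_FDERIV[OF h has_derivative_frechet[OF assms(2)]]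
  by (auto simp: differentiable_on_def differentiable_def intro: has_derivative_at_withinI)

lemma Ck_2_D:
  assumes "Ck 2 f"
  shows "f differentiable_on UNIV" "partial_deriv i f differentiable_on UNIV"
    "continuous_on UNIV (partial_deriv i (partial_deriv j f))"
  using assms by (simp_all add: numeral_2_eq_2)

lemma grad_mult:
  fixes f g :: "real^'n::finite \<Rightarrow> real"
  assumes "f differentiable_on UNIV" "g differentiable_on UNIV"
  shows "grad (\<lambda>x. f x * g x) x = f x *\<^sub>R grad g x + g x *\<^sub>R grad f x"
  by (simp add: Finite_Cartesian_Product.vec_eq_iff grad_nth partial_deriv_mult[OF assms])

lemma grad_compose:
  fixes g :: "real^'n::finite \<Rightarrow> real"
  assumes "\<And>t. (h has_real_derivative h' t) (at t)" and "g differentiable_on UNIV"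
  shows "grad (\<lambda>x. h (g x)) x = h' (g x) *\<^sub>R grad g x"
  by (simp add: Finite_Cartesian_Product.vec_eq_iff grad_nth partial_deriv_compose[OF assms])

lemma laplacian_mult:
  assumes f: "Ck 2 f" and g: "Ck 2 g"
  shows "laplacian (\<lambda>x. f x * g x) x
    = f x * laplacian g x + 2 * inner (grad f x) (grad g x) + g x * laplacian f x"
proof -
  note d = Ck_2_D[OF f] Ck_2_D[OF g] differentiable_on_mult
  have "partial_deriv i (partial_deriv i (\<lambda>x. f x * g x)) x
      = f x * partial_deriv i (partial_deriv i g) x + 2 * (partial_deriv i f x * partial_deriv i g x)
        + g x * partial_deriv i (partial_deriv i f) x" for i
    by (simp add: partial_deriv_mult partial_deriv_add d)
  then show ?thesis
    by (simp add: laplacian_def inner_grad grad_nth sum.distrib sum_distrib_left)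
qed

lemma laplacian_compose:
  assumes h: "\<And>t. (h has_real_derivative h' t) (at t)" "\<And>t. (h' has_real_derivative h'' t) (at t)"
    and g: "Ck 2 g"
  shows "laplacian (\<lambda>x. h (g x)) x = h' (g x) * laplacian g x + h'' (g x) * inner (grad g x) (grad g x)"
proof -
  note d = Ck_2_D[OF g]
  have "partial_deriv i (partial_deriv i (\<lambda>x. h (g x))) x
      = h' (g x) * partial_deriv i (partial_deriv i g) x
        + h'' (g x) * (partial_deriv i g x * partial_deriv i g x)" for i
    by (simp add: partial_deriv_compose[OF h(1)] partial_deriv_compose[OF h(2)] d
        partial_deriv_mult[OF differentiable_compose_real[OF h(2)]])
  then show ?thesis
    by (simp add: laplacian_def inner_grad grad_nth sum.distrib sum_distrib_left)
qed

lemma laplacian_add: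
  assumes f: "Ck 2 f" and g: "Ck 2 g"
  shows "laplacian (\<lambda>x. f x + g x) x = laplacian f x + laplacian g x"
  by (simp add: laplacian_def partial_deriv_add Ck_2_D[OF f] Ck_2_D[OF g] sum.distrib)

lemma partial_deriv_const: "partial_deriv i (\<lambda>_. c) = (\<lambda>_. 0)"
  by (rule ext, rule partial_deriv_eq[OF has_derivative_const, THEN trans]) simp

lemma laplacian_cmult:
  assumes "Ck 2 f"
  shows "laplacian (\<lambda>x. c * f x) x = c * laplacian f x"
  by (simp add: laplacian_def partial_deriv_mult partial_deriv_const
      Ck_2_D[OF assms] sum_distrib_left)

subsection \<open>The conformal factor and the test functions\<close>

text \<open>This is U divided by its constant, and also half the conformal factor of stereographic
  projection.\<close>

definition conf :: "real^4 \<Rightarrow> real" where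
  "conf x = 1 / (1 + inner x x)"

lemma one_plus_inner_pos: "0 < 1 + inner x x"
  using inner_ge_zero[of x] by linarith

lemma conf_pos: "0 < conf x"
  using one_plus_inner_pos[of x] by (simp add: conf_def)

lemma conf_le_1: "conf x \<le> 1"
  using one_plus_inner_pos[of x] by (simp add: conf_def)

text \<open>Trades |x|^2 for a polynomial in \<open>conf\<close>. Growth estimates and the
  stereographic identities below thereby become polynomial algebra.\<close>

lemma conf_mult_inner: "conf x * inner x x = 1 - conf x"
  using one_plus_inner_pos[of x] by (simp add: conf_def field_simps)

lemma conf_has_derivative: "(conf has_derivative (\<lambda>h. - 2 * (conf x)\<^sup>2 * inner x h)) (at x)"
proof -
  have "((\<lambda>y::real^4. 1 + inner y y) has_derivative (\<lambda>h. 2 * inner x h)) (at x)"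
    by (auto intro!: derivative_eq_intros simp: inner_commute)
  from DERIV_compose_FDERIV[OF _ this, of "\<lambda>t. 1 / t" "- 1 / (1 + inner x x)\<^sup>2"] one_plus_inner_pos[of x]
  have "((\<lambda>y::real^4. 1 / (1 + inner y y)) has_derivative
      (\<lambda>h. 2 * inner x h * (- 1 / (1 + inner x x)\<^sup>2))) (at x)"
    by (force intro!: derivative_eq_intros simp: power2_eq_square)
  then show ?thesis
    unfolding conf_def[abs_def]
    by (rule has_derivative_eq_rhs) (simp add: power_divide fun_eq_iff)
qed

text \<open>The generators are chosen so that partial derivatives stay inside. \<open>N\<close>
  fixes the truncation radius; functions built without the \<open>flat\<close> generator belong to
  the algebra for every \<open>N\<close>.\<close>

inductive_set test_alg :: "real \<Rightarrow> (real^4 \<Rightarrow> real) set" for N where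
  const: "(\<lambda>_. c) \<in> test_alg N"
| coord: "(\<lambda>x. inner b x) \<in> test_alg N"
| conf: "conf \<in> test_alg N"
| flat: "(\<lambda>x. flat k (N * conf x - 1)) \<in> test_alg N"
| add: "f \<in> test_alg N \<Longrightarrow> g \<in> test_alg N \<Longrightarrow> (\<lambda>x. f x + g x) \<in> test_alg N"
| mult: "f \<in> test_alg N \<Longrightarrow> g \<in> test_alg N \<Longrightarrow> (\<lambda>x. f x * g x) \<in> test_alg N"

text \<open>Differentiability and closure under partial derivatives are proved together, since the
  product rule needs both for each factor.\<close>

lemma test_alg_derivative:
  assumes "f \<in> test_alg N"
  shows "\<exists>f'. (\<forall>x. (f has_derivative f' x) (at x)) \<and> (\<forall>i. (\<lambda>x. f' x (axis i 1)) \<in> test_alg N)"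
  using assms
proof induction
  case (const c)
  show ?case
    by (rule exI[of _ "\<lambda>_ _. 0"]) (simp add: test_alg.const)
next
  case (coord b)
  show ?case
    by (rule exI[of _ "\<lambda>_. inner b"])
      (simp add: test_alg.const bounded_linear_imp_has_derivative bounded_linear_inner_right)
next
  case conf
  have "(\<lambda>x. - 2 * (conf x)\<^sup>2 * inner x (axis i 1)) \<in> test_alg N" for i :: 4
    unfolding power2_eq_square inner_commute[of _ "axis i 1"] by (intro test_alg.intros)
  then show ?case
    by (intro exI[of _ "\<lambda>x h. - 2 * (conf x)\<^sup>2 * inner x h"] conjI allI conf_has_derivative)
next
  case (flat k)
  let ?f' = "\<lambda>x h. N * (- 2 * (conf x)\<^sup>2 * inner x h)
      * (flat (k + 2) (N * conf x - 1) + - real k * flat (k + 1) (N * conf x - 1))"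
  have d: "((\<lambda>x. flat k (N * conf x - 1)) has_derivative ?f' x) (at x)" for x
  proof -
    have "((\<lambda>x. N * conf x - 1) has_derivative (\<lambda>h. N * (- 2 * (conf x)\<^sup>2 * inner x h))) (at x)"
      by (auto intro!: derivative_eq_intros conf_has_derivative)
    from DERIV_compose_FDERIV[OF flat_has_real_derivative this]
    show ?thesis by simp
  qed
  have "(\<lambda>x. ?f' x (axis i 1)) \<in> test_alg N" for i :: 4
    unfolding power2_eq_square inner_commute[of _ "axis i 1"]
    by (intro test_alg.intros)
  with d show ?case
    by (intro exI[of _ ?f'] conjI allI)
next
  case (add f g)
  then obtain f' g' where f: "\<forall>x. (f has_derivative f' x) (at x)" "\<forall>i. (\<lambda>x. f' x (axis i 1)) \<in> test_alg N"
    and g: "\<forall>x. (g has_derivative g' x) (at x)" "\<forall>i. (\<lambda>x. g' x (axis i 1)) \<in> test_alg N"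
    by blast
  then show ?case
    by (intro exI[of _ "\<lambda>x h. f' x h + g' x h"]) (auto intro!: has_derivative_add test_alg.add)
next
  case (mult f g)
  then obtain f' g' where f: "\<forall>x. (f has_derivative f' x) (at x)" "\<forall>i. (\<lambda>x. f' x (axis i 1)) \<in> test_alg N"
    and g: "\<forall>x. (g has_derivative g' x) (at x)" "\<forall>i. (\<lambda>x. g' x (axis i 1)) \<in> test_alg N"
    by blast
  with mult show ?case
    by (intro exI[of _ "\<lambda>x h. f x * g' x h + f' x h * g x"])
      (auto intro!: has_derivative_mult test_alg.add test_alg.mult)
qed

lemma test_alg_differentiable: "f \<in> test_alg N \<Longrightarrow> f differentiable_on UNIV"
  using test_alg_derivative by (metis differentiableI differentiable_at_imp_differentiable_on)

lemma test_alg_partial_deriv: "f \<in> test_alg N \<Longrightarrow> partial_deriv i f \<in> test_alg N"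
proof -
  assume "f \<in> test_alg N"
  then obtain f' where f: "\<forall>x. (f has_derivative f' x) (at x)" "\<forall>i. (\<lambda>x. f' x (axis i 1)) \<in> test_alg N"
    using test_alg_derivative by blast
  have "partial_deriv i f = (\<lambda>x. f' x (axis i 1))"
    using f(1) by (auto intro!: ext partial_deriv_eq)
  with f(2) show ?thesis by simp
qed

lemma test_alg_Ck: "f \<in> test_alg N \<Longrightarrow> Ck k f"
  by (induction k arbitrary: f)
    (auto intro: test_alg_differentiable test_alg_partial_deriv differentiable_imp_continuous_on)

text \<open>The profile is nonzero only where \<open>N * conf x > 1\<close>, i.e. 1 + |x|^2 < N. The
  radius 1 + N is a crude bound that involves no square root.\<close>

lemma cutoff_in_Cc_infty:
  assumes "f \<in> test_alg N"
  shows "(\<lambda>x. flat 0 (N * conf x - 1) * f x) \<in> Cc_infty"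
proof -
  have "norm x \<le> 1 + N" if "flat 0 (N * conf x - 1) * f x \<noteq> 0" for x
  proof -
    have "N * conf x > 1"
      using that by (auto simp: flat_def split: if_splits)
    then have "1 + inner x x < N"
      using one_plus_inner_pos[of x] by (simp add: conf_def field_simps)
    moreover have "0 \<le> inner x x" "0 \<le> N * N"
      by (auto simp: inner_ge_zero)
    ultimately have "0 \<le> 1 + N" "inner x x \<le> 1 + N * 2 + N * N"
      by linarith+
    then have "0 \<le> 1 + N" "(norm x)\<^sup>2 \<le> (1 + N)\<^sup>2"
      by (simp_all add: power2_norm_eq_inner) (simp add: power2_eq_square algebra_simps)
    then show ?thesis
      by (rule power2_le_imp_le[rotated])
  qed
  then have "bounded {x. flat 0 (N * conf x - 1) * f x \<noteq> 0}"
    by (intro boundedI[of _ "1 + N"]) blast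
  moreover have "(\<lambda>x. flat 0 (N * conf x - 1) * f x) \<in> test_alg N"
    by (intro test_alg.intros assms)
  ultimately show ?thesis
    by (simp add: Cc_infty_def test_alg_Ck del: mult_eq_0_iff)
qed

lemma test_alg_power: "f \<in> test_alg N \<Longrightarrow> (\<lambda>x. f x ^ k) \<in> test_alg N"
  by (induction k) (auto intro: test_alg.intros)

section \<open>Compactly supported integrands and integration by parts\<close>

lemma continuous_imp_measurable_lebesgue:
  fixes f :: "real^'n::finite \<Rightarrow> 'b::{real_normed_vector, second_countable_topology}"
  assumes "continuous_on UNIV f"
  shows "f \<in> borel_measurable lebesgue"
  using borel_measurable_continuous_onI[OF assms] by (simp add: measurable_completion)

lemma compact_support_bounded:
  fixes f :: "real^'n::finite \<Rightarrow> real"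
  assumes "continuous_on UNIV f" "bounded {x. f x \<noteq> 0}"
  obtains M where "0 < M" "\<And>x. \<bar>f x\<bar> \<le> M"
proof -
  have "compact (f ` closure {x. f x \<noteq> 0})"
    using assms by (intro compact_continuous_image continuous_on_subset[OF assms(1)])
      (auto simp: compact_closure)
  then obtain M where M: "\<And>y. y \<in> f ` closure {x. f x \<noteq> 0} \<Longrightarrow> \<bar>y\<bar> \<le> M"
    using compact_imp_bounded bounded_real by metis
  have "\<bar>f x\<bar> \<le> \<bar>M\<bar> + 1" for x
  proof (cases "f x = 0")
    case False
    then have "f x \<in> f ` closure {x. f x \<noteq> 0}"
      by (intro imageI subsetD[OF closure_subset]) simp
    from M[OF this] show ?thesis by simp
  qed simp
  then show ?thesis by (intro that[of "\<bar>M\<bar> + 1"]) auto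
qed

lemma emeasure_bounded_lebesgue:
  fixes S :: "'a::euclidean_space set"
  assumes "bounded S"
  shows "emeasure lebesgue S < \<infinity>"
proof -
  obtain a where "S \<subseteq> cbox (- a) a"
    using bounded_subset_cbox_symmetric[OF assms] by blast
  then have "emeasure lebesgue S \<le> emeasure lebesgue (cbox (- a) a)"
    by (intro emeasure_mono) auto
  also have "\<dots> < \<infinity>"
    by (simp add: emeasure_lborel_cbox_eq)
  finally show ?thesis .
qed

lemma integrable_compact_support:
  fixes f :: "real^'n::finite \<Rightarrow> real"
  assumes "continuous_on UNIV f" "bounded {x. f x \<noteq> 0}"
  shows "integrable lebesgue f"
proof -
  obtain M where M: "0 < M" "\<And>x. \<bar>f x\<bar> \<le> M"
    using compact_support_bounded[OF assms] by blast
  obtain a where a: "{x. f x \<noteq> 0} \<subseteq> cbox (- a) a"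
    using bounded_subset_cbox_symmetric[OF assms(2)] by blast
  have "integrable lebesgue (\<lambda>x. M * indicat_real (cbox (- a) a) x)"
    by (intro integrable_mult_right integrable_real_indicator) (auto simp: emeasure_lborel_cbox_eq)
  then show ?thesis
  proof (rule Bochner_Integration.integrable_bound)
    show "AE x in lebesgue. norm (f x) \<le> norm (M * indicat_real (cbox (- a) a) x)"
      using M a by (auto simp: indicator_def intro!: AE_I2)
  qed (rule continuous_imp_measurable_lebesgue[OF assms(1)])
qed

text \<open>Translation invariance is taken from \<open>lborel\<close>; continuity makes both
  integrands Borel, so completing the measure does not change the integrals.\<close>

lemma lebesgue_integral_translate:
  fixes f :: "real^'n::finite \<Rightarrow> real"
  assumes "continuous_on UNIV f"
  shows "(\<integral>x. f (c + x) \<partial>lebesgue) = (\<integral>x. f x \<partial>lebesgue)"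
proof -
  have "continuous_on UNIV (\<lambda>x. f (c + x))"
    by (intro continuous_on_compose2[OF assms] continuous_intros) auto
  with assms have f: "f \<in> borel_measurable borel" "(\<lambda>x. f (c + x)) \<in> borel_measurable borel"
    by (auto intro: borel_measurable_continuous_onI)
  have "(\<integral>x. f x \<partial>lborel) = (\<integral>x. f x \<partial>distr lborel borel ((+) c))"
    by (simp only: lborel_distr_plus)
  also have "\<dots> = (\<integral>x. f (c + x) \<partial>lborel)"
    by (rule integral_distr) (simp_all add: f)
  finally show ?thesis
    using integral_completion[of f lborel] integral_completion[of "\<lambda>x. f (c + x)" lborel] f
    by (simp add: eq_commute)
qed

lemma partial_deriv_line:
  fixes f :: "real^'n::finite \<Rightarrow> real"
  assumes "f differentiable_on UNIV"
  shows "((\<lambda>t. f (x + t *\<^sub>R axis i 1)) has_real_derivative partial_deriv i f (x + t *\<^sub>R axis i 1)) (at t)"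
proof -
  have l: "((\<lambda>t. x + t *\<^sub>R axis i 1) has_derivative (\<lambda>h. h *\<^sub>R axis i 1)) (at t)"
    by (auto intro!: derivative_eq_intros)
  have d: "(f has_derivative frechet_derivative f (at (x + t *\<^sub>R axis i 1))) (at (x + t *\<^sub>R axis i 1))"
    by (rule has_derivative_frechet[OF assms])
  from has_derivative_compose[OF l d]
  show ?thesis
    unfolding has_field_derivative_def partial_deriv_def
    by (rule has_derivative_eq_rhs)
      (simp add: fun_eq_iff linear_cmul[OF has_derivative_linear[OF d]] mult.commute)
qed

text \<open>By translation invariance every difference quotient of f has integral 0; dominated
  convergence carries this to the derivative.\<close>

lemma integral_partial_deriv_eq_0:
  fixes f :: "real^'n::finite \<Rightarrow> real"
  assumes f: "f differentiable_on UNIV" and c: "continuous_on UNIV (partial_deriv i f)"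
    and supp: "bounded {x. f x \<noteq> 0}"
  shows "(\<integral>x. partial_deriv i f x \<partial>lebesgue) = 0"
proof -
  define e :: "real^'n" where "e = axis i 1"
  have cf: "continuous_on UNIV f"
    using f by (rule differentiable_imp_continuous_on)
  obtain R where R: "\<And>x. f x \<noteq> 0 \<Longrightarrow> norm x \<le> R"
    using supp by (auto simp: bounded_iff)
  have pd0: "partial_deriv i f x = 0" if "R < norm x" for x
  proof -
    have "((\<lambda>_. 0) has_derivative (\<lambda>_. 0)) (at x)"
      by simp
    moreover have "open {x. R < norm x}"
      by (intro open_Collect_less continuous_intros)
    moreover have "0 = f y" if "y \<in> {x. R < norm x}" for y
      using R[of y] that by force
    ultimately have "(f has_derivative (\<lambda>_. 0)) (at x)"
      using that has_derivative_transform_within_open by blast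
    then show ?thesis
      by (simp add: partial_deriv_eq)
  qed
  then have "bounded {x. partial_deriv i f x \<noteq> 0}"
    by (intro boundedI[of _ R]) (metis (mono_tags) mem_Collect_eq not_less)
  from compact_support_bounded[OF c this] obtain M where M: "0 < M" "\<And>x. \<bar>partial_deriv i f x\<bar> \<le> M"
    by blast
  define q where "q n x = real (Suc n) * (f (inverse (real (Suc n)) *\<^sub>R e + x) - f x)" for n x
  \<comment> \<open>The mean value theorem turns the bound \<open>M\<close> on the derivative into a
    bound on all quotients at once.\<close>
  have q: "\<exists>\<xi>. 0 < \<xi> \<and> \<xi> < inverse (real (Suc n)) \<and> q n x = partial_deriv i f (x + \<xi> *\<^sub>R e)" for n x
  proof -
    have "\<exists>\<xi>>0. \<xi> < inverse (real (Suc n)) \<and>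
        f (x + inverse (real (Suc n)) *\<^sub>R axis i 1) - f (x + 0 *\<^sub>R axis i 1)
        = (inverse (real (Suc n)) - 0) * partial_deriv i f (x + \<xi> *\<^sub>R axis i 1)"
      by (rule MVT2) (auto intro: partial_deriv_line[OF f])
    then show ?thesis
      by (auto simp: q_def e_def add.commute)
  qed
  have int: "integrable lebesgue (\<lambda>x. f (v + x))" for v
  proof (rule integrable_compact_support)
    show "continuous_on UNIV (\<lambda>x. f (v + x))"
      by (intro continuous_intros continuous_on_compose2[OF cf]) auto
    have "norm x \<le> R + norm v" if "f (v + x) \<noteq> 0" for x
      using R[OF that] norm_triangle_ineq4[of "v + x" v] by simp
    then show "bounded {x. f (v + x) \<noteq> 0}"
      by (intro boundedI[of _ "R + norm v"]) auto
  qed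
  have "(\<lambda>n. \<integral>x. q n x \<partial>lebesgue) \<longlonglongrightarrow> (\<integral>x. partial_deriv i f x \<partial>lebesgue)"
  proof (rule integral_dominated_convergence)
    show "partial_deriv i f \<in> borel_measurable lebesgue"
      by (rule continuous_imp_measurable_lebesgue[OF c])
    show "q n \<in> borel_measurable lebesgue" for n
      unfolding q_def by (intro continuous_imp_measurable_lebesgue continuous_intros continuous_on_compose2[OF cf]) auto
    \<comment> \<open>The shifts have length at most 1, so all quotients vanish outside the ball of
      radius R + 1.\<close>
    show "integrable lebesgue (\<lambda>x. M * indicat_real (cball (0::real^'n) (R + 1)) x)"
      by (intro integrable_mult_right integrable_real_indicator)
        (use emeasure_bounded_lebesgue[of "cball (0::real^'n) (R + 1)"] in \<open>simp_all add: less_top\<close>)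
    show "AE x in lebesgue. (\<lambda>n. q n x) \<longlonglongrightarrow> partial_deriv i f x"
    proof (rule AE_I2)
      fix x
      have "((\<lambda>t. f (x + t *\<^sub>R e)) has_real_derivative partial_deriv i f x) (at 0)"
        using partial_deriv_line[OF f, of x i 0] by (simp add: e_def)
      then have lim: "((\<lambda>h. (f (x + h *\<^sub>R e) - f x) / h) \<longlongrightarrow> partial_deriv i f x) (at 0)"
        by (simp add: DERIV_def)
      have "filterlim (\<lambda>n. inverse (real (Suc n))) (at 0) sequentially"
        unfolding filterlim_at using LIMSEQ_inverse_real_of_nat by auto
      from filterlim_compose[OF lim this]
      show "(\<lambda>n. q n x) \<longlonglongrightarrow> partial_deriv i f x"
        by (simp add: q_def divide_inverse add.commute mult.commute)
    qed
    show "AE x in lebesgue. norm (q n x) \<le> M * indicat_real (cball 0 (R + 1)) x" for n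
    proof (rule AE_I2)
      fix x
      show "norm (q n x) \<le> M * indicat_real (cball 0 (R + 1)) x"
      proof (cases "norm x \<le> R + 1")
        case True
        then show ?thesis
          using q[of n x] M(2) by auto
      next
        case False
        have "norm (inverse (real (Suc n)) *\<^sub>R e) \<le> 1"
          by (simp add: e_def norm_axis_1 inverse_le_1_iff)
        then have "R < norm (inverse (real (Suc n)) *\<^sub>R e + x)"
          using False norm_diff_ineq[of x "inverse (real (Suc n)) *\<^sub>R e"] by (simp add: add.commute)
        then have "f (inverse (real (Suc n)) *\<^sub>R e + x) = 0" "f x = 0"
          using R False by force+
        then show ?thesis
          using M by (simp add: q_def)
      qed
    qed
  qed
  moreover have "(\<integral>x. q n x \<partial>lebesgue) = 0" for n
    unfolding q_def
    using int[of "inverse (real (Suc n)) *\<^sub>R e"] int[of 0] lebesgue_integral_translate[OF cf]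
    by simp
  ultimately show ?thesis
    by (simp add: LIMSEQ_const_iff eq_commute[of 0])
qed

text \<open>The support condition is on g alone, so f may be a derivative of a function living on
  the whole space.\<close>

lemma integral_by_parts:
  fixes f g :: "real^'n::finite \<Rightarrow> real"
  assumes f: "f differentiable_on UNIV" "continuous_on UNIV (partial_deriv i f)"
    and g: "g differentiable_on UNIV" "continuous_on UNIV (partial_deriv i g)" "bounded {x. g x \<noteq> 0}"
    and g': "bounded {x. partial_deriv i g x \<noteq> 0}"
  shows "integrable lebesgue (\<lambda>x. f x * partial_deriv i g x)"
    "integrable lebesgue (\<lambda>x. partial_deriv i f x * g x)"
    "(\<integral>x. f x * partial_deriv i g x \<partial>lebesgue) = - (\<integral>x. partial_deriv i f x * g x \<partial>lebesgue)"
proof -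
  have cont: "continuous_on UNIV f" "continuous_on UNIV g"
    using f g by (auto intro: differentiable_imp_continuous_on)
  show i1: "integrable lebesgue (\<lambda>x. f x * partial_deriv i g x)"
    by (intro integrable_compact_support continuous_intros cont g) (auto intro: bounded_subset[OF g'])
  show i2: "integrable lebesgue (\<lambda>x. partial_deriv i f x * g x)"
    by (intro integrable_compact_support continuous_intros cont f) (auto intro: bounded_subset[OF g(3)])
  have "(\<integral>x. partial_deriv i (\<lambda>x. f x * g x) x \<partial>lebesgue) = 0"
  proof (rule integral_partial_deriv_eq_0)
    show "continuous_on UNIV (partial_deriv i (\<lambda>x. f x * g x))"
      unfolding partial_deriv_mult[OF f(1) g(1)] by (intro continuous_intros cont f g)
  qed (auto intro: bounded_subset[OF g(3)] differentiable_on_mult f g)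
  then show "(\<integral>x. f x * partial_deriv i g x \<partial>lebesgue) = - (\<integral>x. partial_deriv i f x * g x \<partial>lebesgue)"
    using i1 i2 by (simp add: partial_deriv_mult f g)
qed

lemma Cc_infty_D:
  assumes "\<phi> \<in> Cc_infty"
  shows "Ck k \<phi>" "\<phi> differentiable_on UNIV" "continuous_on UNIV \<phi>" "bounded {x. \<phi> x \<noteq> 0}"
proof -
  show "Ck k \<phi>" for k using assms by (simp add: Cc_infty_def)
  from this[of 1] show "\<phi> differentiable_on UNIV" by simp
  then show "continuous_on UNIV \<phi>" by (rule differentiable_imp_continuous_on)
  show "bounded {x. \<phi> x \<noteq> 0}"
    using assms by (auto simp: Cc_infty_def dest!: compact_imp_bounded intro: bounded_subset closure_subset)
qed

lemma Cc_infty_partial_deriv: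
  assumes "\<phi> \<in> Cc_infty"
  shows "partial_deriv i \<phi> \<in> Cc_infty"
proof -
  have "partial_deriv i \<phi> x = 0" if "x \<notin> closure {x. \<phi> x \<noteq> 0}" for x
  proof -
    have "((\<lambda>_. 0) has_derivative (\<lambda>_. 0)) (at x)" by simp
    then have "(\<phi> has_derivative (\<lambda>_. 0)) (at x)"
      by (rule has_derivative_transform_within_open[where s = "- closure {x. \<phi> x \<noteq> 0}"])
        (use that closure_subset[of "{x. \<phi> x \<noteq> 0}"] in auto)
    then show ?thesis by (simp add: partial_deriv_eq)
  qed
  then have "closure {x. partial_deriv i \<phi> x \<noteq> 0} \<subseteq> closure {x. \<phi> x \<noteq> 0}"
    by (intro closure_minimal) auto
  moreover have "Ck k (partial_deriv i \<phi>)" for k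
    using Cc_infty_D(1)[OF assms, of "Suc k"] by simp
  moreover have "bounded (closure {x. \<phi> x \<noteq> 0})"
    using assms by (auto simp: Cc_infty_def)
  ultimately show ?thesis
    by (auto simp: Cc_infty_def compact_closure intro: bounded_subset[OF _ order_trans[OF closure_subset]])
qed

section \<open>Integrability against powers of the conformal factor\<close>

lemma conf_continuous: "continuous_on UNIV conf"
  using test_alg.conf[THEN test_alg_differentiable] by (rule differentiable_imp_continuous_on)

text \<open>Dyadic decomposition: on the shell $2^k \le |x| < 2^{k+1}$ the integrand is at most $32^{-k}$,
  while the ball of radius $2^{k+1}$ has measure proportional to $16^{k+1}$.\<close>

lemma integrable_conf_5_2: "integrable lebesgue (\<lambda>x. (conf x)\<^sup>2 * sqrt (conf x))"
proof -
  define w where "w x = (conf x)\<^sup>2 * sqrt (conf x)" for x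
  have cw: "continuous_on UNIV w"
    unfolding w_def by (intro continuous_intros conf_continuous)
  have w0: "0 \<le> w x" for x
    using conf_pos[of x] by (simp add: w_def less_imp_le)
  define B where "B k = ball (0::real^4) (2 ^ Suc k)" for k :: nat
  have bound: "ennreal (w x) \<le> (\<Sum>k. ennreal (1 / 32 ^ k) * indicator (B k) x)" for x
  proof -
    obtain n :: nat where n: "norm x < 2 ^ n"
      using real_arch_pow[of 2 "norm x"] by auto
    define k where "k = (LEAST k. norm x < 2 ^ Suc k)"
    have "norm x < 2 ^ Suc n"
      using n norm_ge_zero[of x] by (auto intro: less_le_trans)
    then have kx: "norm x < 2 ^ Suc k"
      unfolding k_def by (rule LeastI)
    have "w x \<le> 1 / 32 ^ k"
    \<comment> \<open>For k = 0 the shell is the whole ball of radius 2, where |x| has no positive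
      lower bound; there \<open>conf\<close> at most 1 suffices.\<close>
    proof (cases k)
      case 0
      have "w x \<le> 1 * 1"
        unfolding w_def using conf_pos[of x] conf_le_1[of x]
        by (intro mult_mono) (auto simp: power_le_one)
      then show ?thesis using 0 by simp
    next
      case (Suc j)
      then have "2 ^ k \<le> norm x"
        using not_less_Least[of j "\<lambda>k. norm x < 2 ^ Suc k"] by (auto simp: k_def not_less)
      then have "(2 ^ k)\<^sup>2 \<le> inner x x"
        by (metis power2_norm_eq_inner power_mono zero_le_numeral zero_le_power)
      moreover have "(2 ^ k)\<^sup>2 = (4 ^ k :: real)"
        by (simp add: power2_eq_square flip: power_mult_distrib)
      ultimately have "4 ^ k \<le> inner x x" by simp
      then have c: "conf x \<le> 1 / 4 ^ k"
        unfolding conf_def by (intro divide_left_mono) (auto intro!: mult_pos_pos simp: add_pos_nonneg)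
      have "sqrt (conf x) \<le> sqrt (1 / 4 ^ k)"
        using c by (rule real_sqrt_le_mono)
      also have "\<dots> = 1 / 2 ^ k"
        by (simp add: real_sqrt_divide real_sqrt_power)
      finally have "w x \<le> (1 / 4 ^ k)\<^sup>2 * (1 / 2 ^ k)"
        unfolding w_def using conf_pos[of x] c
        by (intro mult_mono power_mono) auto
      also have "\<dots> = 1 / 32 ^ k"
        by (simp add: power2_eq_square flip: power_mult_distrib)
      finally show ?thesis .
    qed
    then have "ennreal (w x) \<le> ennreal (1 / 32 ^ k) * indicator (B k) x"
      using kx by (simp add: B_def indicator_def ennreal_leI)
    also have "\<dots> \<le> (\<Sum>k. ennreal (1 / 32 ^ k) * indicator (B k) x)"
    proof -
      have "sum g {k} \<le> suminf g" for g :: "nat \<Rightarrow> ennreal"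
        by (intro sum_le_suminf) auto
      then show ?thesis by (simp only: sum.insert finite.emptyI empty_iff not_False_eq_True sum.empty add_0_right)
    qed
    finally show ?thesis .
  qed
  \<comment> \<open>The ball \<open>B k\<close> has volume \<open>unit_ball_vol 4\<close> times
    16^(k+1); against 32^-k this leaves c 2^-k.\<close>
  define c where "c = unit_ball_vol 4 * 16"
  have c0: "0 \<le> c" by (simp add: c_def)
  have int: "(\<integral>\<^sup>+x. ennreal (1 / 32 ^ k) * indicator (B k) x \<partial>lborel) = ennreal (c * (1 / 2) ^ k)" for k
  proof -
    have "(\<integral>\<^sup>+x. ennreal (1 / 32 ^ k) * indicator (B k) x \<partial>lborel)
        = ennreal (1 / 32 ^ k) * ennreal (unit_ball_vol 4 * (2 ^ Suc k) ^ 4)"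
      by (subst nn_integral_cmult_indicator) (simp_all add: B_def emeasure_ball)
    also have "\<dots> = ennreal (1 / 32 ^ k * (unit_ball_vol 4 * (2 ^ Suc k) ^ 4))"
      by (rule ennreal_mult[symmetric]) simp_all
    also have "1 / 32 ^ k * (unit_ball_vol 4 * (2 ^ Suc k) ^ 4) = c * (1 / 2 :: real) ^ k"
    proof -
      have "(2 ^ Suc k) ^ 4 = (16 * 16 ^ k :: real)"
      proof -
        have "((2::real) ^ Suc k) ^ 4 = (2 ^ 4) ^ Suc k"
          by (metis power_mult mult.commute)
        then show ?thesis by simp
      qed
      moreover have "(32::real) ^ k = 16 ^ k * 2 ^ k"
        by (simp flip: power_mult_distrib)
      ultimately show ?thesis
        by (simp add: c_def power_one_over)
    qed
    finally show ?thesis .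
  qed
  have "(\<integral>\<^sup>+x. ennreal (w x) \<partial>lborel) \<le> (\<integral>\<^sup>+x. (\<Sum>k. ennreal (1 / 32 ^ k) * indicator (B k) x) \<partial>lborel)"
    by (intro nn_integral_mono bound)
  also have "\<dots> = (\<Sum>k. \<integral>\<^sup>+x. ennreal (1 / 32 ^ k) * indicator (B k) x \<partial>lborel)"
  proof (rule nn_integral_suminf)
    fix k
    have [measurable]: "B k \<in> sets lborel"
      by (simp add: B_def)
    show "(\<lambda>x. ennreal (1 / 32 ^ k) * indicator (B k) x) \<in> borel_measurable lborel"
      by measurable
  qed
  also have "\<dots> = (\<Sum>k. ennreal (c * (1 / 2) ^ k))"
    by (simp only: int)
  also have "\<dots> < \<infinity>"
  proof -
    have "summable (\<lambda>k. c * (1 / 2) ^ k)"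
      by (intro summable_mult summable_geometric) simp
    then have "(\<Sum>k. ennreal (c * (1 / 2) ^ k)) \<noteq> \<infinity>"
      using c0 unfolding infinity_ennreal_def by (intro ennreal_suminf_neq_top mult_nonneg_nonneg) auto
    then show ?thesis
      by (simp add: less_top[symmetric])
  qed
  finally have "integrable lborel w"
    using w0 borel_measurable_continuous_onI[OF cw] by (intro integrableI_nonneg) auto
  then have "integrable lebesgue w"
    using borel_measurable_continuous_onI[OF cw] by (subst integrable_completion) auto
  then show ?thesis
    by (simp add: w_def[abs_def])
qed

lemma integrable_conf_power_3: "integrable lebesgue (\<lambda>x. conf x ^ 3)"
proof (rule Bochner_Integration.integrable_bound[OF integrable_conf_5_2])
  show "(\<lambda>x. conf x ^ 3) \<in> borel_measurable lebesgue"
    by (intro continuous_imp_measurable_lebesgue continuous_intros conf_continuous)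
  have "conf x ^ 3 \<le> (conf x)\<^sup>2 * sqrt (conf x)" for x
  proof -
    have "conf x = sqrt (conf x) * sqrt (conf x)"
      using conf_pos[of x] by simp
    also have "\<dots> \<le> sqrt (conf x)"
      using conf_pos[of x] conf_le_1[of x] by (intro mult_left_le) auto
    finally show ?thesis
      by (simp add: power3_eq_cube power2_eq_square mult_left_mono)
  qed
  then show "AE x in lebesgue. norm (conf x ^ 3) \<le> norm ((conf x)\<^sup>2 * sqrt (conf x))"
    using conf_pos by (auto simp: less_imp_le)
qed

text \<open>A pointwise form of Young's inequality with exponents 4 and 4/3.\<close>

lemma integrable_L4_times_conf:
  assumes [measurable]: "v \<in> borel_measurable lebesgue" and "integrable lebesgue (\<lambda>x. v x ^ 4)"
  shows "integrable lebesgue (\<lambda>x. v x * (conf x)\<^sup>2)"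
proof (rule Bochner_Integration.integrable_bound[OF Bochner_Integration.integrable_add[OF assms(2) integrable_conf_5_2]])
  have [measurable]: "conf \<in> borel_measurable lebesgue"
    by (rule continuous_imp_measurable_lebesgue[OF conf_continuous])
  show "(\<lambda>x. v x * (conf x)\<^sup>2) \<in> borel_measurable lebesgue"
    by measurable
  \<comment> \<open>Young's inequality would produce the exponent 8/3 of \<open>conf\<close>. The
    exponent 5/2 is still integrable in dimension 4 and involves only a square root. The threshold
    \<open>sqrt (conf x)\<close> balances the cases: below it the product is at most conf^(5/2),
    above it conf^2 is at most |v|^3.\<close>
  have "\<bar>v x\<bar> * (conf x)\<^sup>2 \<le> v x ^ 4 + (conf x)\<^sup>2 * sqrt (conf x)" for x
  proof (cases "\<bar>v x\<bar> \<le> sqrt (conf x)")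
    case True
    then have "(conf x)\<^sup>2 * \<bar>v x\<bar> \<le> (conf x)\<^sup>2 * sqrt (conf x)"
      by (intro mult_left_mono) auto
    then show ?thesis by (simp add: mult.commute add_increasing)
  next
    case False
    then have "(sqrt (conf x)) ^ 3 \<le> \<bar>v x\<bar> ^ 3"
      using conf_pos[of x] by (intro power_mono) auto
    moreover have "(conf x)\<^sup>2 \<le> (sqrt (conf x)) ^ 3"
    proof -
      define r where "r = sqrt (conf x)"
      have "conf x = r\<^sup>2" "0 \<le> r" "r \<le> 1"
        using conf_pos[of x] conf_le_1[of x] by (auto simp: r_def)
      then have "(conf x)\<^sup>2 = r ^ 3 * r"
        by (simp add: power2_eq_square power3_eq_cube)
      also have "\<dots> \<le> r ^ 3 * 1"
        using \<open>0 \<le> r\<close> \<open>r \<le> 1\<close> by (intro mult_left_mono) auto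
      finally show ?thesis by (simp add: r_def)
    qed
    ultimately have "\<bar>v x\<bar> * (conf x)\<^sup>2 \<le> \<bar>v x\<bar> * \<bar>v x\<bar> ^ 3"
      by (intro mult_left_mono) auto
    also have "\<dots> = v x ^ 4"
      by (simp flip: power_Suc)
    finally have "\<bar>v x\<bar> * (conf x)\<^sup>2 \<le> v x ^ 4" .
    then show ?thesis
      using conf_pos[of x] by (intro add_increasing2) auto
  qed
  then show "AE x in lebesgue. norm (v x * (conf x)\<^sup>2) \<le> norm (v x ^ 4 + (conf x)\<^sup>2 * sqrt (conf x))"
    using conf_pos by (auto simp: abs_mult less_imp_le)
qed

section \<open>Passing to limits in the completion\<close>

text \<open>Plays the role of Hoelder's inequality on a set of finite measure: a small constant plus
  a multiple of the higher power dominates the first power. If a exceeds \<delta>, the factor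
  (a/\<delta>)^p is at least 1.\<close>

lemma le_add_power_div:
  fixes a \<delta> :: real
  assumes "0 \<le> a" "0 < \<delta>"
  shows "a \<le> \<delta> + a ^ Suc p / \<delta> ^ p"
proof (cases "a \<le> \<delta>")
  case False
  then have "a * 1 \<le> a * (a / \<delta>) ^ p"
    using assms by (intro mult_left_mono one_le_power) (auto simp: field_simps)
  then show ?thesis
    using assms by (simp add: power_divide field_simps) (simp add: add_increasing)
qed (use assms in \<open>simp add: add_increasing2\<close>)

text \<open>On the support of h, of finite measure c, the L^1 distance is at most \<delta> M c plus
  a multiple of the L^(p+1) distance; n is sent to infinity for fixed \<delta>. The exponent
  \<open>Suc p\<close> covers both convergences of \<open>D12_gradient\<close>: 4 for the functions,
  2 for the gradients.\<close>

lemma tendsto_integral_compact_support: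
  fixes f :: "nat \<Rightarrow> real^'n::finite \<Rightarrow> real" and u h :: "real^'n \<Rightarrow> real"
  assumes [measurable]: "\<And>n. f n \<in> borel_measurable lebesgue" "u \<in> borel_measurable lebesgue"
    and h: "continuous_on UNIV h" "bounded {x. h x \<noteq> 0}"
    and lim: "(\<lambda>n. \<integral>\<^sup>+x. ennreal (\<bar>f n x - u x\<bar> ^ Suc p) \<partial>lebesgue) \<longlonglongrightarrow> 0"
    and int: "\<And>n. integrable lebesgue (\<lambda>x. f n x * h x)"
  shows "integrable lebesgue (\<lambda>x. u x * h x)"
    and "(\<lambda>n. \<integral>x. f n x * h x \<partial>lebesgue) \<longlonglongrightarrow> (\<integral>x. u x * h x \<partial>lebesgue)"
proof -
  have [measurable]: "h \<in> borel_measurable lebesgue"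
    by (rule continuous_imp_measurable_lebesgue[OF h(1)])
  obtain M where M: "0 < M" "\<And>x. \<bar>h x\<bar> \<le> M"
    using compact_support_bounded[OF h] by blast
  define K where "K = {x. h x \<noteq> 0}"
  have [measurable]: "K \<in> sets lebesgue"
  proof -
    have "{x \<in> space lebesgue. h x \<noteq> 0} \<in> sets lebesgue" by measurable
    then show ?thesis by (simp add: K_def)
  qed
  obtain c where c: "emeasure lebesgue K = ennreal c" "0 \<le> c"
    using emeasure_bounded_lebesgue[OF h(2)] unfolding K_def
    by (metis emeasure_eq_ennreal_measure less_irrefl measure_nonneg infinity_ennreal_def)
  define I where "I n = (\<integral>\<^sup>+x. ennreal (\<bar>f n x - u x\<bar> ^ Suc p) \<partial>lebesgue)" for n
  have bound: "(\<integral>\<^sup>+x. norm (f n x * h x - u x * h x) \<partial>lebesgue) \<le> ennreal (\<delta> * M * c) + ennreal (M / \<delta> ^ p) * I n"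
    if "0 < \<delta>" for n \<delta>
  proof -
    have "ennreal (norm (f n x * h x - u x * h x))
        \<le> ennreal (\<delta> * M) * indicator K x + ennreal (M / \<delta> ^ p) * ennreal (\<bar>f n x - u x\<bar> ^ Suc p)" for x
    proof -
      let ?d = "\<bar>f n x - u x\<bar>"
      have "norm (f n x * h x - u x * h x) = ?d * \<bar>h x\<bar>"
        by (simp add: abs_mult left_diff_distrib[symmetric])
      also have "\<dots> \<le> (\<delta> + ?d ^ Suc p / \<delta> ^ p) * (M * indicat_real K x)"
        using M that le_add_power_div[OF _ that, of ?d p]
        by (intro mult_mono) (auto simp: K_def indicator_def intro!: add_nonneg_nonneg)
      also have "\<dots> \<le> \<delta> * M * indicat_real K x + M / \<delta> ^ p * ?d ^ Suc p"
        using M that by (auto simp: indicator_def field_simps)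
      finally have "ennreal (norm (f n x * h x - u x * h x))
          \<le> ennreal (\<delta> * M * indicat_real K x + M / \<delta> ^ p * ?d ^ Suc p)"
        by (rule ennreal_leI)
      also have "\<dots> = ennreal (\<delta> * M) * indicator K x + ennreal (M / \<delta> ^ p) * ennreal (?d ^ Suc p)"
      proof -
        have "ennreal (M / \<delta> ^ p * ?d ^ Suc p) = ennreal (M / \<delta> ^ p) * ennreal (?d ^ Suc p)"
          using M that by (intro ennreal_mult) auto
        moreover have "ennreal (\<delta> * M * indicat_real K x) = ennreal (\<delta> * M) * indicator K x"
          by (simp add: indicator_def)
        ultimately show ?thesis
          using M that by (subst ennreal_plus) (auto simp del: power_Suc)
      qed
      finally show ?thesis .
    qed
    then have "(\<integral>\<^sup>+x. norm (f n x * h x - u x * h x) \<partial>lebesgue) \<le>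
        (\<integral>\<^sup>+x. ennreal (\<delta> * M) * indicator K x + ennreal (M / \<delta> ^ p) * ennreal (\<bar>f n x - u x\<bar> ^ Suc p) \<partial>lebesgue)"
      by (intro nn_integral_mono)
    also have "\<dots> = ennreal (\<delta> * M) * emeasure lebesgue K + ennreal (M / \<delta> ^ p) * I n"
      unfolding I_def by (subst nn_integral_add) (auto simp: nn_integral_cmult simp del: power_Suc)
    also have "\<dots> = ennreal (\<delta> * M * c) + ennreal (M / \<delta> ^ p) * I n"
      using c M that by (simp add: ennreal_mult)
    finally show ?thesis .
  qed
  have lim0: "(\<lambda>n. \<integral>\<^sup>+x. norm (f n x * h x - u x * h x) \<partial>lebesgue) \<longlonglongrightarrow> 0"
  proof (rule order_tendstoI)
    fix e :: ennreal assume "0 < e"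
    \<comment> \<open>\<open>e\<close> may be infinite; a value strictly between 0 and
      \<open>e\<close> is finite and yields a real number.\<close>
    then obtain d where d: "0 < d" "d < e"
      using dense by blast
    have "d < \<infinity>"
      using d(2) by (rule less_le_trans) simp
    define r where "r = enn2real d"
    have r: "0 < r" "ennreal r < e"
      using d \<open>d < \<infinity>\<close> by (simp_all add: r_def enn2real_positive_iff)
    \<comment> \<open>Makes \<delta> M c at most r/2; the added 1 keeps the denominator positive
      when c = 0.\<close>
    define \<delta> where "\<delta> = r / 2 / (M * c + 1)"
    have "0 < M * c + 1"
      using M c by (simp add: add_nonneg_pos)
    then have \<delta>: "0 < \<delta>" "\<delta> * M * c \<le> r / 2"
      using r by (simp_all add: \<delta>_def field_simps)
    have "(\<lambda>n. ennreal (M / \<delta> ^ p) * I n) \<longlonglongrightarrow> ennreal (M / \<delta> ^ p) * 0"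
      using lim unfolding I_def by (intro ennreal_tendsto_cmult) auto
    then have "\<forall>\<^sub>F n in sequentially. ennreal (M / \<delta> ^ p) * I n < ennreal (r / 2)"
      using r by (intro order_tendstoD(2)) auto
    then show "\<forall>\<^sub>F n in sequentially. (\<integral>\<^sup>+x. norm (f n x * h x - u x * h x) \<partial>lebesgue) < e"
    proof eventually_elim
      case (elim n)
      have "(\<integral>\<^sup>+x. norm (f n x * h x - u x * h x) \<partial>lebesgue) \<le> ennreal (\<delta> * M * c) + ennreal (M / \<delta> ^ p) * I n"
        by (rule bound[OF \<delta>(1)])
      also have "\<dots> \<le> ennreal (r / 2) + ennreal (r / 2)"
        using elim \<delta>(2) by (intro add_mono ennreal_leI) auto
      also have "\<dots> = ennreal r"
        using r by (simp flip: ennreal_plus)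
      finally show ?case using r(2) by simp
    qed
  qed simp
  obtain n where "(\<integral>\<^sup>+x. norm (f n x * h x - u x * h x) \<partial>lebesgue) < 1"
    using order_tendstoD(2)[OF lim0, of 1] by (auto simp: eventually_sequentially)
  then have "integrable lebesgue (\<lambda>x. f n x * h x - u x * h x)"
    by (intro integrableI_bounded) (auto intro: less_trans)
  from Bochner_Integration.integrable_diff[OF int[of n] this]
  show i: "integrable lebesgue (\<lambda>x. u x * h x)" by simp
  show "(\<lambda>n. \<integral>x. f n x * h x \<partial>lebesgue) \<longlonglongrightarrow> (\<integral>x. u x * h x \<partial>lebesgue)"
    by (rule tendsto_L1_int[OF int i lim0])
qed

lemma measurable_vec_nth_lebesgue:
  fixes G :: "real^'m::finite \<Rightarrow> real^'n::finite"
  assumes "G \<in> borel_measurable lebesgue"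
  shows "(\<lambda>x. vec_nth (G x) i) \<in> borel_measurable lebesgue"
  using measurable_compose[OF assms, of "\<lambda>y. vec_nth y i" borel]
  by (simp add: borel_measurable_continuous_onI continuous_on_component continuous_on_id)

lemma continuous_grad:
  fixes f :: "real^'n::finite \<Rightarrow> real"
  assumes "Ck 1 f"
  shows "continuous_on UNIV (grad f)"
  using assms unfolding grad_def[abs_def] by (intro continuous_on_vec_lambda) simp

text \<open>Eliminates the weak gradient: both derivatives fall on \<phi>. The approximants satisfy
  the identity by parts, component by component; L^2 convergence of gradients and L^4 convergence of
  functions pass to the limit against the compactly supported derivatives of \<phi>.\<close>

lemma D12_gradient_integral:
  assumes u: "D12_gradient u G" and \<phi>: "\<phi> \<in> Cc_infty"
  shows "(\<integral>x. inner (G x) (grad \<phi> x) \<partial>lebesgue) = - (\<integral>x. u x * laplacian \<phi> x \<partial>lebesgue)"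
proof -
  from u have mu: "u \<in> borel_measurable lebesgue" and mG: "G \<in> borel_measurable lebesgue"
    by (auto simp: D12_gradient_def)
  from u obtain f where f: "\<And>n. f n \<in> Cc_infty"
    and lu: "(\<lambda>n. \<integral>\<^sup>+x. ennreal (\<bar>f n x - u x\<bar> ^ 4) \<partial>lebesgue) \<longlonglongrightarrow> 0"
    and lG: "(\<lambda>n. \<integral>\<^sup>+x. ennreal (norm (grad (f n) x - G x) ^ 2) \<partial>lebesgue) \<longlonglongrightarrow> 0"
    by (auto simp: D12_gradient_def)
  have comp: "integrable lebesgue (\<lambda>x. vec_nth (G x) i * partial_deriv i \<phi> x) \<and>
      integrable lebesgue (\<lambda>x. u x * partial_deriv i (partial_deriv i \<phi>) x) \<and>
      (\<integral>x. vec_nth (G x) i * partial_deriv i \<phi> x \<partial>lebesgue)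
        = - (\<integral>x. u x * partial_deriv i (partial_deriv i \<phi>) x \<partial>lebesgue)" for i
  proof -
    note d1 = Cc_infty_partial_deriv[OF \<phi>, of i]
    note d2 = Cc_infty_partial_deriv[OF d1, of i]
    note fd = Cc_infty_partial_deriv[OF f, of i]
    note bp = integral_by_parts[OF Cc_infty_D(2)[OF f] Cc_infty_D(3)[OF fd]
        Cc_infty_D(2)[OF d1] Cc_infty_D(3)[OF d2] Cc_infty_D(4)[OF d1] Cc_infty_D(4)[OF d2]]
    have "(\<lambda>n. \<integral>\<^sup>+x. ennreal (\<bar>partial_deriv i (f n) x - vec_nth (G x) i\<bar> ^ Suc 1) \<partial>lebesgue) \<longlonglongrightarrow> 0"
    proof (rule tendsto_sandwich[OF _ _ tendsto_const lG])
      have "\<bar>partial_deriv i (f n) x - vec_nth (G x) i\<bar> \<le> norm (grad (f n) x - G x)" for n x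
        using component_le_norm_cart[of "grad (f n) x - G x" i] by (simp add: grad_nth)
      then show "\<forall>\<^sub>F n in sequentially. (\<integral>\<^sup>+x. ennreal (\<bar>partial_deriv i (f n) x - vec_nth (G x) i\<bar> ^ Suc 1) \<partial>lebesgue)
          \<le> (\<integral>\<^sup>+x. ennreal (norm (grad (f n) x - G x) ^ 2) \<partial>lebesgue)"
        by (intro always_eventually allI nn_integral_mono ennreal_leI)
          (simp add: numeral_2_eq_2 power_mono del: power_Suc)
    qed simp
    note G = tendsto_integral_compact_support[OF continuous_imp_measurable_lebesgue[OF Cc_infty_D(3)[OF fd]]
        measurable_vec_nth_lebesgue[OF mG] Cc_infty_D(3)[OF d1] Cc_infty_D(4)[OF d1] this bp(2)]
    have "(\<lambda>n. \<integral>\<^sup>+x. ennreal (\<bar>f n x - u x\<bar> ^ Suc 3) \<partial>lebesgue) \<longlonglongrightarrow> 0"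
      using lu by simp
    note U = tendsto_integral_compact_support[OF continuous_imp_measurable_lebesgue[OF Cc_infty_D(3)[OF f]]
        mu Cc_infty_D(3)[OF d2] Cc_infty_D(4)[OF d2] this bp(1)]
    have "(\<integral>x. u x * partial_deriv i (partial_deriv i \<phi>) x \<partial>lebesgue)
        = - (\<integral>x. vec_nth (G x) i * partial_deriv i \<phi> x \<partial>lebesgue)"
      using LIMSEQ_unique[OF U(2)] tendsto_minus[OF G(2)] by (simp add: bp(3))
    with G(1) U(1) show ?thesis by simp
  qed
  have "(\<integral>x. inner (G x) (grad \<phi> x) \<partial>lebesgue) = (\<integral>x. (\<Sum>i\<in>UNIV. vec_nth (G x) i * partial_deriv i \<phi> x) \<partial>lebesgue)"
    by (simp add: inner_vec_def grad_nth)
  also have "\<dots> = - (\<Sum>i\<in>UNIV. \<integral>x. u x * partial_deriv i (partial_deriv i \<phi>) x \<partial>lebesgue)"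
    using comp by (subst Bochner_Integration.integral_sum) (auto simp: sum_negf)
  also have "(\<Sum>i\<in>UNIV. \<integral>x. u x * partial_deriv i (partial_deriv i \<phi>) x \<partial>lebesgue)
      = (\<integral>x. u x * laplacian \<phi> x \<partial>lebesgue)"
    using comp by (subst Bochner_Integration.integral_sum[symmetric]) (auto simp: laplacian_def sum_distrib_left)
  finally show ?thesis .
qed

lemma power4_add_le:
  fixes a b :: real
  shows "(a + b) ^ 4 \<le> 8 * (a ^ 4 + b ^ 4)"
proof -
  have sq: "(a + b)\<^sup>2 \<le> 2 * (a\<^sup>2 + b\<^sup>2)" for a b :: real
    using sum_squares_bound[of a b] by (simp add: power2_sum)
  have "((a + b)\<^sup>2)\<^sup>2 \<le> (2 * (a\<^sup>2 + b\<^sup>2))\<^sup>2"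
    by (intro power_mono sq) auto
  also have "\<dots> = 4 * (a\<^sup>2 + b\<^sup>2)\<^sup>2"
    by (subst power_mult_distrib) simp
  also have "\<dots> \<le> 4 * (2 * ((a\<^sup>2)\<^sup>2 + (b\<^sup>2)\<^sup>2))"
    by (intro mult_left_mono sq) auto
  finally show ?thesis
    by (simp flip: power_mult)
qed

text \<open>Some approximant has finite L^4 distance from u and is itself continuous with bounded
  support; (a+b)^4 \<le> 8(a^4+b^4) then gives the bound for u.\<close>

lemma D12_gradient_L4:
  assumes "D12_gradient u G"
  shows "integrable lebesgue (\<lambda>x. u x ^ 4)"
proof -
  from assms have [measurable]: "u \<in> borel_measurable lebesgue"
    by (auto simp: D12_gradient_def)
  from assms obtain f where f: "\<And>n. f n \<in> Cc_infty"
    and lu: "(\<lambda>n. \<integral>\<^sup>+x. ennreal (\<bar>f n x - u x\<bar> ^ 4) \<partial>lebesgue) \<longlonglongrightarrow> 0"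
    by (auto simp: D12_gradient_def)
  obtain n where n: "(\<integral>\<^sup>+x. ennreal (\<bar>f n x - u x\<bar> ^ 4) \<partial>lebesgue) < 1"
    using order_tendstoD(2)[OF lu, of 1] by (auto simp: eventually_sequentially)
  note cf = Cc_infty_D(3)[OF f[of n]]
  have [measurable]: "f n \<in> borel_measurable lebesgue"
    by (rule continuous_imp_measurable_lebesgue[OF cf])
  have "integrable lebesgue (\<lambda>x. \<bar>f n x - u x\<bar> ^ 4)"
    using n by (intro integrableI_bounded) (auto intro: less_trans)
  moreover have "integrable lebesgue (\<lambda>x. f n x ^ 4)"
    using Cc_infty_D(4)[OF f[of n]] by (intro integrable_compact_support continuous_intros cf) simp
  ultimately have "integrable lebesgue (\<lambda>x. 8 * (\<bar>f n x - u x\<bar> ^ 4 + f n x ^ 4))"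
    by (intro integrable_mult_right Bochner_Integration.integrable_add)
  then show ?thesis
  proof (rule Bochner_Integration.integrable_bound)
    have "u x ^ 4 \<le> 8 * (\<bar>f n x - u x\<bar> ^ 4 + f n x ^ 4)" for x
      using power4_add_le[of "u x - f n x" "f n x"] by (simp add: abs_minus_commute[of "f n x" "u x"])
    then show "AE x in lebesgue. norm (u x ^ 4) \<le> norm (8 * (\<bar>f n x - u x\<bar> ^ 4 + f n x ^ 4))"
      by (simp add: abs_mult)
  qed measurable
qed

lemma D12_gradient_cong_AE:
  assumes u: "D12_gradient u G" and ae: "AE x in lebesgue. u' x = u x"
  shows "D12_gradient u' G"
proof -
  have "AE x in lebesgue. u x = u' x"
    using ae by eventually_elim simp
  then have "u' \<in> borel_measurable lebesgue"
    by (rule borel_measurable_AE[rotated]) (use u in \<open>simp add: D12_gradient_def\<close>)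
  moreover have "(\<integral>\<^sup>+x. ennreal (\<bar>\<phi> x - u' x\<bar> ^ 4) \<partial>lebesgue) = (\<integral>\<^sup>+x. ennreal (\<bar>\<phi> x - u x\<bar> ^ 4) \<partial>lebesgue)"
    for \<phi> :: "real^4 \<Rightarrow> real"
    using ae by (intro nn_integral_cong_AE) auto
  ultimately show ?thesis
    using u by (simp add: D12_gradient_def)
qed

text \<open>Lets families known only up to null sets inherit the equation from their smooth
  representatives.\<close>

lemma weak_solution_D12_cong_AE:
  assumes w: "weak_solution_D12 u f"
    and u: "AE x in lebesgue. u' x = u x" and f: "AE x in lebesgue. f' x = f x"
    and m: "f \<in> borel_measurable lebesgue"
  shows "weak_solution_D12 u' f'"
proof -
  have "AE x in lebesgue. f x = f' x"
    using f by eventually_elim simp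
  with m have m': "f' \<in> borel_measurable lebesgue"
    by (rule borel_measurable_AE)
  have "(\<integral>x. f' x * \<phi> x \<partial>lebesgue) = (\<integral>x. f x * \<phi> x \<partial>lebesgue)" if "\<phi> \<in> Cc_infty" for \<phi>
  proof (rule integral_cong_AE)
    have "\<phi> \<in> borel_measurable lebesgue"
      by (rule continuous_imp_measurable_lebesgue[OF Cc_infty_D(3)[OF that]])
    with m m' show "(\<lambda>x. f' x * \<phi> x) \<in> borel_measurable lebesgue" "(\<lambda>x. f x * \<phi> x) \<in> borel_measurable lebesgue"
      by measurable
  qed (use f in auto)
  moreover obtain G where "D12_gradient u G"
    "\<forall>\<phi>\<in>Cc_infty. (\<integral>x. inner (G x) (grad \<phi> x) \<partial>lebesgue) = (\<integral>x. f x * \<phi> x \<partial>lebesgue)"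
    using w by (auto simp: weak_solution_D12_def)
  ultimately show ?thesis
    unfolding weak_solution_D12_def using D12_gradient_cong_AE[OF _ u] by (intro exI[of _ G]) simp
qed

subsection \<open>Cutting off\<close>

text \<open>The truncation happens at |x| of order sqrt n. The profile stays below 1 everywhere, so
  convergence to 1 is merely pointwise, and limits are taken by dominated convergence.\<close>

definition cutoff :: "nat \<Rightarrow> real^4 \<Rightarrow> real" where
  "cutoff n x = flat 0 (real n * conf x - 1)"

text \<open>With \<open>t = n * conf x - 1\<close> the two functions below are \<open>(t + 1) \<chi>'\<close> and \<open>(t + 1)\<^sup>2 \<chi>''\<close> for the
  profile \<open>\<chi> = flat 0\<close>: differentiating the cutoff costs no power of \<open>n\<close>.\<close>

definition cutoff' :: "nat \<Rightarrow> real^4 \<Rightarrow> real" where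
  "cutoff' n x = flat 1 (real n * conf x - 1) + flat 2 (real n * conf x - 1)"

definition cutoff'' :: "nat \<Rightarrow> real^4 \<Rightarrow> real" where
  "cutoff'' n x = flat 4 (real n * conf x - 1) - 3 * flat 2 (real n * conf x - 1) - 2 * flat 1 (real n * conf x - 1)"

text \<open>From \<open>flat k\<close> \<le> k!: the constants are 3 = 1 + 2 and 32 = 24 + 3 * 2 + 2
  * 1.\<close>

lemma cutoff_bounds: "0 \<le> cutoff n x" "cutoff n x \<le> 1" "\<bar>cutoff' n x\<bar> \<le> 3" "\<bar>cutoff'' n x\<bar> \<le> 32"
proof -
  define t where "t = real n * conf x - 1"
  have 1: "flat 0 t \<le> 1" "flat 1 t \<le> 1" "flat 2 t \<le> 2" "flat 4 t \<le> 24"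
    using flat_le_fact[of 0 t] flat_le_fact[of 1 t] flat_le_fact[of 2 t] flat_le_fact[of 4 t]
    by (simp_all add: fact_numeral)
  note 0 = flat_nonneg[of 0 t] flat_nonneg[of 1 t] flat_nonneg[of 2 t] flat_nonneg[of 4 t]
  show "0 \<le> cutoff n x" "cutoff n x \<le> 1" "\<bar>cutoff' n x\<bar> \<le> 3" "\<bar>cutoff'' n x\<bar> \<le> 32"
    unfolding cutoff_def cutoff'_def cutoff''_def t_def[symmetric] using 0 1 by linarith+
qed

lemma cutoff_tendsto:
  "(\<lambda>n. cutoff n x) \<longlonglongrightarrow> 1" "(\<lambda>n. cutoff' n x) \<longlonglongrightarrow> 0" "(\<lambda>n. cutoff'' n x) \<longlonglongrightarrow> 0"
proof -
  have "filterlim (\<lambda>n. -1 + real n * conf x) at_top sequentially"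
    by (intro filterlim_tendsto_add_at_top[OF tendsto_const] filterlim_at_top_mult_tendsto_pos[OF tendsto_const conf_pos]
        filterlim_real_sequentially)
  then have t: "filterlim (\<lambda>n. real n * conf x - 1) at_top sequentially"
    by simp
  have f: "(\<lambda>n. flat k (real n * conf x - 1)) \<longlonglongrightarrow> (if k = 0 then 1 else 0)" for k
    by (rule filterlim_compose[OF flat_tendsto t])
  show "(\<lambda>n. cutoff n x) \<longlonglongrightarrow> 1" "(\<lambda>n. cutoff' n x) \<longlonglongrightarrow> 0" "(\<lambda>n. cutoff'' n x) \<longlonglongrightarrow> 0"
    unfolding cutoff_def cutoff'_def cutoff''_def
    using f[of 0] tendsto_add[OF f[of 1] f[of 2]]
      tendsto_diff[OF tendsto_diff[OF f[of 4] tendsto_mult_left[OF f[of 2], of 3]] tendsto_mult_left[OF f[of 1], of 2]]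
    by simp_all
qed

lemma grad_conf: "grad conf x = (- 2 * (conf x)\<^sup>2) *\<^sub>R x"
  by (simp add: Finite_Cartesian_Product.vec_eq_iff grad_nth partial_deriv_eq[OF conf_has_derivative] inner_axis)

lemma laplacian_conf: "laplacian conf x = - 8 * conf x ^ 3"
  using laplacian_bubble[of 1 x] by (simp add: conf_def[abs_def] power2_norm_eq_inner power_divide)

lemma Ck_conf: "Ck k conf"
  by (rule test_alg_Ck[OF test_alg.conf])

lemma cutoff_Ck: "Ck k (cutoff n)"
  unfolding cutoff_def[abs_def] by (rule test_alg_Ck[OF test_alg.flat])

lemma cutoff_profile_derivs:
  fixes n :: nat
  defines "h' \<equiv> \<lambda>c. real n * flat 2 (real n * c - 1)"
    and "h'' \<equiv> \<lambda>c. (real n)\<^sup>2 * (flat 4 (real n * c - 1) - 2 * flat 3 (real n * c - 1))"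
  shows "((\<lambda>c. flat 0 (real n * c - 1)) has_real_derivative h' c) (at c)"
    "(h' has_real_derivative h'' c) (at c)"
proof -
  have l: "((\<lambda>c. real n * c - 1) has_real_derivative real n) (at c)"
    by (auto intro!: derivative_eq_intros)
  show "((\<lambda>c. flat 0 (real n * c - 1)) has_real_derivative h' c) (at c)"
    using DERIV_chain2[OF flat_has_real_derivative[of 0] l] by (simp add: h'_def mult.commute numeral_2_eq_2)
  have "((\<lambda>c. flat 2 (real n * c - 1)) has_real_derivative
      (flat 4 (real n * c - 1) - 2 * flat 3 (real n * c - 1)) * real n) (at c)"
    using DERIV_chain2[OF flat_has_real_derivative[of 2] l] by simp
  from DERIV_cmult[OF this, of "real n"]
  show "(h' has_real_derivative h'' c) (at c)"
    unfolding h'_def h''_def by (rule DERIV_cong) (simp add: power2_eq_square)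
qed

text \<open>Here t + 1 stands for n times \<open>conf\<close>. The chain rule yields n and n^2 only
  together with \<open>conf\<close> and its square, and a factor t lowers the index of
  \<open>flat\<close>; so the powers of n are absorbed into bounded profiles.\<close>

lemma cutoff_scaled:
  fixes t :: real
  shows "(t + 1) * flat 2 t = flat 1 t + flat 2 t"
    "(t + 1)\<^sup>2 * (flat 4 t - 2 * flat 3 t) = flat 4 t - 3 * flat 2 t - 2 * flat 1 t"
proof -
  have f: "t * flat 2 t = flat 1 t" "t * flat 3 t = flat 2 t" "t * flat 4 t = flat 3 t"
    by (simp_all add: flat_def power2_eq_square power3_eq_cube power4_eq_xxxx)
  show "(t + 1) * flat 2 t = flat 1 t + flat 2 t"
    by (simp add: distrib_right f)
  have "(t + 1)\<^sup>2 * (flat 4 t - 2 * flat 3 t)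
      = t * (t * flat 4 t) + 2 * (t * flat 4 t) + flat 4 t - 2 * (t * (t * flat 3 t)) - 4 * (t * flat 3 t) - 2 * flat 3 t"
    by (simp add: power2_eq_square algebra_simps)
  also have "\<dots> = flat 4 t - 3 * flat 2 t - 2 * flat 1 t"
    by (simp add: f)
  finally show "(t + 1)\<^sup>2 * (flat 4 t - 2 * flat 3 t) = flat 4 t - 3 * flat 2 t - 2 * flat 1 t" .
qed

lemma grad_cutoff: "grad (cutoff n) x = (- 2 * conf x * cutoff' n x) *\<^sub>R x"
proof -
  have "grad (cutoff n) x = (real n * flat 2 (real n * conf x - 1)) *\<^sub>R grad conf x"
    unfolding cutoff_def[abs_def]
    by (rule grad_compose[OF cutoff_profile_derivs(1)]) (rule Ck_2_D(1)[OF Ck_conf])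
  also have "\<dots> = (- 2 * conf x * ((real n * conf x - 1 + 1) * flat 2 (real n * conf x - 1))) *\<^sub>R x"
    by (simp add: grad_conf power2_eq_square mult.commute mult.left_commute)
  finally show ?thesis
    by (simp only: cutoff_scaled(1) cutoff'_def)
qed

lemma laplacian_cutoff:
  "laplacian (cutoff n) x = 4 * conf x * (1 - conf x) * cutoff'' n x - 8 * (conf x)\<^sup>2 * cutoff' n x"
proof -
  let ?t = "real n * conf x - 1"
  have "laplacian (cutoff n) x = real n * flat 2 ?t * laplacian conf x
      + (real n)\<^sup>2 * (flat 4 ?t - 2 * flat 3 ?t) * inner (grad conf x) (grad conf x)"
    unfolding cutoff_def[abs_def]
    by (rule laplacian_compose[OF cutoff_profile_derivs Ck_conf])
  also have "inner (grad conf x) (grad conf x) = 4 * conf x ^ 3 * (conf x * inner x x)"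
    by (simp add: grad_conf power2_eq_square power3_eq_cube)
  also have "\<dots> = 4 * conf x ^ 3 * (1 - conf x)"
    by (simp only: conf_mult_inner)
  also have "real n * flat 2 ?t * laplacian conf x
      + (real n)\<^sup>2 * (flat 4 ?t - 2 * flat 3 ?t) * (4 * conf x ^ 3 * (1 - conf x))
    = 4 * conf x * (1 - conf x) * ((?t + 1)\<^sup>2 * (flat 4 ?t - 2 * flat 3 ?t)) - 8 * (conf x)\<^sup>2 * ((?t + 1) * flat 2 ?t)"
    by (simp add: laplacian_conf power_mult_distrib) (simp add: power2_eq_square power3_eq_cube)
  finally show ?thesis
    by (simp only: cutoff_scaled cutoff'_def cutoff''_def)
qed

text \<open>Sorted by profile, the coefficients are free of n; the last two terms therefore vanish
  pointwise as n grows.\<close>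

lemma laplacian_cutoff_mult:
  assumes f: "Ck 2 f"
  shows "laplacian (\<lambda>x. cutoff n x * f x) x = cutoff n x * laplacian f x
    - cutoff' n x * (4 * conf x * inner x (grad f x) + 8 * (conf x)\<^sup>2 * f x)
    + cutoff'' n x * (4 * conf x * (1 - conf x) * f x)"
proof -
  have "laplacian (\<lambda>x. cutoff n x * f x) x = cutoff n x * laplacian f x
      + 2 * inner (grad (cutoff n) x) (grad f x) + f x * laplacian (cutoff n) x"
    by (rule laplacian_mult[OF cutoff_Ck f])
  also have "\<dots> = cutoff n x * laplacian f x + 2 * (- 2 * conf x * cutoff' n x * inner x (grad f x))
      + f x * (4 * conf x * (1 - conf x) * cutoff'' n x - 8 * (conf x)\<^sup>2 * cutoff' n x)"
    by (simp only: grad_cutoff laplacian_cutoff inner_scaleR_left)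
  finally show ?thesis
    by (simp add: algebra_simps)
qed

lemma conf_measurable [measurable]: "conf \<in> borel_measurable lebesgue"
  by (rule continuous_imp_measurable_lebesgue[OF conf_continuous])

lemma cutoff_measurable [measurable]:
  "cutoff n \<in> borel_measurable lebesgue" "cutoff' n \<in> borel_measurable lebesgue"
  "cutoff'' n \<in> borel_measurable lebesgue"
proof -
  have *: "(\<lambda>x. flat k (real n * conf x - 1)) \<in> borel_measurable lebesgue" for k
    by (intro continuous_imp_measurable_lebesgue differentiable_imp_continuous_on
        test_alg_differentiable[OF test_alg.flat])
  note [measurable] = *[of 0] *[of 1] *[of 2] *[of 4]
  show "cutoff n \<in> borel_measurable lebesgue" "cutoff' n \<in> borel_measurable lebesgue"
    "cutoff'' n \<in> borel_measurable lebesgue"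
    unfolding cutoff_def[abs_def] cutoff'_def[abs_def] cutoff''_def[abs_def] by measurable
qed

lemma bubble_eq: "bubble x = sqrt 8 * conf x"
  by (simp add: bubble_def alpha4_eq conf_def power2_norm_eq_inner)

lemma bubble_power2: "(bubble x)\<^sup>2 = 8 * (conf x)\<^sup>2"
  by (simp add: bubble_eq power_mult_distrib)

section \<open>Decaying test functions and classical solutions\<close>

lemma Ck_laplacian_continuous: "Ck 2 f \<Longrightarrow> continuous_on UNIV (laplacian f)"
  unfolding laplacian_def[abs_def] by (intro continuous_intros Ck_2_D(3))

text \<open>The weak equation may be tested with functions decaying like \<open>conf\<close>: in \<open>laplacian (cutoff n * f)\<close>
  all terms are bounded by a constant times \<open>conf\<^sup>2\<close>, uniformly in \<open>n\<close>.\<close>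

lemma weak_solution_test:
  assumes weak: "weak_solution_D12 v (\<lambda>x. g x * (bubble x)\<^sup>2)"
    and g [measurable]: "g \<in> borel_measurable lebesgue" and g4: "integrable lebesgue (\<lambda>x. g x ^ 4)"
    and f: "\<And>N. f \<in> test_alg N" and C: "0 \<le> C"
    and b0: "\<And>x. \<bar>f x\<bar> \<le> C * conf x"
    and b1: "\<And>x. \<bar>inner x (grad f x)\<bar> \<le> C * conf x"
    and b2: "\<And>x. \<bar>laplacian f x\<bar> \<le> C * (conf x)\<^sup>2"
  shows "(\<integral>x. v x * laplacian f x \<partial>lebesgue) = - (\<integral>x. 8 * g x * (conf x)\<^sup>2 * f x \<partial>lebesgue)"
proof -
  obtain G where G: "D12_gradient v G"
    and eq: "\<And>\<phi>. \<phi> \<in> Cc_infty \<Longrightarrow>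
      (\<integral>x. inner (G x) (grad \<phi> x) \<partial>lebesgue) = (\<integral>x. (g x * (bubble x)\<^sup>2) * \<phi> x \<partial>lebesgue)"
    using weak by (auto simp: weak_solution_D12_def)
  have v [measurable]: "v \<in> borel_measurable lebesgue"
    using G by (simp add: D12_gradient_def)
  note v4 = D12_gradient_L4[OF G]
  have Ckf: "Ck 2 f"
    by (rule test_alg_Ck[OF f])
  have f_meas [measurable]: "f \<in> borel_measurable lebesgue"
    by (intro continuous_imp_measurable_lebesgue differentiable_imp_continuous_on Ck_2_D(1)[OF Ckf])
  have lf_meas [measurable]: "laplacian f \<in> borel_measurable lebesgue"
    by (intro continuous_imp_measurable_lebesgue Ck_laplacian_continuous Ckf)
  define \<phi> where "\<phi> n x = cutoff n x * f x" for n x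
  have \<phi>: "\<phi> n \<in> Cc_infty" for n
    unfolding \<phi>_def[abs_def] cutoff_def by (rule cutoff_in_Cc_infty[OF f])
  have "Ck 2 (\<phi> n)" for n
    using \<phi>[of n] by (rule Cc_infty_D)
  then have [measurable]: "laplacian (\<phi> n) \<in> borel_measurable lebesgue" for n
    by (intro continuous_imp_measurable_lebesgue Ck_laplacian_continuous)
  have lap: "laplacian (\<phi> n) x = cutoff n x * laplacian f x
    - cutoff' n x * (4 * conf x * inner x (grad f x) + 8 * (conf x)\<^sup>2 * f x)
    + cutoff'' n x * (4 * conf x * (1 - conf x) * f x)" for n x
    unfolding \<phi>_def[abs_def] by (rule laplacian_cutoff_mult[OF Ckf])
  \<comment> \<open>165 = 1 + 3 * 12 + 32 * 4, with 3 and 32 from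
    \<open>cutoff_bounds\<close>.\<close>
  have lap_bound: "\<bar>laplacian (\<phi> n) x\<bar> \<le> 165 * C * (conf x)\<^sup>2" for n x
  proof -
    note c = conf_pos[of x] conf_le_1[of x]
    have "\<bar>cutoff n x * laplacian f x\<bar> \<le> 1 * (C * (conf x)\<^sup>2)"
      unfolding abs_mult using cutoff_bounds(1,2)[of n x] b2[of x] by (intro mult_mono) auto
    moreover have "\<bar>4 * conf x * inner x (grad f x)\<bar> \<le> 4 * C * (conf x)\<^sup>2"
    proof -
      have "\<bar>4 * conf x * inner x (grad f x)\<bar> = 4 * conf x * \<bar>inner x (grad f x)\<bar>"
        using c by (simp add: abs_mult)
      also have "\<dots> \<le> 4 * conf x * (C * conf x)"
        using c b1[of x] by (intro mult_left_mono) auto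
      finally show ?thesis by (simp add: power2_eq_square ac_simps)
    qed
    moreover have cf: "conf x * \<bar>f x\<bar> \<le> C * (conf x)\<^sup>2"
      using mult_left_mono[OF b0[of x], of "conf x"] c by (simp add: power2_eq_square mult.left_commute)
    moreover have "\<bar>8 * (conf x)\<^sup>2 * f x\<bar> \<le> 8 * C * (conf x)\<^sup>2"
    proof -
      have "\<bar>8 * (conf x)\<^sup>2 * f x\<bar> = 8 * (conf x * (conf x * \<bar>f x\<bar>))"
        using c by (simp add: abs_mult power2_eq_square)
      also have "\<dots> \<le> 8 * (1 * (C * (conf x)\<^sup>2))"
        using c C by (intro mult_left_mono mult_mono[OF _ cf]) auto
      finally show ?thesis by simp
    qed
    ultimately have t2: "\<bar>4 * conf x * inner x (grad f x) + 8 * (conf x)\<^sup>2 * f x\<bar> \<le> 12 * C * (conf x)\<^sup>2"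
      by linarith
    have "\<bar>4 * conf x * (1 - conf x) * f x\<bar> = 4 * ((1 - conf x) * (conf x * \<bar>f x\<bar>))"
      using c by (simp add: abs_mult)
    also have "\<dots> \<le> 4 * (1 * (C * (conf x)\<^sup>2))"
      using c C by (intro mult_left_mono mult_mono[OF _ cf]) auto
    finally have t3: "\<bar>4 * conf x * (1 - conf x) * f x\<bar> \<le> 4 * C * (conf x)\<^sup>2"
      by simp
    have "\<bar>cutoff' n x * (4 * conf x * inner x (grad f x) + 8 * (conf x)\<^sup>2 * f x)\<bar> \<le> 3 * (12 * C * (conf x)\<^sup>2)"
      unfolding abs_mult[of "cutoff' n x"] using t2 cutoff_bounds(3)[of n x] by (intro mult_mono) auto
    moreover have "\<bar>cutoff'' n x * (4 * conf x * (1 - conf x) * f x)\<bar> \<le> 32 * (4 * C * (conf x)\<^sup>2)"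
      unfolding abs_mult[of "cutoff'' n x"] using t3 cutoff_bounds(4)[of n x] by (intro mult_mono) auto
    moreover note \<open>\<bar>cutoff n x * laplacian f x\<bar> \<le> 1 * (C * (conf x)\<^sup>2)\<close>
    ultimately show ?thesis
      unfolding lap by linarith
  qed
  have "(\<lambda>n. \<integral>x. v x * laplacian (\<phi> n) x \<partial>lebesgue) \<longlonglongrightarrow> (\<integral>x. v x * laplacian f x \<partial>lebesgue)"
  proof (rule integral_dominated_convergence)
    show "integrable lebesgue (\<lambda>x. 165 * C * \<bar>v x * (conf x)\<^sup>2\<bar>)"
      by (intro integrable_mult_right integrable_abs integrable_L4_times_conf v v4)
    show "AE x in lebesgue. (\<lambda>n. v x * laplacian (\<phi> n) x) \<longlonglongrightarrow> v x * laplacian f x"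
    proof (rule AE_I2)
      fix x
      have "(\<lambda>n. v x * laplacian (\<phi> n) x) \<longlonglongrightarrow> v x * (1 * laplacian f x
          - 0 * (4 * conf x * inner x (grad f x) + 8 * (conf x)\<^sup>2 * f x) + 0 * (4 * conf x * (1 - conf x) * f x))"
        unfolding lap by (intro tendsto_intros cutoff_tendsto)
      then show "(\<lambda>n. v x * laplacian (\<phi> n) x) \<longlonglongrightarrow> v x * laplacian f x"
        by simp
    qed
    show "AE x in lebesgue. norm (v x * laplacian (\<phi> n) x) \<le> 165 * C * \<bar>v x * (conf x)\<^sup>2\<bar>" for n
    proof (rule AE_I2)
      fix x
      have "\<bar>v x\<bar> * \<bar>laplacian (\<phi> n) x\<bar> \<le> \<bar>v x\<bar> * (165 * C * (conf x)\<^sup>2)"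
        by (intro mult_left_mono lap_bound) auto
      then show "norm (v x * laplacian (\<phi> n) x) \<le> 165 * C * \<bar>v x * (conf x)\<^sup>2\<bar>"
        by (simp add: abs_mult ac_simps)
    qed
  qed measurable
  moreover have "(\<lambda>n. \<integral>x. 8 * g x * (conf x)\<^sup>2 * \<phi> n x \<partial>lebesgue) \<longlonglongrightarrow> (\<integral>x. 8 * g x * (conf x)\<^sup>2 * f x \<partial>lebesgue)"
  proof (rule integral_dominated_convergence)
    show "(\<lambda>x. 8 * g x * (conf x)\<^sup>2 * \<phi> n x) \<in> borel_measurable lebesgue" for n
      unfolding \<phi>_def by measurable
    show "integrable lebesgue (\<lambda>x. 8 * C * \<bar>g x * (conf x)\<^sup>2\<bar>)"
      by (intro integrable_mult_right integrable_abs integrable_L4_times_conf g g4)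
    show "AE x in lebesgue. (\<lambda>n. 8 * g x * (conf x)\<^sup>2 * \<phi> n x) \<longlonglongrightarrow> 8 * g x * (conf x)\<^sup>2 * f x"
    proof (rule AE_I2)
      fix x
      have "(\<lambda>n. 8 * g x * (conf x)\<^sup>2 * \<phi> n x) \<longlonglongrightarrow> 8 * g x * (conf x)\<^sup>2 * (1 * f x)"
        unfolding \<phi>_def by (intro tendsto_intros cutoff_tendsto)
      then show "(\<lambda>n. 8 * g x * (conf x)\<^sup>2 * \<phi> n x) \<longlonglongrightarrow> 8 * g x * (conf x)\<^sup>2 * f x"
        by simp
    qed
    show "AE x in lebesgue. norm (8 * g x * (conf x)\<^sup>2 * \<phi> n x) \<le> 8 * C * \<bar>g x * (conf x)\<^sup>2\<bar>" for n
    proof (rule AE_I2)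
      fix x
      have "C * conf x \<le> C * 1"
        using conf_le_1[of x] C by (intro mult_left_mono) auto
      then have "\<bar>\<phi> n x\<bar> \<le> 1 * C"
        unfolding \<phi>_def abs_mult using cutoff_bounds(1,2)[of n x] b0[of x]
        by (intro mult_mono) auto
      then have "\<bar>8 * g x * (conf x)\<^sup>2\<bar> * \<bar>\<phi> n x\<bar> \<le> \<bar>8 * g x * (conf x)\<^sup>2\<bar> * C"
        by (intro mult_left_mono) auto
      then show "norm (8 * g x * (conf x)\<^sup>2 * \<phi> n x) \<le> 8 * C * \<bar>g x * (conf x)\<^sup>2\<bar>"
        by (simp add: abs_mult ac_simps)
    qed
  qed measurable
  then have "(\<lambda>n. - (\<integral>x. 8 * g x * (conf x)\<^sup>2 * \<phi> n x \<partial>lebesgue)) \<longlonglongrightarrow> - (\<integral>x. 8 * g x * (conf x)\<^sup>2 * f x \<partial>lebesgue)"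
    by (rule tendsto_minus)
  moreover have "(\<integral>x. v x * laplacian (\<phi> n) x \<partial>lebesgue) = - (\<integral>x. 8 * g x * (conf x)\<^sup>2 * \<phi> n x \<partial>lebesgue)" for n
  proof -
    have "(\<integral>x. v x * laplacian (\<phi> n) x \<partial>lebesgue) = - (\<integral>x. inner (G x) (grad (\<phi> n) x) \<partial>lebesgue)"
      by (simp add: D12_gradient_integral[OF G \<phi>])
    also have "\<dots> = - (\<integral>x. 8 * g x * (conf x)\<^sup>2 * \<phi> n x \<partial>lebesgue)"
      unfolding eq[OF \<phi>] bubble_power2 by (simp add: ac_simps)
    finally show ?thesis .
  qed
  ultimately show ?thesis
    by (simp add: LIMSEQ_unique)
qed

text \<open>The hypotheses express the decay |x|^-2 of f and |x|^-3 of its gradient. Both |f|^4 and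
  the squared gradient are then dominated by a multiple of the integrable function conf^3.\<close>

lemma D12_gradient_classical:
  assumes f: "\<And>N. f \<in> test_alg N" and C: "0 \<le> C"
    and b0: "\<And>x. \<bar>f x\<bar> \<le> C * conf x"
    and b1: "\<And>x. (norm (grad f x))\<^sup>2 \<le> C * conf x ^ 3"
  shows "D12_gradient f (grad f)"
proof -
  have Ckf: "Ck k f" for k
    by (rule test_alg_Ck[OF f])
  have f_meas [measurable]: "f \<in> borel_measurable lebesgue"
    by (intro continuous_imp_measurable_lebesgue differentiable_imp_continuous_on Ck_2_D(1)[OF Ckf])
  have gf_meas [measurable]: "grad f \<in> borel_measurable lebesgue"
    by (intro continuous_imp_measurable_lebesgue continuous_grad Ckf)
  define \<phi> where "\<phi> n x = cutoff n x * f x" for n x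
  have \<phi>: "\<phi> n \<in> Cc_infty" for n
    unfolding \<phi>_def[abs_def] cutoff_def by (rule cutoff_in_Cc_infty[OF f])
  have \<phi>_meas [measurable]: "\<phi> n \<in> borel_measurable lebesgue" for n
    by (intro continuous_imp_measurable_lebesgue Cc_infty_D(3) \<phi>)
  have g\<phi>_meas [measurable]: "grad (\<phi> n) \<in> borel_measurable lebesgue" for n
    by (intro continuous_imp_measurable_lebesgue continuous_grad Cc_infty_D(1) \<phi>)
  have g\<phi>: "grad (\<phi> n) x = cutoff n x *\<^sub>R grad f x - (2 * conf x * cutoff' n x * f x) *\<^sub>R x" for n x
    unfolding \<phi>_def[abs_def]
    by (subst grad_mult[OF Ck_2_D(1)[OF cutoff_Ck] Ck_2_D(1)[OF Ckf]])
      (simp add: grad_cutoff ac_simps)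
  have "(\<lambda>n. \<integral>\<^sup>+x. ennreal (\<bar>\<phi> n x - f x\<bar> ^ 4) \<partial>lebesgue) \<longlonglongrightarrow> (\<integral>\<^sup>+x. 0 \<partial>(lebesgue :: (real^4) measure))"
  proof (rule nn_integral_dominated_convergence)
    have "integrable lebesgue (\<lambda>x. C ^ 4 * conf x ^ 3)"
      by (intro integrable_mult_right integrable_conf_power_3)
    then show "(\<integral>\<^sup>+x. ennreal (C ^ 4 * conf x ^ 3) \<partial>lebesgue) < \<infinity>"
      using C conf_pos by (subst nn_integral_eq_integral) (auto simp: less_imp_le)
    show "AE x in lebesgue. ennreal (\<bar>\<phi> n x - f x\<bar> ^ 4) \<le> ennreal (C ^ 4 * conf x ^ 3)" for n
    proof (intro AE_I2 ennreal_leI)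
      fix x
      have "\<bar>\<phi> n x - f x\<bar> = (1 - cutoff n x) * \<bar>f x\<bar>"
      proof -
        have "\<phi> n x - f x = - ((1 - cutoff n x) * f x)"
          by (simp add: \<phi>_def algebra_simps)
        then show ?thesis
          using cutoff_bounds(2)[of n x] by (simp add: abs_mult)
      qed
      also have "\<dots> \<le> 1 * (C * conf x)"
        using cutoff_bounds(1,2)[of n x] b0[of x] by (intro mult_mono) auto
      finally have "\<bar>\<phi> n x - f x\<bar> ^ 4 \<le> (C * conf x) ^ 4"
        by (intro power_mono) auto
      also have "\<dots> = C ^ 4 * conf x ^ 3 * conf x"
        by (simp add: power_mult_distrib power3_eq_cube power4_eq_xxxx)
      also have "\<dots> \<le> C ^ 4 * conf x ^ 3 * 1"
        using C conf_pos[of x] conf_le_1[of x] by (intro mult_left_mono) auto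
      finally show "\<bar>\<phi> n x - f x\<bar> ^ 4 \<le> C ^ 4 * conf x ^ 3" by simp
    qed
    show "AE x in lebesgue. (\<lambda>n. ennreal (\<bar>\<phi> n x - f x\<bar> ^ 4)) \<longlonglongrightarrow> 0"
    proof (rule AE_I2)
      fix x
      have "(\<lambda>n. \<bar>\<phi> n x - f x\<bar> ^ 4) \<longlonglongrightarrow> \<bar>1 * f x - f x\<bar> ^ 4"
        unfolding \<phi>_def by (intro tendsto_intros cutoff_tendsto)
      from tendsto_ennrealI[OF this]
      show "(\<lambda>n. ennreal (\<bar>\<phi> n x - f x\<bar> ^ 4)) \<longlonglongrightarrow> 0"
        by simp
    qed
  qed measurable
  moreover have "(\<lambda>n. \<integral>\<^sup>+x. ennreal ((norm (grad (\<phi> n) x - grad f x))\<^sup>2) \<partial>lebesgue) \<longlonglongrightarrow> (\<integral>\<^sup>+x. 0 \<partial>(lebesgue :: (real^4) measure))"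
  proof (rule nn_integral_dominated_convergence)
    \<comment> \<open>The squared norm of the difference is at most 2a^2 + 2b^2, with a^2 \<le> C
      conf^3 for the factor 1 - \<open>cutoff\<close> and b^2 \<le> 36 C^2 conf^3 for the gradient
      of the cutoff.\<close>
    define K where "K = 2 * C + 72 * C\<^sup>2"
    have "integrable lebesgue (\<lambda>x. K * conf x ^ 3)"
      by (intro integrable_mult_right integrable_conf_power_3)
    then show "(\<integral>\<^sup>+x. ennreal (K * conf x ^ 3) \<partial>lebesgue) < \<infinity>"
      using C conf_pos by (subst nn_integral_eq_integral) (auto simp: less_imp_le K_def)
    show "AE x in lebesgue. ennreal ((norm (grad (\<phi> n) x - grad f x))\<^sup>2) \<le> ennreal (K * conf x ^ 3)" for n
    proof (intro AE_I2 ennreal_leI)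
      fix x
      define a where "a = (1 - cutoff n x) * norm (grad f x)"
      define b where "b = 2 * conf x * \<bar>cutoff' n x\<bar> * \<bar>f x\<bar> * norm x"
      note c = conf_pos[of x] conf_le_1[of x]
      have "grad (\<phi> n) x - grad f x = - ((1 - cutoff n x) *\<^sub>R grad f x) - (2 * conf x * cutoff' n x * f x) *\<^sub>R x"
        by (simp add: g\<phi> algebra_simps)
      then have "norm (grad (\<phi> n) x - grad f x) \<le> a + b"
        using norm_triangle_ineq4[of "- ((1 - cutoff n x) *\<^sub>R grad f x)" "(2 * conf x * cutoff' n x * f x) *\<^sub>R x"]
          cutoff_bounds(2)[of n x] c
        by (simp add: a_def b_def abs_mult)
      then have "(norm (grad (\<phi> n) x - grad f x))\<^sup>2 \<le> (a + b)\<^sup>2"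
        by (intro power_mono) auto
      also have "\<dots> \<le> 2 * a\<^sup>2 + 2 * b\<^sup>2"
        using sum_squares_bound[of a b] by (simp add: power2_sum)
      also have "a\<^sup>2 \<le> C * conf x ^ 3"
      proof -
        have "a\<^sup>2 = (1 - cutoff n x)\<^sup>2 * (norm (grad f x))\<^sup>2"
          by (simp add: a_def power_mult_distrib)
        also have "\<dots> \<le> 1 * (C * conf x ^ 3)"
          using cutoff_bounds(1,2)[of n x] b1[of x] C c by (intro mult_mono power_le_one) auto
        finally show ?thesis by simp
      qed
      also have "b\<^sup>2 \<le> 36 * C\<^sup>2 * conf x ^ 3"
      proof -
        have "b \<le> 2 * conf x * 3 * (C * conf x) * norm x"
          unfolding b_def using c cutoff_bounds(3)[of n x] b0[of x] C by (intro mult_mono) auto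
        moreover have "0 \<le> b" using c by (simp add: b_def)
        ultimately have "b\<^sup>2 \<le> (2 * conf x * 3 * (C * conf x) * norm x)\<^sup>2"
          by (intro power_mono)
        also have "\<dots> = 36 * C\<^sup>2 * conf x ^ 3 * (conf x * inner x x)"
          by (simp add: power_mult_distrib power2_norm_eq_inner) (simp add: power2_eq_square power3_eq_cube power4_eq_xxxx)
        also have "\<dots> \<le> 36 * C\<^sup>2 * conf x ^ 3 * 1"
          using c by (intro mult_left_mono) (auto simp: conf_mult_inner)
        finally show ?thesis by simp
      qed
      finally show "(norm (grad (\<phi> n) x - grad f x))\<^sup>2 \<le> K * conf x ^ 3"
        by (simp add: K_def distrib_right)
    qed
    show "AE x in lebesgue. (\<lambda>n. ennreal ((norm (grad (\<phi> n) x - grad f x))\<^sup>2)) \<longlonglongrightarrow> 0"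
    proof (rule AE_I2)
      fix x
      have "(\<lambda>n. (norm (grad (\<phi> n) x - grad f x))\<^sup>2) \<longlonglongrightarrow>
          (norm (1 *\<^sub>R grad f x - (2 * conf x * 0 * f x) *\<^sub>R x - grad f x))\<^sup>2"
        unfolding g\<phi> by (intro tendsto_intros cutoff_tendsto)
      from tendsto_ennrealI[OF this]
      show "(\<lambda>n. ennreal ((norm (grad (\<phi> n) x - grad f x))\<^sup>2)) \<longlonglongrightarrow> 0"
        by simp
    qed
  qed measurable
  ultimately show ?thesis
    unfolding D12_gradient_def using \<phi> by (auto intro!: exI[of _ \<phi>])
qed

lemma weak_solution_D12_classical:
  assumes f: "Ck 2 f" and D: "D12_gradient f (grad f)"
  shows "weak_solution_D12 f (\<lambda>x. - laplacian f x)"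
  unfolding weak_solution_D12_def
proof (intro exI conjI ballI)
  show "D12_gradient f (grad f)" by (rule D)
  fix \<phi> :: "real^4 \<Rightarrow> real" assume \<phi>: "\<phi> \<in> Cc_infty"
  note bp = integral_by_parts[OF Ck_2_D(2)[OF f] Ck_2_D(3)[OF f] Cc_infty_D(2)[OF \<phi>]
      Cc_infty_D(3)[OF Cc_infty_partial_deriv[OF \<phi>]] Cc_infty_D(4)[OF \<phi>]
      Cc_infty_D(4)[OF Cc_infty_partial_deriv[OF \<phi>]]]
  have "(\<integral>x. inner (grad f x) (grad \<phi> x) \<partial>lebesgue) = (\<integral>x. (\<Sum>i\<in>UNIV. partial_deriv i f x * partial_deriv i \<phi> x) \<partial>lebesgue)"
    by (simp add: inner_vec_def grad_nth)
  also have "\<dots> = (\<Sum>i\<in>UNIV. \<integral>x. partial_deriv i f x * partial_deriv i \<phi> x \<partial>lebesgue)"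
    by (intro Bochner_Integration.integral_sum bp(1))
  also have "\<dots> = - (\<Sum>i\<in>UNIV. \<integral>x. partial_deriv i (partial_deriv i f) x * \<phi> x \<partial>lebesgue)"
    by (simp only: bp(3) sum_negf)
  also have "\<dots> = - (\<integral>x. (\<Sum>i\<in>UNIV. partial_deriv i (partial_deriv i f) x * \<phi> x) \<partial>lebesgue)"
    by (subst Bochner_Integration.integral_sum) (auto intro: bp(2))
  also have "\<dots> = (\<integral>x. - laplacian f x * \<phi> x \<partial>lebesgue)"
    by (simp add: laplacian_def sum_distrib_right)
  finally show "(\<integral>x. inner (grad f x) (grad \<phi> x) \<partial>lebesgue) = (\<integral>x. - laplacian f x * \<phi> x \<partial>lebesgue)" .
qed

subsection \<open>Stereographic projection\<close>

text \<open>Inverse stereographic projection with R^5 realised as a product: 0 goes to (0, -1),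
  infinity to the pole (0, 1). The last coordinate (|x|^2 - 1)/(|x|^2 + 1) is written through
  \<open>conf\<close>, so linear forms on the sphere lie in the test algebra.\<close>

definition stereo :: "real^4 \<Rightarrow> (real^4) \<times> real" where
  "stereo x = ((2 * conf x) *\<^sub>R x, 1 - 2 * conf x)"

lemma inner_stereo: "inner a (stereo x) = 2 * conf x * inner (fst a) x + snd a * (1 - 2 * conf x)"
  by (simp add: stereo_def inner_prod_def)

lemma inner_stereo_self: "inner (stereo x) (stereo x) = 1"
proof -
  have "inner (stereo x) (stereo x) = 4 * conf x * (conf x * inner x x) + (1 - 2 * conf x)\<^sup>2"
    by (simp add: stereo_def inner_prod_def power2_eq_square)
  also have "\<dots> = 1"
    by (simp add: conf_mult_inner power2_eq_square algebra_simps)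
  finally show ?thesis .
qed

lemma norm_stereo: "norm (stereo x) = 1"
  by (simp add: norm_eq_sqrt_inner inner_stereo_self)

lemma abs_inner_stereo_le: "\<bar>inner a (stereo x)\<bar> \<le> norm a"
  using Cauchy_Schwarz_ineq2[of a "stereo x"] by (simp add: norm_stereo)

lemma continuous_stereo: "continuous_on UNIV stereo"
  unfolding stereo_def[abs_def] by (intro continuous_intros conf_continuous)

lemma stereo_test_alg: "(\<lambda>x. inner a (stereo x)) \<in> test_alg N"
proof -
  have "(\<lambda>x. (2 * conf x) * inner (fst a) x + snd a * (1 + - 2 * conf x)) \<in> test_alg N"
    by (intro test_alg.intros)
  then show ?thesis
    by (simp add: inner_stereo)
qed

lemma inner_stereo_has_derivative:
  "((\<lambda>x. inner a (stereo x)) has_derivative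
    (\<lambda>h. 2 * conf x * inner (fst a) h - 4 * (conf x)\<^sup>2 * (inner (fst a) x - snd a) * inner x h)) (at x)"
  unfolding inner_stereo
  by (rule derivative_eq_intros conf_has_derivative refl | simp)+ (simp add: fun_eq_iff algebra_simps)

lemma grad_inner_stereo:
  "grad (\<lambda>x. inner a (stereo x)) x
    = (2 * conf x) *\<^sub>R fst a - (4 * (conf x)\<^sup>2 * (inner (fst a) x - snd a)) *\<^sub>R x"
  by (simp add: Finite_Cartesian_Product.vec_eq_iff grad_nth partial_deriv_eq[OF inner_stereo_has_derivative] inner_axis)

lemma laplacian_inner_stereo:
  "laplacian (\<lambda>x. inner a (stereo x)) x
    = - 16 * conf x ^ 3 * inner (fst a) x - 8 * (conf x)\<^sup>2 * inner (fst a) x + 16 * snd a * conf x ^ 3"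
proof -
  define b where "b = fst a"
  have pb: "partial_deriv i (\<lambda>x. inner b x) = (\<lambda>_. vec_nth b i)" for i
    by (rule ext, subst partial_deriv_eq[OF bounded_linear_imp_has_derivative[OF bounded_linear_inner_right]])
      (simp add: inner_axis)
  have gb: "grad (\<lambda>x. inner b x) x = b"
    by (simp add: Finite_Cartesian_Product.vec_eq_iff grad_nth pb)
  have lb: "laplacian (\<lambda>x. inner b x) x = 0"
    by (simp add: laplacian_def pb partial_deriv_const)
  have lc: "laplacian (\<lambda>x. snd a) x = 0"
    by (simp add: laplacian_def partial_deriv_const)
  have Cb: "Ck k (\<lambda>x. inner b x)" for k
    by (rule test_alg_Ck[OF test_alg.coord])
  have Cc: "Ck k (\<lambda>x::real^4. c)" for k c
    by (rule test_alg_Ck[OF test_alg.const])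
  have C1: "Ck k (\<lambda>x. conf x * inner b x)" "Ck k (\<lambda>x. 2 * (conf x * inner b x))" "Ck k (\<lambda>x. c * conf x)"
      "Ck k (\<lambda>x. snd a + c * conf x)" for k c
    by (intro test_alg_Ck[where N = 0] test_alg.intros)+
  have "(\<lambda>x. inner a (stereo x)) = (\<lambda>x. 2 * (conf x * inner b x) + (snd a + (- 2 * snd a) * conf x))"
    by (rule ext) (simp add: inner_stereo b_def algebra_simps)
  then have "laplacian (\<lambda>x. inner a (stereo x)) x
      = laplacian (\<lambda>x. 2 * (conf x * inner b x) + (snd a + (- 2 * snd a) * conf x)) x"
    by simp
  also have "\<dots> = 2 * (conf x * 0 + 2 * inner (grad conf x) b + inner b x * laplacian conf x)
      + (0 + (- 2 * snd a) * laplacian conf x)"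
    by (simp only: laplacian_add[OF C1(2) C1(4)] laplacian_add[OF Cc C1(3)] laplacian_cmult[OF C1(1)]
        laplacian_cmult[OF Ck_conf] laplacian_mult[OF Ck_conf Cb] gb lb lc)
  finally show ?thesis
    by (simp add: grad_conf laplacian_conf b_def[symmetric] inner_commute)
qed

text \<open>Conformality: on the sphere the tangential gradient of y \<mapsto> a \<bullet> y has
  squared length |a|^2 - (a \<bullet> y)^2, and the metric factor is (2 conf)^2.\<close>

lemma grad_inner_stereo_norm:
  "inner (grad (\<lambda>x. inner a (stereo x)) x) (grad (\<lambda>x. inner a (stereo x)) x)
    = 4 * (conf x)\<^sup>2 * (inner a a - (inner a (stereo x))\<^sup>2)"
proof -
  define c B s where "c = conf x" and "B = inner (fst a) x" and "s = snd a"
  have cX: "c * inner x x = 1 - c"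
    by (simp add: c_def conf_mult_inner)
  have BB: "inner x (fst a) = B"
    by (simp add: B_def inner_commute)
  have "inner (grad (\<lambda>x. inner a (stereo x)) x) (grad (\<lambda>x. inner a (stereo x)) x)
      = 4 * c\<^sup>2 * inner (fst a) (fst a) - 16 * c ^ 3 * (B - s) * B + 16 * c ^ 3 * (B - s)\<^sup>2 * (c * inner x x)"
    unfolding grad_inner_stereo c_def[symmetric] B_def[symmetric] s_def[symmetric]
    by (simp add: inner_diff_left inner_diff_right BB B_def[symmetric])
      (simp add: power2_eq_square power3_eq_cube algebra_simps)
  also have "\<dots> = 4 * c\<^sup>2 * (inner (fst a) (fst a) + s\<^sup>2 - (2 * c * B + s * (1 - 2 * c))\<^sup>2)"
    unfolding cX by (simp add: power2_eq_square power3_eq_cube algebra_simps)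
  finally show ?thesis
    by (simp add: inner_stereo inner_prod_def[of a a] c_def B_def s_def power2_eq_square)
qed

text \<open>The left side collects the terms of the Laplacian of conf p that contain derivatives of
  p. It is a multiple of conf^3 p, although neither summand is by itself in general.\<close>

lemma conf_stereo_identity:
  "2 * inner (grad conf x) (grad (\<lambda>x. inner a (stereo x)) x) + conf x * laplacian (\<lambda>x. inner a (stereo x)) x
    = - 16 * conf x ^ 3 * inner a (stereo x)"
proof -
  define c B s where "c = conf x" and "B = inner (fst a) x" and "s = snd a"
  have cX: "c * inner x x = 1 - c"
    by (simp add: c_def conf_mult_inner)
  have BB: "inner x (fst a) = B"
    by (simp add: B_def inner_commute)
  have "2 * inner (grad conf x) (grad (\<lambda>x. inner a (stereo x)) x)
      = - 8 * c ^ 3 * B + 16 * c ^ 3 * (B - s) * (c * inner x x)"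
    unfolding grad_inner_stereo grad_conf c_def[symmetric] B_def[symmetric] s_def[symmetric]
    by (simp add: inner_diff_right BB B_def[symmetric])
      (simp add: power2_eq_square power3_eq_cube algebra_simps)
  note E = this[unfolded cX]
  show ?thesis
    unfolding E laplacian_inner_stereo
    unfolding inner_stereo c_def[symmetric] B_def[symmetric] s_def[symmetric]
    by (simp add: power2_eq_square power3_eq_cube algebra_simps)
qed

text \<open>The conformal Laplacian of the sphere in stereographic coordinates, applied to the
  restriction of \<open>y \<mapsto> (a \<bullet> y)\<^sup>k\<close>.\<close>

definition sphere_fun :: "nat \<Rightarrow> (real^4) \<times> real \<Rightarrow> real^4 \<Rightarrow> real" where
  "sphere_fun k a x = conf x * inner a (stereo x) ^ k"

lemma sphere_fun_test_alg: "sphere_fun k a \<in> test_alg N"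
  unfolding sphere_fun_def[abs_def] by (intro test_alg.intros test_alg_power stereo_test_alg)

lemma laplacian_sphere_fun:
  "laplacian (sphere_fun k a) x
    = - 4 * (real k + 1) * (real k + 2) * conf x ^ 3 * inner a (stereo x) ^ k
      + 4 * real k * (real k - 1) * inner a a * conf x ^ 3 * inner a (stereo x) ^ (k - 2)"
proof -
  let ?p = "\<lambda>x. inner a (stereo x)"
  define p where "p = ?p x"
  define c where "c = conf x"
  have Cp: "Ck m ?p" and Cpk: "Ck m (\<lambda>x. ?p x ^ k)" for m
    by (intro test_alg_Ck[where N = 0] test_alg_power stereo_test_alg)+
  have d1: "((\<lambda>t. t ^ k) has_real_derivative real k * t ^ (k - 1)) (at t)" for t :: real
    by (auto intro!: derivative_eq_intros)
  have d2: "((\<lambda>t. real k * t ^ (k - 1)) has_real_derivative real k * (real k - 1) * t ^ (k - 2)) (at t)" for t :: real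
  proof -
    have "((\<lambda>t. real k * t ^ (k - 1)) has_real_derivative real k * (real (k - 1) * t ^ (k - 2))) (at t)"
      by (auto intro!: derivative_eq_intros simp: numeral_2_eq_2)
    then show ?thesis by (cases k) (auto simp: mult.assoc)
  qed
  \<comment> \<open>In \<open>r1\<close> and \<open>r2\<close> the factors k and k(k-1) vanish
    exactly where the exponents are truncated.\<close>
  have r1: "real k * p ^ (k - 1) * p = real k * p ^ k"
    by (cases k) auto
  have r2: "real k * (real k - 1) * p ^ (k - 2) * p\<^sup>2 = real k * (real k - 1) * p ^ k"
  proof (cases "k < 2")
    case True
    then have "k = 0 \<or> k = 1" by auto
    then show ?thesis by auto
  next
    case False
    then have "p ^ (k - 2) * p\<^sup>2 = p ^ k"
      by (simp only: power_add[symmetric] not_less le_add_diff_inverse2)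
    then show ?thesis by (simp add: mult.assoc)
  qed
  have I1: "2 * inner (grad conf x) (grad ?p x) + c * laplacian ?p x = - 16 * c ^ 3 * p"
    using conf_stereo_identity[of x a] by (simp add: c_def p_def)
  have I2: "inner (grad ?p x) (grad ?p x) = 4 * c\<^sup>2 * (inner a a - p\<^sup>2)"
    by (simp add: grad_inner_stereo_norm c_def p_def)
  have "laplacian (sphere_fun k a) x = c * laplacian (\<lambda>x. ?p x ^ k) x
      + 2 * inner (grad conf x) (grad (\<lambda>x. ?p x ^ k) x) + p ^ k * laplacian conf x"
    unfolding sphere_fun_def[abs_def] c_def p_def by (rule laplacian_mult[OF Ck_conf Cpk])
  also have "\<dots> = real k * p ^ (k - 1) * (2 * inner (grad conf x) (grad ?p x) + c * laplacian ?p x)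
      + c * (real k * (real k - 1) * p ^ (k - 2)) * inner (grad ?p x) (grad ?p x) - 8 * c ^ 3 * p ^ k"
    by (simp add: laplacian_compose[OF d1 d2 Cp] grad_compose[OF d1 Ck_2_D(1)[OF Cp]] laplacian_conf
        p_def[symmetric] c_def[symmetric] algebra_simps)
  also have "\<dots> = - 16 * c ^ 3 * (real k * p ^ (k - 1) * p)
      + 4 * c ^ 3 * inner a a * (real k * (real k - 1) * p ^ (k - 2))
      - 4 * c ^ 3 * (real k * (real k - 1) * p ^ (k - 2) * p\<^sup>2) - 8 * c ^ 3 * p ^ k"
    unfolding I1 I2 by (simp add: power2_eq_square power3_eq_cube algebra_simps)
  \<comment> \<open>16k + 4k(k-1) + 8 = 4(k+1)(k+2).\<close>
  also have "\<dots> = - 4 * (real k + 1) * (real k + 2) * c ^ 3 * p ^ k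
      + 4 * real k * (real k - 1) * inner a a * c ^ 3 * p ^ (k - 2)"
    unfolding r1 r2 by (simp add: algebra_simps)
  finally show ?thesis
    by (simp only: p_def c_def)
qed

text \<open>The radial operator x \<bullet> grad preserves decay because conf |x|^2 = 1 - conf. On
  \<open>conf\<close> it gives -2 conf (1 - conf), the source of the 2; on p it is at most (1 +
  4)|a|, the source of the 5.\<close>

lemma abs_inner_grad_sphere_fun: "\<bar>inner x (grad (sphere_fun k a) x)\<bar> \<le> (2 * norm a ^ k + 5 * real k * norm a ^ k) * conf x"
proof -
  let ?p = "\<lambda>x. inner a (stereo x)"
  define c B s p where "c = conf x" and "B = 2 * c * inner (fst a) x" and "s = snd a" and "p = ?p x"
  have c: "0 < c" "c \<le> 1"
    by (simp_all add: c_def conf_pos conf_le_1)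
  have cX: "c * inner x x = 1 - c"
    by (simp add: c_def conf_mult_inner)
  have d1: "((\<lambda>t. t ^ k) has_real_derivative real k * t ^ (k - 1)) (at t)" for t :: real
    by (auto intro!: derivative_eq_intros)
  have Cp: "Ck m ?p" and Cpk: "Ck m (\<lambda>x. ?p x ^ k)" for m
    by (intro test_alg_Ck[where N = 0] test_alg_power stereo_test_alg)+
  have g: "grad (sphere_fun k a) x = c *\<^sub>R ((real k * p ^ (k - 1)) *\<^sub>R grad ?p x) + p ^ k *\<^sub>R grad conf x"
    unfolding sphere_fun_def[abs_def]
    by (simp only: grad_mult[OF Ck_2_D(1)[OF Ck_conf] Ck_2_D(1)[OF Cpk]] grad_compose[OF d1 Ck_2_D(1)[OF Cp]] c_def p_def)
  have BB: "2 * c * inner x (fst a) = B"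
    by (simp add: B_def inner_commute)
  have xp: "inner x (grad ?p x) = B * (1 - 2 * (1 - c)) + 4 * (1 - c) * (c * s)"
  proof -
    have "inner x (grad ?p x) = B - 2 * (B - 2 * c * s) * (c * inner x x)"
      unfolding grad_inner_stereo c_def[symmetric] s_def[symmetric]
      by (simp add: inner_diff_right BB) (simp add: B_def power2_eq_square algebra_simps)
    then show ?thesis by (simp add: cX algebra_simps)
  qed
  have s_le: "\<bar>s\<bar> \<le> norm a"
    using norm_snd_le[of "snd a" "fst a"] by (simp add: s_def)
  have B_le: "\<bar>B\<bar> \<le> norm a"
  proof -
    \<comment> \<open>\<open>B\<close> is a linear form evaluated on the unit sphere, hence bounded,
      although \<open>inner (fst a) x\<close> is not.\<close>
    have "B = inner (fst a, 0) (stereo x)"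
      by (simp add: inner_stereo B_def c_def)
    then have "\<bar>B\<bar> \<le> norm (fst a, 0::real)"
      using abs_inner_stereo_le[of "(fst a, 0)" x] by simp
    also have "\<dots> \<le> norm a"
      using norm_fst_le[of "fst a" "snd a"] by (simp add: norm_Pair)
    finally show ?thesis .
  qed
  have "\<bar>B * (1 - 2 * (1 - c))\<bar> \<le> norm a * 1"
    unfolding abs_mult using B_le c by (intro mult_mono) auto
  moreover have "\<bar>4 * (1 - c) * (c * s)\<bar> \<le> 4 * 1 * (1 * norm a)"
    unfolding abs_mult using s_le c by (intro mult_mono) auto
  ultimately have xp_le: "\<bar>inner x (grad ?p x)\<bar> \<le> 5 * norm a"
    unfolding xp by linarith
  have p_le: "\<bar>p\<bar> \<le> norm a"
    unfolding p_def by (rule abs_inner_stereo_le)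
  have "inner x (grad (sphere_fun k a) x) = c * (real k * p ^ (k - 1) * inner x (grad ?p x)) - 2 * c * (1 - c) * p ^ k"
    unfolding g grad_conf c_def[symmetric]
    by (simp add: inner_add_right inner_diff_right power2_eq_square cX[symmetric])
  then have "\<bar>inner x (grad (sphere_fun k a) x)\<bar>
      \<le> \<bar>c * (real k * p ^ (k - 1) * inner x (grad ?p x))\<bar> + \<bar>2 * c * (1 - c) * p ^ k\<bar>"
    by linarith
  also have "\<bar>c * (real k * p ^ (k - 1) * inner x (grad ?p x))\<bar> \<le> c * (real k * norm a ^ (k - 1) * (5 * norm a))"
    unfolding abs_mult power_abs using c p_le xp_le by (intro mult_mono power_mono) auto
  also have "c * (real k * norm a ^ (k - 1) * (5 * norm a)) = 5 * real k * norm a ^ k * c"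
    by (cases k) (auto simp: algebra_simps)
  also have "\<bar>2 * c * (1 - c) * p ^ k\<bar> \<le> 2 * c * 1 * norm a ^ k"
    unfolding abs_mult power_abs using c p_le by (intro mult_mono power_mono) auto
  finally show ?thesis
    by (simp add: c_def algebra_simps)
qed

lemma sphere_fun_bounds:
  obtains C where "0 \<le> C" "\<And>x. \<bar>sphere_fun k a x\<bar> \<le> C * conf x"
    "\<And>x. \<bar>inner x (grad (sphere_fun k a) x)\<bar> \<le> C * conf x"
    "\<And>x. \<bar>laplacian (sphere_fun k a) x\<bar> \<le> C * (conf x)\<^sup>2"
proof -
  define C1 where "C1 = 2 * norm a ^ k + 5 * real k * norm a ^ k"
  define C2 where "C2 = 4 * (real k + 1) * (real k + 2) * norm a ^ k
    + \<bar>4 * real k * (real k - 1) * inner a a\<bar> * norm a ^ (k - 2)"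
  have C: "0 \<le> C1" "0 \<le> C2" "norm a ^ k \<le> C1"
    by (simp_all add: C1_def C2_def)
  have p: "\<bar>inner a (stereo x)\<bar> ^ m \<le> norm a ^ m" for x m
    by (intro power_mono abs_inner_stereo_le) simp
  show ?thesis
  proof (rule that[of "C1 + C2"])
    fix x
    note c = conf_pos[of x] conf_le_1[of x]
    have "\<bar>sphere_fun k a x\<bar> = \<bar>inner a (stereo x)\<bar> ^ k * conf x"
      using c by (simp add: sphere_fun_def abs_mult power_abs)
    also have "\<dots> \<le> (C1 + C2) * conf x"
      using p[of x k] C c by (intro mult_right_mono) linarith+
    finally show "\<bar>sphere_fun k a x\<bar> \<le> (C1 + C2) * conf x" .
    have "C1 * conf x \<le> (C1 + C2) * conf x"
      using C c by (intro mult_right_mono) auto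
    with abs_inner_grad_sphere_fun[of x k a]
    show "\<bar>inner x (grad (sphere_fun k a) x)\<bar> \<le> (C1 + C2) * conf x"
      unfolding C1_def[symmetric] by linarith
    have "\<bar>laplacian (sphere_fun k a) x\<bar> \<le> \<bar>- 4 * (real k + 1) * (real k + 2) * conf x ^ 3 * inner a (stereo x) ^ k\<bar>
        + \<bar>4 * real k * (real k - 1) * inner a a * conf x ^ 3 * inner a (stereo x) ^ (k - 2)\<bar>"
      unfolding laplacian_sphere_fun by (rule abs_triangle_ineq)
    also have "\<bar>- 4 * (real k + 1) * (real k + 2) * conf x ^ 3 * inner a (stereo x) ^ k\<bar>
        = 4 * (real k + 1) * (real k + 2) * conf x ^ 3 * \<bar>inner a (stereo x)\<bar> ^ k"
      using c by (simp add: abs_mult power_abs)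
    also have "\<dots> \<le> 4 * (real k + 1) * (real k + 2) * conf x ^ 3 * norm a ^ k"
      using c by (intro mult_left_mono p) auto
    also have "\<bar>4 * real k * (real k - 1) * inner a a * conf x ^ 3 * inner a (stereo x) ^ (k - 2)\<bar>
        = \<bar>4 * real k * (real k - 1) * inner a a\<bar> * conf x ^ 3 * \<bar>inner a (stereo x)\<bar> ^ (k - 2)"
      using c by (simp add: abs_mult power_abs)
    also have "\<dots> \<le> \<bar>4 * real k * (real k - 1) * inner a a\<bar> * conf x ^ 3 * norm a ^ (k - 2)"
      using c by (intro mult_left_mono p) auto
    finally have "\<bar>laplacian (sphere_fun k a) x\<bar> \<le> C2 * conf x ^ 3"
      by (simp add: C2_def algebra_simps)
    also have "\<dots> \<le> (C1 + C2) * (conf x)\<^sup>2"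
      using C c by (intro mult_mono power_decreasing) auto
    finally show "\<bar>laplacian (sphere_fun k a) x\<bar> \<le> (C1 + C2) * (conf x)\<^sup>2" .
  qed (use C in auto)
qed

lemma D12_gradient_sphere_fun_1: "D12_gradient (sphere_fun 1 a) (grad (sphere_fun 1 a))"
\<comment> \<open>One constant has to serve two bounds: \<open>norm a\<close> for the function and
  16 = 2 * 4 + 2 * 4 times its square for the gradient.\<close>
proof (rule D12_gradient_classical[OF sphere_fun_test_alg, of "norm a + 16 * (norm a)\<^sup>2"])
  fix x
  let ?p = "\<lambda>x. inner a (stereo x)"
  define c where "c = conf x"
  have c: "0 < c" "c \<le> 1"
    by (simp_all add: c_def conf_pos conf_le_1)
  have "\<bar>sphere_fun 1 a x\<bar> \<le> norm a * c"
    using mult_right_mono[OF abs_inner_stereo_le[of a x], of c] c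
    by (simp add: sphere_fun_def abs_mult c_def mult.commute)
  also have "\<dots> \<le> (norm a + 16 * (norm a)\<^sup>2) * c"
    using c by (intro mult_right_mono) auto
  finally show "\<bar>sphere_fun 1 a x\<bar> \<le> (norm a + 16 * (norm a)\<^sup>2) * conf x"
    by (simp add: c_def)
  have Cp: "Ck m ?p" for m
    by (intro test_alg_Ck[where N = 0] stereo_test_alg)
  have g: "grad (sphere_fun 1 a) x = c *\<^sub>R grad ?p x + ?p x *\<^sub>R grad conf x"
    unfolding sphere_fun_def[abs_def] power_one_right c_def
    by (rule grad_mult[OF Ck_2_D(1)[OF Ck_conf] Ck_2_D(1)[OF Cp]])
  have p2: "(?p x)\<^sup>2 \<le> (norm a)\<^sup>2"
    using abs_inner_stereo_le[of a x] by (simp add: abs_le_square_iff[symmetric])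
  have "(norm (c *\<^sub>R grad ?p x))\<^sup>2 = c\<^sup>2 * (4 * c\<^sup>2 * (inner a a - (?p x)\<^sup>2))"
    by (simp add: power_mult_distrib power2_norm_eq_inner grad_inner_stereo_norm c_def)
  also have "\<dots> \<le> c\<^sup>2 * (4 * c\<^sup>2 * (norm a)\<^sup>2)"
    by (intro mult_left_mono) (auto simp: power2_norm_eq_inner)
  also have "\<dots> = 4 * (norm a)\<^sup>2 * (c ^ 3 * c)"
    by (simp add: power2_eq_square power3_eq_cube)
  also have "\<dots> \<le> 4 * (norm a)\<^sup>2 * (c ^ 3 * 1)"
    using c by (intro mult_left_mono) auto
  finally have n1: "(norm (c *\<^sub>R grad ?p x))\<^sup>2 \<le> 4 * (norm a)\<^sup>2 * c ^ 3"
    by simp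
  have "(norm (?p x *\<^sub>R grad conf x))\<^sup>2 = (?p x)\<^sup>2 * (4 * c ^ 3 * (c * inner x x))"
    by (simp add: power_mult_distrib power2_norm_eq_inner grad_conf c_def)
      (simp add: power2_eq_square power3_eq_cube power4_eq_xxxx)
  also have "\<dots> \<le> (norm a)\<^sup>2 * (4 * c ^ 3 * 1)"
    using c p2 by (intro mult_mono) (auto simp: c_def conf_mult_inner)
  finally have n2: "(norm (?p x *\<^sub>R grad conf x))\<^sup>2 \<le> 4 * (norm a)\<^sup>2 * c ^ 3"
    by simp
  have "(norm (grad (sphere_fun 1 a) x))\<^sup>2 \<le> (norm (c *\<^sub>R grad ?p x) + norm (?p x *\<^sub>R grad conf x))\<^sup>2"
    unfolding g by (intro power_mono norm_triangle_ineq) auto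
  also have "\<dots> \<le> 2 * (norm (c *\<^sub>R grad ?p x))\<^sup>2 + 2 * (norm (?p x *\<^sub>R grad conf x))\<^sup>2"
    using sum_squares_bound[of "norm (c *\<^sub>R grad ?p x)" "norm (?p x *\<^sub>R grad conf x)"] by (simp add: power2_sum)
  also have "\<dots> \<le> 16 * (norm a)\<^sup>2 * c ^ 3"
    using n1 n2 by linarith
  also have "\<dots> \<le> (norm a + 16 * (norm a)\<^sup>2) * c ^ 3"
    using c by (intro mult_right_mono) auto
  finally show "(norm (grad (sphere_fun 1 a) x))\<^sup>2 \<le> (norm a + 16 * (norm a)\<^sup>2) * conf x ^ 3"
    by (simp add: c_def)
qed auto

text \<open>The eigenvalue for k = 1 is 3, so these functions lie in the kernel of the linearisation
  of -\<Delta>u = u^3 at U. They are the tangent vectors to the family of bubbles: a = (b, 0) gives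
  a multiple of the translation derivative along b, a = (0, 1) one of the dilation
  derivative.\<close>

lemma weak_solution_sphere_fun_1:
  "weak_solution_D12 (sphere_fun 1 a) (\<lambda>x. 3 * sphere_fun 1 a x * (bubble x)\<^sup>2)"
proof -
  have "- laplacian (sphere_fun 1 a) x = 3 * sphere_fun 1 a x * (bubble x)\<^sup>2" for x
    unfolding laplacian_sphere_fun bubble_power2 sphere_fun_def by (simp add: power2_eq_square power3_eq_cube)
  then show ?thesis
    using weak_solution_D12_classical[OF test_alg_Ck[OF sphere_fun_test_alg] D12_gradient_sphere_fun_1, of a]
    by simp
qed

text \<open>Up to a constant, \<open>conf x ^ 3\<close> is \<open>U\<^sup>3\<close>.\<close>

definition moment :: "(real^4 \<Rightarrow> real) \<Rightarrow> nat \<Rightarrow> (real^4) \<times> real \<Rightarrow> real" where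
  "moment v k a = (\<integral>x. v x * conf x ^ 3 * inner a (stereo x) ^ k \<partial>lebesgue)"

lemma stereo_measurable [measurable]: "(\<lambda>x. inner a (stereo x)) \<in> borel_measurable lebesgue"
  by (intro continuous_imp_measurable_lebesgue continuous_intros continuous_stereo)

lemma integrable_L4_times_conf_3:
  assumes [measurable]: "v \<in> borel_measurable lebesgue" and v4: "integrable lebesgue (\<lambda>x. v x ^ 4)"
  shows "integrable lebesgue (\<lambda>x. v x * conf x ^ 3)"
proof (rule Bochner_Integration.integrable_bound[OF integrable_L4_times_conf[OF assms]])
  show "AE x in lebesgue. norm (v x * conf x ^ 3) \<le> norm (v x * (conf x)\<^sup>2)"
    using conf_pos conf_le_1
    by (intro AE_I2) (simp add: abs_mult less_imp_le mult_left_mono power_decreasing)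
qed measurable

lemma integrable_moment:
  assumes [measurable]: "v \<in> borel_measurable lebesgue" and v4: "integrable lebesgue (\<lambda>x. v x ^ 4)"
  shows "integrable lebesgue (\<lambda>x. v x * conf x ^ 3 * inner a (stereo x) ^ k)"
proof (rule Bochner_Integration.integrable_bound)
  show "integrable lebesgue (\<lambda>x. norm a ^ k * (v x * conf x ^ 3))"
    by (intro integrable_mult_right integrable_L4_times_conf_3 assms)
  show "AE x in lebesgue. norm (v x * conf x ^ 3 * inner a (stereo x) ^ k) \<le> norm (norm a ^ k * (v x * conf x ^ 3))"
  proof (rule AE_I2)
    fix x
    have "\<bar>v x * conf x ^ 3\<bar> * \<bar>inner a (stereo x)\<bar> ^ k \<le> \<bar>v x * conf x ^ 3\<bar> * norm a ^ k"
      by (intro mult_left_mono power_mono abs_inner_stereo_le) auto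
    then show "norm (v x * conf x ^ 3 * inner a (stereo x) ^ k) \<le> norm (norm a ^ k * (v x * conf x ^ 3))"
      by (simp add: abs_mult power_abs mult.commute)
  qed
qed measurable

text \<open>The equation tested with \<open>sphere_fun k a\<close>, divided by 4; the 2 on the right
  is 8/4, with 8 from the square of the bubble. For k < 2 the truncated index k - 2 carries the
  coefficient 0.\<close>

lemma weak_solution_moments:
  assumes weak: "weak_solution_D12 v (\<lambda>x. g x * (bubble x)\<^sup>2)"
    and g: "g \<in> borel_measurable lebesgue" "integrable lebesgue (\<lambda>x. g x ^ 4)"
  shows "(real k + 1) * (real k + 2) * moment v k a - real k * (real k - 1) * inner a a * moment v (k - 2) a
    = 2 * moment g k a"
proof -
  obtain G where G: "D12_gradient v G"
    using weak by (auto simp: weak_solution_D12_def)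
  have v: "v \<in> borel_measurable lebesgue" "integrable lebesgue (\<lambda>x. v x ^ 4)"
    using G D12_gradient_L4[OF G] by (simp_all add: D12_gradient_def)
  obtain C where "0 \<le> C" "\<And>x. \<bar>sphere_fun k a x\<bar> \<le> C * conf x"
    "\<And>x. \<bar>inner x (grad (sphere_fun k a) x)\<bar> \<le> C * conf x"
    "\<And>x. \<bar>laplacian (sphere_fun k a) x\<bar> \<le> C * (conf x)\<^sup>2"
    using sphere_fun_bounds[of k a] by metis
  note test = weak_solution_test[OF weak g sphere_fun_test_alg this]
  let ?A = "4 * (real k + 1) * (real k + 2)" and ?B = "4 * real k * (real k - 1) * inner a a"
  have "(\<integral>x. v x * laplacian (sphere_fun k a) x \<partial>lebesgue)
    = (\<integral>x. ?B * (v x * conf x ^ 3 * inner a (stereo x) ^ (k - 2)) - ?A * (v x * conf x ^ 3 * inner a (stereo x) ^ k) \<partial>lebesgue)"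
    unfolding laplacian_sphere_fun by (intro Bochner_Integration.integral_cong refl) (simp add: algebra_simps)
  also have "\<dots> = ?B * moment v (k - 2) a - ?A * moment v k a"
    unfolding moment_def
    by (subst Bochner_Integration.integral_diff) (intro integrable_mult_right integrable_moment v integral_mult_right_zero refl | simp)+
  finally have "?B * moment v (k - 2) a - ?A * moment v k a
      = - (\<integral>x. 8 * g x * (conf x)\<^sup>2 * sphere_fun k a x \<partial>lebesgue)"
    using test by simp
  also have "(\<integral>x. 8 * g x * (conf x)\<^sup>2 * sphere_fun k a x \<partial>lebesgue) = (\<integral>x. 8 * (g x * conf x ^ 3 * inner a (stereo x) ^ k) \<partial>lebesgue)"
    by (intro Bochner_Integration.integral_cong refl)
      (simp add: sphere_fun_def power2_eq_square power3_eq_cube)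
  also have "\<dots> = 8 * moment g k a"
    by (simp add: moment_def)
  finally show ?thesis
    by (simp add: algebra_simps)
qed

subsection \<open>Completeness\<close>

text \<open>Only powers of a single linear form are controlled by the moments, and products of
  different forms would call for polarisation. Exponentials multiply by adding their vectors, so
  their span is an algebra outright.\<close>

inductive_set exp_span :: "('a::real_inner \<Rightarrow> real) set" where
  exp: "(\<lambda>y. c * exp (inner a y)) \<in> exp_span"
| add: "f \<in> exp_span \<Longrightarrow> g \<in> exp_span \<Longrightarrow> (\<lambda>y. f y + g y) \<in> exp_span"

lemma exp_span_mult:
  assumes "f \<in> exp_span" "g \<in> exp_span"
  shows "(\<lambda>y. f y * g y) \<in> exp_span"
  using assms
proof (induction arbitrary: g)
  case (exp c a)
  from exp show ?case
  proof induction
    case (exp d b)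
    have "(\<lambda>y. c * exp (inner a y) * (d * exp (inner b y))) = (\<lambda>y. (c * d) * exp (inner (a + b) y))"
      by (simp add: inner_add_left exp_add ac_simps)
    then show ?case by (simp only: exp_span.exp)
  next
    case (add f g)
    then show ?case by (simp add: distrib_left exp_span.add)
  qed
next
  case (add f g')
  then show ?case by (simp add: distrib_right exp_span.add)
qed

lemma exp_span_continuous: "f \<in> exp_span \<Longrightarrow> continuous_on S f"
  by (induction rule: exp_span.induct) (auto intro!: continuous_intros)

lemma exp_span_dense:
  fixes S :: "'a::real_inner set"
  assumes "compact S" "continuous_on S f" "0 < e"
  obtains g where "g \<in> exp_span" "\<And>y. y \<in> S \<Longrightarrow> \<bar>f y - g y\<bar> < e"
proof -
  interpret function_ring_on exp_span S
  proof
    fix c :: real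
    show "(\<lambda>_. c) \<in> exp_span"
      using exp_span.exp[of c 0] by simp
  next
    fix x y :: 'a assume "x \<noteq> y"
    \<comment> \<open>The two values differ by |x - y|^2, so the exponential with vector x - y
      separates the points.\<close>
    have "inner (x - y) x \<noteq> inner (x - y) y"
      using \<open>x \<noteq> y\<close> by (metis eq_iff_diff_eq_0 inner_diff_right inner_eq_zero_iff)
    then show "\<exists>f\<in>exp_span. f x \<noteq> f y"
      by (intro bexI[OF _ exp_span.exp[of 1 "x - y"]]) simp
  qed (use assms(1) in \<open>auto intro: exp_span_continuous exp_span.add exp_span_mult\<close>)
  show ?thesis
    using Stone_Weierstrass_basic[OF assms(2,3)] that by blast
qed

text \<open>Open sets form an intersection-stable generator of the Borel sets, and vanishing of the
  integral passes to complements and disjoint unions. Lebesgue sets differ from Borel sets by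
  subsets of null sets, and an integrable density is determined by its integrals.\<close>

lemma AE_zero_if_open_integrals_zero:
  fixes F :: "'a::euclidean_space \<Rightarrow> real"
  assumes F: "integrable lebesgue F"
    and z: "\<And>A. open A \<Longrightarrow> (\<integral>x. indicator A x * F x \<partial>lebesgue) = 0"
  shows "AE x in lebesgue. F x = 0"
proof -
  have int: "integrable lebesgue (\<lambda>x. indicator A x * F x)" if "A \<in> sets lebesgue" for A
    using integrable_mult_indicator[OF that F] by simp
  have total: "(\<integral>x. F x \<partial>lebesgue) = 0"
    using z[of UNIV] by simp
  have borel: "(\<integral>x. indicator A x * F x \<partial>lebesgue) = 0" if "A \<in> sets borel" for A
  proof -
    have "Int_stable {S :: 'a set. open S}" "{S :: 'a set. open S} \<subseteq> Pow UNIV"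
      by (auto simp: Int_stable_def)
    moreover have "A \<in> sigma_sets UNIV {S. open S}"
      using that by (simp add: borel_def)
    ultimately show ?thesis
    proof (induction rule: sigma_sets_induct_disjoint)
      case (compl A)
      then have "A \<in> sets borel" by (simp add: borel_def)
      then have "A \<in> sets lebesgue" by simp
      have "(\<integral>x. indicator (UNIV - A) x * F x \<partial>lebesgue) = (\<integral>x. F x - indicator A x * F x \<partial>lebesgue)"
        by (intro Bochner_Integration.integral_cong) (auto simp: indicator_def)
      also have "\<dots> = 0"
        using compl.IH total by (subst Bochner_Integration.integral_diff[OF F int[OF \<open>A \<in> sets lebesgue\<close>]]) simp
      finally show ?case .
    next
      case (union A)
      have A: "A i \<in> sets lebesgue" for i
      proof -
        have "A i \<in> sets borel"
          using union by (auto simp: borel_def)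
        then show ?thesis by simp
      qed
      have "integrable lebesgue (\<lambda>x. indicator (\<Union>i. A i) x * F x)"
        using A by (intro int) auto
      then have "set_lebesgue_integral lebesgue (\<Union>i. A i) F = (\<Sum>i. set_lebesgue_integral lebesgue (A i) F)"
        using A union.hyps(1)
        by (intro lebesgue_integral_countable_add) (auto simp: set_integrable_def disjoint_family_on_def)
      then show ?case
        using union.IH by (simp add: set_lebesgue_integral_def)
    qed (use z in auto)
  qed
  have "set_lebesgue_integral lebesgue A F = 0" if A: "A \<in> sets lebesgue" for A
  proof -
    obtain S N N' where S: "A = S \<union> N" "N \<subseteq> N'" "N' \<in> null_sets lborel" "S \<in> sets lborel"
      using A by (rule sets_completionE)
    have "AE x in lebesgue. x \<notin> N'"
      using S(3) by (intro AE_not_in) (simp add: null_sets_completionI)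
    then have "AE x in lebesgue. indicator A x * F x = indicator S x * F x"
      by eventually_elim (use S in \<open>auto simp: indicator_def\<close>)
    then have "(\<integral>x. indicator A x * F x \<partial>lebesgue) = (\<integral>x. indicator S x * F x \<partial>lebesgue)"
      using int[OF A] int[of S] S(4) by (intro integral_cong_AE borel_measurable_integrable) auto
    with borel[of S] S(4) show ?thesis
      by (simp add: set_lebesgue_integral_def)
  qed
  then show ?thesis
    by (intro density_unique_real F) auto
qed

text \<open>Vanishing moments give \<open>\<integral> v conf\<^sup>3 exp (a \<bullet> stereo) = 0\<close>, hence by Stone--Weierstrass the
  signed measure \<open>v conf\<^sup>3 dx\<close> pushed to the sphere vanishes.\<close>

lemma moments_zero_imp_AE_zero:
  assumes v: "v \<in> borel_measurable lebesgue" "integrable lebesgue (\<lambda>x. v x ^ 4)"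
    and m: "\<And>k a. moment v k a = 0"
  shows "AE x in lebesgue. v x = 0"
proof -
  define F where "F x = v x * conf x ^ 3" for x
  have F: "integrable lebesgue F"
    unfolding F_def[abs_def] by (rule integrable_L4_times_conf_3[OF v])
  note [measurable] = borel_measurable_integrable[OF F]
  have st: "(\<lambda>x. g (stereo x)) \<in> borel_measurable lebesgue" if "continuous_on UNIV g"
    for g :: "(real^4) \<times> real \<Rightarrow> real"
    by (intro continuous_imp_measurable_lebesgue continuous_on_compose2[OF that continuous_stereo]) simp
  have int: "integrable lebesgue (\<lambda>x. F x * g (stereo x))"
    if g: "continuous_on UNIV g" and b: "\<And>x. \<bar>g (stereo x)\<bar> \<le> M" for g :: "(real^4) \<times> real \<Rightarrow> real" and M
  proof (rule Bochner_Integration.integrable_bound[OF integrable_mult_right[OF F, of M]])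
    show "(\<lambda>x. F x * g (stereo x)) \<in> borel_measurable lebesgue"
      using st[OF g] by measurable
    show "AE x in lebesgue. norm (F x * g (stereo x)) \<le> norm (M * F x)"
    proof (rule AE_I2)
      fix x
      have "\<bar>F x\<bar> * \<bar>g (stereo x)\<bar> \<le> \<bar>F x\<bar> * \<bar>M\<bar>"
        using b[of x] by (intro mult_left_mono) auto
      then show "norm (F x * g (stereo x)) \<le> norm (M * F x)"
        by (simp add: abs_mult mult.commute)
    qed
  qed
  have exp0: "(\<integral>x. F x * exp (inner a (stereo x)) \<partial>lebesgue) = 0" for a
  proof -
    \<comment> \<open>Partial sums of the exponential series. As \<open>stereo\<close> has norm 1,
      they are dominated by exp |a|, which permits exchanging series and integral.\<close>
    define q where "q n x = (\<Sum>k<n. inner a (stereo x) ^ k /\<^sub>R fact k)" for n x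
    have "(\<lambda>n. \<integral>x. F x * q n x \<partial>lebesgue) \<longlonglongrightarrow> (\<integral>x. F x * exp (inner a (stereo x)) \<partial>lebesgue)"
    proof (rule integral_dominated_convergence)
      show "integrable lebesgue (\<lambda>x. exp (norm a) * \<bar>F x\<bar>)"
        by (intro integrable_mult_right integrable_abs F)
      show "(\<lambda>x. F x * exp (inner a (stereo x))) \<in> borel_measurable lebesgue"
        "(\<lambda>x. F x * q n x) \<in> borel_measurable lebesgue" for n
        unfolding q_def by measurable
      show "AE x in lebesgue. (\<lambda>n. F x * q n x) \<longlonglongrightarrow> F x * exp (inner a (stereo x))"
        using exp_converges[of "inner a (stereo x)" for x]
        unfolding q_def sums_def by (intro AE_I2 tendsto_mult_left)
      show "AE x in lebesgue. norm (F x * q n x) \<le> exp (norm a) * \<bar>F x\<bar>" for n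
      proof (rule AE_I2)
        fix x
        have "\<bar>q n x\<bar> \<le> (\<Sum>k<n. norm a ^ k /\<^sub>R fact k)"
          unfolding q_def
          by (rule order_trans[OF sum_abs sum_mono])
            (simp add: abs_mult power_abs power_mono abs_inner_stereo_le divide_right_mono divide_inverse[symmetric] mult_left_mono)
        also have "\<dots> \<le> (\<Sum>k. norm a ^ k /\<^sub>R fact k)"
          by (intro sum_le_suminf summable_exp_generic) auto
        also have "\<dots> = exp (norm a)"
          using exp_converges[of "norm a"] by (simp add: sums_iff)
        finally have "\<bar>F x\<bar> * \<bar>q n x\<bar> \<le> \<bar>F x\<bar> * exp (norm a)"
          by (intro mult_left_mono) auto
        then show "norm (F x * q n x) \<le> exp (norm a) * \<bar>F x\<bar>"
          by (simp add: abs_mult mult.commute)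
      qed
    qed
    moreover have "(\<integral>x. F x * q n x \<partial>lebesgue) = 0" for n
    proof -
      have "(\<integral>x. F x * q n x \<partial>lebesgue) = (\<integral>x. (\<Sum>k<n. inverse (fact k) * (v x * conf x ^ 3 * inner a (stereo x) ^ k)) \<partial>lebesgue)"
        by (simp add: q_def F_def sum_distrib_left ac_simps)
      also have "\<dots> = (\<Sum>k<n. inverse (fact k) * moment v k a)"
        unfolding moment_def
        by (subst Bochner_Integration.integral_sum) (auto intro!: integrable_mult_right integrable_moment v)
      finally show ?thesis by (simp add: m)
    qed
    ultimately show ?thesis
      by (simp add: LIMSEQ_const_iff eq_commute[of 0])
  qed
  have bdd: "\<exists>M. \<forall>x. \<bar>g (stereo x)\<bar> \<le> M" if "continuous_on (sphere 0 1) g" for g :: "(real^4) \<times> real \<Rightarrow> real"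
  proof -
    have "compact (g ` sphere 0 1)"
      by (intro compact_continuous_image that compact_sphere)
    then obtain M where "\<And>y. y \<in> g ` sphere 0 1 \<Longrightarrow> \<bar>y\<bar> \<le> M"
      using compact_imp_bounded bounded_real by metis
    then show ?thesis
      by (intro exI[of _ M]) (simp add: norm_stereo)
  qed
  have span0: "(\<integral>x. F x * g (stereo x) \<partial>lebesgue) = 0" if "g \<in> exp_span" for g
    using that
  proof induction
    case (exp c a)
    have "(\<integral>x. F x * (c * exp (inner a (stereo x))) \<partial>lebesgue) = (\<integral>x. c * (F x * exp (inner a (stereo x))) \<partial>lebesgue)"
      by (simp only: mult.left_commute)
    then show ?case by (simp add: exp0)
  next
    case (add f g)
    have i: "integrable lebesgue (\<lambda>x. F x * h (stereo x))" if "h \<in> exp_span" for h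
      using bdd[OF exp_span_continuous[OF that]] int[OF exp_span_continuous[OF that]] by metis
    show ?case
      by (simp add: distrib_left Bochner_Integration.integral_add[OF i[OF add(1)] i[OF add(2)]] add)
  qed
  have cont0: "(\<integral>x. F x * g (stereo x) \<partial>lebesgue) = 0" if g: "continuous_on UNIV g" for g
  proof -
    obtain L where L: "\<And>x. \<bar>g (stereo x)\<bar> \<le> L"
      using bdd[OF continuous_on_subset[OF g]] by auto
    define J where "J = (\<integral>x. \<bar>F x\<bar> \<partial>lebesgue)"
    have J: "0 \<le> J"
      by (simp add: J_def)
    have "\<bar>\<integral>x. F x * g (stereo x) \<partial>lebesgue\<bar> \<le> 0 + e" if "0 < e" for e
    proof -
      \<comment> \<open>The added 1 covers J = 0.\<close>
      define d where "d = e / (J + 1)"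
      have d: "0 < d" "d * J \<le> e"
        using that J by (auto simp: d_def field_simps)
      obtain h where h: "h \<in> exp_span" "\<And>y. y \<in> sphere 0 1 \<Longrightarrow> \<bar>g y - h y\<bar> < d"
        using exp_span_dense[OF compact_sphere continuous_on_subset[OF g] d(1)] by (metis subset_UNIV)
      have hb: "\<bar>g (stereo x) - h (stereo x)\<bar> < d" for x
        by (rule h(2)) (simp add: norm_stereo)
      have "\<bar>h (stereo x)\<bar> \<le> L + d" for x
        using L[of x] hb[of x] by linarith
      note ih = int[OF exp_span_continuous[OF h(1)] this]
      have "(\<integral>x. F x * g (stereo x) \<partial>lebesgue) = (\<integral>x. F x * g (stereo x) \<partial>lebesgue) - (\<integral>x. F x * h (stereo x) \<partial>lebesgue)"
        by (simp add: span0[OF h(1)])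
      also have "\<dots> = (\<integral>x. F x * g (stereo x) - F x * h (stereo x) \<partial>lebesgue)"
        by (rule Bochner_Integration.integral_diff[symmetric, OF int[OF g L] ih])
      finally have "\<bar>\<integral>x. F x * g (stereo x) \<partial>lebesgue\<bar> \<le> (\<integral>x. \<bar>F x * g (stereo x) - F x * h (stereo x)\<bar> \<partial>lebesgue)"
        by (simp only: integral_abs_bound)
      also have "\<dots> \<le> (\<integral>x. d * \<bar>F x\<bar> \<partial>lebesgue)"
      proof (rule integral_mono)
        show "integrable lebesgue (\<lambda>x. \<bar>F x * g (stereo x) - F x * h (stereo x)\<bar>)"
          by (intro integrable_abs Bochner_Integration.integrable_diff int[OF g L] ih)
        show "integrable lebesgue (\<lambda>x. d * \<bar>F x\<bar>)"
          by (intro integrable_mult_right integrable_abs F)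
        fix x
        have "\<bar>F x\<bar> * \<bar>g (stereo x) - h (stereo x)\<bar> \<le> \<bar>F x\<bar> * d"
          using hb[of x] by (intro mult_left_mono) auto
        then show "\<bar>F x * g (stereo x) - F x * h (stereo x)\<bar> \<le> d * \<bar>F x\<bar>"
          by (simp add: abs_mult right_diff_distrib[symmetric] mult.commute)
      qed
      also have "\<dots> = d * J"
        by (simp add: J_def)
      finally show ?thesis using d by simp
    qed
    then have "\<bar>\<integral>x. F x * g (stereo x) \<partial>lebesgue\<bar> \<le> 0"
      by (rule field_le_epsilon)
    then show ?thesis by simp
  qed
  have "(\<integral>x. indicator A x * F x \<partial>lebesgue) = 0" if A: "open A" for A
  proof -
    \<comment> \<open>The map is stereographic projection from the pole (0, 1), a left inverse of
      \<open>stereo\<close>. Thus \<open>B\<close> is an open set of R^5 whose preimage under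
      \<open>stereo\<close> is \<open>A\<close>.\<close>
    define B where "B = {y :: (real^4) \<times> real. snd y \<noteq> 1} \<inter> (\<lambda>y. (1 / (1 - snd y)) *\<^sub>R fst y) -` A"
    have "open {y :: (real^4) \<times> real. snd y \<noteq> 1}"
      by (intro open_Collect_neq continuous_intros)
    moreover have "continuous_on {y :: (real^4) \<times> real. snd y \<noteq> 1} (\<lambda>y. (1 / (1 - snd y)) *\<^sub>R fst y)"
      by (intro continuous_intros) auto
    ultimately have B: "open B"
      unfolding B_def using A continuous_open_preimage by blast
    have AB: "stereo x \<in> B \<longleftrightarrow> x \<in> A" for x
      using conf_pos[of x] by (simp add: B_def stereo_def)
    \<comment> \<open>The pole keeps the complement nonempty even for \<open>A = UNIV\<close>. The
      distance to the empty set is 0 by convention, which would make every \<open>g n\<close>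
      vanish.\<close>
    have "(0, 1) \<in> - B"
      by (simp add: B_def)
    then have ne: "- B \<noteq> {}"
      by blast
    have cB: "closed (- B)"
      using B by (simp add: closed_Compl)
    \<comment> \<open>Continuous functions increasing to the indicator of the open set
      \<open>B\<close>.\<close>
    define g where "g n y = min 1 (real n * infdist y (- B))" for n y
    have g: "continuous_on UNIV (g n)" for n
      unfolding g_def by (intro continuous_intros)
    have g01: "0 \<le> g n y" "g n y \<le> 1" for n y
      by (auto simp: g_def infdist_nonneg)
    have "(\<lambda>n. \<integral>x. F x * g n (stereo x) \<partial>lebesgue) \<longlonglongrightarrow> (\<integral>x. F x * indicator A x \<partial>lebesgue)"
    proof (rule integral_dominated_convergence)
      show "(\<lambda>x. F x * indicator A x) \<in> borel_measurable lebesgue"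
        using A by (intro borel_measurable_times borel_measurable_indicator) auto
      show "(\<lambda>x. F x * g n (stereo x)) \<in> borel_measurable lebesgue" for n
        using st[OF g[of n]] by measurable
      show "integrable lebesgue (\<lambda>x. \<bar>F x\<bar>)"
        by (intro integrable_abs F)
      show "AE x in lebesgue. norm (F x * g n (stereo x)) \<le> \<bar>F x\<bar>" for n
        using g01(1)[of n "stereo _"] g01(2)[of n "stereo _"] by (intro AE_I2) (simp add: abs_mult mult_left_le)
      show "AE x in lebesgue. (\<lambda>n. F x * g n (stereo x)) \<longlonglongrightarrow> F x * indicator A x"
      proof (intro AE_I2 tendsto_mult_left)
        fix x
        show "(\<lambda>n. g n (stereo x)) \<longlonglongrightarrow> indicator A x"
        proof (cases "x \<in> A")
          case True
          then have "infdist (stereo x) (- B) > 0"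
            using AB[of x] in_closed_iff_infdist_zero[OF cB ne, of "stereo x"] infdist_nonneg[of "stereo x" "- B"]
            by (auto simp: less_le)
          then obtain N :: nat where N: "1 < real N * infdist (stereo x) (- B)"
            using reals_Archimedean3 by blast
          have "g n (stereo x) = 1" if "N \<le> n" for n
          proof -
            have "real N * infdist (stereo x) (- B) \<le> real n * infdist (stereo x) (- B)"
              using that by (intro mult_right_mono) (auto simp: infdist_nonneg)
            with N show ?thesis by (simp add: g_def)
          qed
          then have "\<forall>\<^sub>F n in sequentially. g n (stereo x) = 1"
            by (auto simp: eventually_sequentially)
          with True show ?thesis
            by (simp add: tendsto_eventually)
        next
          case False
          then have "infdist (stereo x) (- B) = 0"
            using AB[of x] by (intro infdist_zero) simp
          with False show ?thesis by (simp add: g_def)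
        qed
      qed
    qed
    then show ?thesis
      by (simp add: cont0[OF g] LIMSEQ_const_iff mult.commute eq_commute[of 0])
  qed
  then have "AE x in lebesgue. F x = 0"
    by (intro AE_zero_if_open_integrals_zero F)
  then show ?thesis
  proof eventually_elim
    case (elim x)
    then show ?case
      using conf_pos[of x] by (simp add: F_def)
  qed
qed

subsection \<open>Linear algebra\<close>

text \<open>A single group detached from the decomposition. Invertibility enters as a trivial kernel
  on families indexed by \<open>I\<close>, so the analysis works with sums over \<open>I\<close>
  rather than with matrices.\<close>

locale positive_system =
  fixes I :: "nat set" and \<beta> :: "nat \<Rightarrow> nat \<Rightarrow> real" and c :: "nat \<Rightarrow> real"
  assumes fin: "finite I" and ne: "I \<noteq> {}"
    and c_pos: "\<And>i. i \<in> I \<Longrightarrow> 0 < c i"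
    and \<beta>_pos: "\<And>i j. i \<in> I \<Longrightarrow> j \<in> I \<Longrightarrow> 0 < \<beta> i j"
    and \<beta>_sym: "\<And>i j. i \<in> I \<Longrightarrow> j \<in> I \<Longrightarrow> \<beta> i j = \<beta> j i"
    and c_eq: "\<And>i. i \<in> I \<Longrightarrow> (\<Sum>j\<in>I. \<beta> i j * c i * (c j)\<^sup>2) = c i"
    and \<beta>_inj: "\<And>z i. (\<And>i. i \<in> I \<Longrightarrow> (\<Sum>j\<in>I. \<beta> i j * z j) = 0) \<Longrightarrow> i \<in> I \<Longrightarrow> z i = 0"
begin

text \<open>The coefficient matrix of the system is \<open>1 + 2 C\<close>, and \<open>c\<close> is the Perron eigenvector of \<open>C\<close>.\<close>

definition C :: "nat \<Rightarrow> nat \<Rightarrow> real" where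
  "C i j = \<beta> i j * c i * c j"

lemma C_pos: "i \<in> I \<Longrightarrow> j \<in> I \<Longrightarrow> 0 < C i j"
  by (simp add: C_def \<beta>_pos c_pos)

lemma C_sym: "i \<in> I \<Longrightarrow> j \<in> I \<Longrightarrow> C i j = C j i"
  by (simp add: C_def \<beta>_sym[of i j])

lemma C_eigen: "i \<in> I \<Longrightarrow> (\<Sum>j\<in>I. C i j * c j) = c i"
  using c_eq[of i] by (simp add: C_def power2_eq_square mult.assoc)

text \<open>C is D \<beta> D for the diagonal matrix D of the positive numbers
  \<open>c i\<close>.\<close>

lemma C_inj:
  assumes "\<And>i. i \<in> I \<Longrightarrow> (\<Sum>j\<in>I. C i j * z j) = 0" "i \<in> I"
  shows "z i = 0"
proof -
  have "c j * z j = 0" if "j \<in> I" for j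
  proof (rule \<beta>_inj[OF _ that])
    fix i assume i: "i \<in> I"
    have "c i * (\<Sum>j\<in>I. \<beta> i j * (c j * z j)) = (\<Sum>j\<in>I. C i j * z j)"
      by (simp add: C_def sum_distrib_left ac_simps)
    then show "(\<Sum>j\<in>I. \<beta> i j * (c j * z j)) = 0"
      using assms(1)[OF i] c_pos[OF i] by simp
  qed
  from this[OF assms(2)] c_pos[OF assms(2)] show ?thesis by simp
qed

text \<open>In the l^1 norm with weights \<open>c\<close> the matrix C is a contraction: its entries
  are positive and, by symmetry, \<open>c\<close> is also a left eigenvector with eigenvalue
  1.\<close>

lemma C_no_large_eigenvalue:
  assumes z: "\<And>i. i \<in> I \<Longrightarrow> \<theta> * z i = (\<Sum>j\<in>I. C i j * z j)" and "1 < \<theta>" "i \<in> I"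
  shows "z i = 0"
proof -
  have "\<theta> * (\<Sum>i\<in>I. c i * \<bar>z i\<bar>) = (\<Sum>i\<in>I. c i * \<bar>\<theta> * z i\<bar>)"
    using \<open>1 < \<theta>\<close> by (simp add: sum_distrib_left abs_mult ac_simps)
  also have "\<dots> = (\<Sum>i\<in>I. c i * \<bar>\<Sum>j\<in>I. C i j * z j\<bar>)"
    by (simp add: z)
  also have "\<dots> \<le> (\<Sum>i\<in>I. c i * (\<Sum>j\<in>I. \<bar>C i j * z j\<bar>))"
    using c_pos by (intro sum_mono mult_left_mono sum_abs) (auto simp: less_imp_le)
  also have "\<dots> = (\<Sum>i\<in>I. \<Sum>j\<in>I. c i * (C i j * \<bar>z j\<bar>))"
    using C_pos by (simp add: sum_distrib_left abs_mult less_imp_le)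
  also have "\<dots> = (\<Sum>j\<in>I. \<Sum>i\<in>I. c i * (C i j * \<bar>z j\<bar>))"
    by (rule sum.swap)
  \<comment> \<open>Symmetry turns the column sums into the row sums evaluated by
    \<open>C_eigen\<close>.\<close>
  also have "\<dots> = (\<Sum>j\<in>I. (\<Sum>i\<in>I. C j i * c i) * \<bar>z j\<bar>)"
    by (intro sum.cong refl) (simp only: sum_distrib_right, intro sum.cong refl, simp add: C_sym ac_simps)
  also have "\<dots> = (\<Sum>j\<in>I. c j * \<bar>z j\<bar>)"
    by (simp add: C_eigen)
  finally have "(\<theta> - 1) * (\<Sum>i\<in>I. c i * \<bar>z i\<bar>) \<le> 0"
    by (simp add: algebra_simps)
  then have "(\<Sum>i\<in>I. c i * \<bar>z i\<bar>) \<le> 0"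
    using \<open>1 < \<theta>\<close> by (simp add: mult_le_0_iff)
  moreover have nn: "\<And>i. i \<in> I \<Longrightarrow> 0 \<le> c i * \<bar>z i\<bar>"
    using c_pos by (simp add: less_imp_le)
  ultimately have "(\<Sum>i\<in>I. c i * \<bar>z i\<bar>) = 0"
    by (intro antisym sum_nonneg)
  then have "c i * \<bar>z i\<bar> = 0"
    using sum_nonneg_eq_0_iff[OF fin nn] \<open>i \<in> I\<close> by simp
  with c_pos[OF \<open>i \<in> I\<close>] show ?thesis by simp
qed

text \<open>Perron's argument: for the largest ratio t of z to c, the vector tc - z is nonnegative,
  fixed by C, and zero at the index attaining the maximum. The row of C at that index has positive
  entries, so tc - z vanishes.\<close>

lemma C_fixed_point:
  assumes z: "\<And>i. i \<in> I \<Longrightarrow> z i = (\<Sum>j\<in>I. C i j * z j)"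
  obtains t where "\<And>i. i \<in> I \<Longrightarrow> z i = t * c i"
proof -
  define t where "t = Max ((\<lambda>i. z i / c i) ` I)"
  have "t \<in> (\<lambda>i. z i / c i) ` I"
    unfolding t_def using fin ne by (intro Max_in) auto
  then obtain k where k: "k \<in> I" "z k / c k = t" by auto
  have le: "z i \<le> t * c i" if "i \<in> I" for i
  proof -
    have "z i / c i \<le> t"
      unfolding t_def using fin that by (intro Max_ge) auto
    then show ?thesis using c_pos[OF that] by (simp add: field_simps)
  qed
  have "(\<Sum>j\<in>I. C k j * (t * c j - z j)) = t * (\<Sum>j\<in>I. C k j * c j) - (\<Sum>j\<in>I. C k j * z j)"
    by (simp add: right_diff_distrib sum_subtractf sum_distrib_left ac_simps)
  also have "\<dots> = t * c k - z k"
    using k(1) z[of k] by (simp add: C_eigen)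
  also have "\<dots> = 0"
    using k c_pos[OF k(1)] by (auto simp: field_simps)
  finally have s: "(\<Sum>j\<in>I. C k j * (t * c j - z j)) = 0" .
  have nn: "\<And>j. j \<in> I \<Longrightarrow> 0 \<le> C k j * (t * c j - z j)"
    using le C_pos[OF k(1)] by (simp add: less_imp_le)
  have "z j = t * c j" if "j \<in> I" for j
  proof -
    have "C k j * (t * c j - z j) = 0"
      using s sum_nonneg_eq_0_iff[OF fin nn] that by simp
    then show ?thesis
      using C_pos[OF k(1) that] by simp
  qed
  then show ?thesis by (rule that)
qed

end

subsection \<open>The Gram form of the five solutions\<close>

definition L4 :: "(real^4 \<Rightarrow> real) \<Rightarrow> bool" where
  "L4 f \<longleftrightarrow> f \<in> borel_measurable lebesgue \<and> integrable lebesgue (\<lambda>x. f x ^ 4)"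

lemma L4_cmult: "L4 f \<Longrightarrow> L4 (\<lambda>x. a * f x)"
  by (auto simp: L4_def power_mult_distrib intro!: borel_measurable_times)

lemma L4_add:
  assumes "L4 f" "L4 g"
  shows "L4 (\<lambda>x. f x + g x)"
proof -
  have [measurable]: "f \<in> borel_measurable lebesgue" "g \<in> borel_measurable lebesgue"
    using assms by (auto simp: L4_def)
  have "integrable lebesgue (\<lambda>x. (f x + g x) ^ 4)"
  proof (rule Bochner_Integration.integrable_bound)
    show "integrable lebesgue (\<lambda>x. 8 * (f x ^ 4 + g x ^ 4))"
      using assms by (intro integrable_mult_right Bochner_Integration.integrable_add) (auto simp: L4_def)
    show "AE x in lebesgue. norm ((f x + g x) ^ 4) \<le> norm (8 * (f x ^ 4 + g x ^ 4))"
      using power4_add_le by (simp add: abs_mult)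
  qed measurable
  then show ?thesis by (simp add: L4_def)
qed

lemma L4_sum: "(\<And>j. j \<in> J \<Longrightarrow> L4 (f j)) \<Longrightarrow> L4 (\<lambda>x. \<Sum>j\<in>J. f j x)"
proof (induction J rule: infinite_finite_induct)
  case (insert j J)
  then have "L4 (\<lambda>x. f j x + (\<Sum>j\<in>J. f j x))"
    by (intro L4_add) auto
  with insert show ?case by simp
qed (simp_all add: L4_def)

lemma D12_gradient_imp_L4: "D12_gradient u G \<Longrightarrow> L4 u"
  by (simp add: L4_def D12_gradient_L4) (simp add: D12_gradient_def)

lemma moment_add: "L4 f \<Longrightarrow> L4 g \<Longrightarrow> moment (\<lambda>x. f x + g x) k a = moment f k a + moment g k a"
  unfolding moment_def L4_def
  by (subst Bochner_Integration.integral_add[symmetric]) (auto intro: integrable_moment simp: distrib_right)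

lemma moment_cmult: "moment (\<lambda>x. r * f x) k a = r * moment f k a"
  unfolding moment_def mult.assoc by (rule integral_mult_right_zero)

lemma moment_sum: "(\<And>j. j \<in> J \<Longrightarrow> L4 (f j)) \<Longrightarrow> moment (\<lambda>x. \<Sum>j\<in>J. f j x) k a = (\<Sum>j\<in>J. moment (f j) k a)"
proof (induction J rule: infinite_finite_induct)
  case (insert j J)
  then show ?case by (simp add: moment_add L4_sum)
qed (simp_all add: moment_def)

lemma moment_1_linear:
  assumes "L4 v"
  shows "linear (moment v 1)"
proof (rule linearI)
  have i: "integrable lebesgue (\<lambda>x. v x * conf x ^ 3 * inner a (stereo x) ^ 1)" for a
    using assms by (intro integrable_moment) (auto simp: L4_def)
  show "moment v 1 (a + b) = moment v 1 a + moment v 1 b" for a b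
    unfolding moment_def using i[of a] i[of b]
    by (subst Bochner_Integration.integral_add[symmetric]) (auto simp: inner_add_left algebra_simps)
  show "moment v 1 (r *\<^sub>R a) = r *\<^sub>R moment v 1 a" for r a
  proof -
    have "moment v 1 (r *\<^sub>R a) = (\<integral>x. r * (v x * conf x ^ 3 * inner a (stereo x) ^ 1) \<partial>lebesgue)"
      unfolding moment_def by (intro Bochner_Integration.integral_cong refl) simp
    then show ?thesis by (simp add: moment_def)
  qed
qed

lemma L4_sphere_fun_1: "L4 (sphere_fun 1 d)"
  by (rule D12_gradient_imp_L4[OF D12_gradient_sphere_fun_1])

text \<open>Both sides integrate conf^4 (d \<bullet> \<sigma>)(a \<bullet> \<sigma>). Linearity in
  a, already known, thereby carries over to d.\<close>

lemma gram_sym: "moment (sphere_fun 1 d) 1 a = moment (sphere_fun 1 a) 1 d"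
  unfolding moment_def sphere_fun_def by (intro Bochner_Integration.integral_cong refl) simp

text \<open>By continuity the form vanishes at every point. The origin, which maps to (0, -1), gives
  the last coordinate of d; the unit vectors of R^4, which map to the equator, give the
  others.\<close>

lemma AE_inner_stereo_zero:
  assumes "AE x in lebesgue. inner d (stereo x) = 0"
  shows "d = 0"
proof -
  let ?N = "{x. inner d (stereo x) \<noteq> 0}"
  have "open ?N"
    by (intro open_Collect_neq continuous_intros continuous_stereo)
  moreover have "negligible ?N"
    using assms by (simp add: negligible_iff_null_sets AE_iff_null_sets \<open>open ?N\<close> borel_open)
  ultimately have "?N = {}"
    using open_not_negligible by blast
  then have z: "inner d (stereo x) = 0" for x by blast
  have "snd d = 0"
    using z[of 0] by (simp add: inner_stereo conf_def)
  moreover have "vec_nth (fst d) i = 0" for i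
    using z[of "axis i 1"] \<open>snd d = 0\<close> by (simp add: inner_stereo conf_def inner_axis inner_axis_axis)
  then have "fst d = 0"
    by (simp add: Finite_Cartesian_Product.vec_eq_iff)
  ultimately show ?thesis
    by (simp add: prod_eq_iff)
qed

lemma gram_pos:
  assumes "moment (sphere_fun 1 d) 1 d = 0"
  shows "d = 0"
proof -
  have "integrable lebesgue (\<lambda>x. sphere_fun 1 d x * conf x ^ 3 * inner d (stereo x) ^ 1)"
    using L4_sphere_fun_1 by (intro integrable_moment) (auto simp: L4_def)
  moreover have e: "sphere_fun 1 d x * conf x ^ 3 * inner d (stereo x) ^ 1 = conf x ^ 4 * (inner d (stereo x))\<^sup>2" for x
    by (simp add: sphere_fun_def power2_eq_square power3_eq_cube power4_eq_xxxx)
  ultimately have "integrable lebesgue (\<lambda>x. conf x ^ 4 * (inner d (stereo x))\<^sup>2)"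
    by simp
  then have "AE x in lebesgue. conf x ^ 4 * (inner d (stereo x))\<^sup>2 = 0"
    using assms by (subst (asm) moment_def, subst (asm) e, subst (asm) integral_nonneg_eq_0_iff_AE) auto
  then have "AE x in lebesgue. inner d (stereo x) = 0"
  proof eventually_elim
    case (elim x)
    then show ?case using conf_pos[of x] by simp
  qed
  then show ?thesis by (rule AE_inner_stereo_zero)
qed

text \<open>Riesz representation for the Gram form: its definiteness makes \<open>T\<close>
  injective, hence surjective in finite dimension.\<close>

lemma gram_represents:
  assumes t: "linear t"
  obtains d where "\<And>a. moment (sphere_fun 1 d) 1 a = t a"
proof -
  define T where "T d = (\<Sum>b\<in>Basis. moment (sphere_fun 1 d) 1 b *\<^sub>R b)" for d
  note lin = moment_1_linear[OF L4_sphere_fun_1]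
  have T_inner: "inner (T d) b = moment (sphere_fun 1 d) 1 b" if "b \<in> Basis" for d b
    using that by (simp add: T_def inner_sum_left inner_Basis if_distrib sum.delta cong: if_cong)
  have "linear T"
  proof (rule linearI)
    show "T (x + y) = T x + T y" for x y
      unfolding T_def gram_sym[of "x + y"] gram_sym[of x] gram_sym[of y]
      by (simp add: linear_add[OF lin] scaleR_left_distrib sum.distrib del: One_nat_def)
    show "T (r *\<^sub>R x) = r *\<^sub>R T x" for r x
      unfolding T_def gram_sym[of "r *\<^sub>R x"] gram_sym[of x]
      by (simp add: linear_scale[OF lin] scaleR_sum_right del: One_nat_def)
  qed
  have ext: "f = g" if "linear f" "linear g" "\<And>b. b \<in> Basis \<Longrightarrow> f b = g b" for f g :: "(real^4) \<times> real \<Rightarrow> real"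
    using that by (intro linear_eq_stdbasis)
  have "inj T"
  proof (rule linear_injective_0[OF \<open>linear T\<close>, THEN iffD2], intro allI impI)
    fix d assume "T d = 0"
    then have "moment (sphere_fun 1 d) 1 b = 0" if "b \<in> Basis" for b
      using T_inner[OF that, of d] by simp
    then have "moment (sphere_fun 1 d) 1 = (\<lambda>_. 0)"
      by (intro ext lin linear_zero) auto
    then show "d = 0"
      by (intro gram_pos) simp
  qed
  with \<open>linear T\<close> have "surj T"
    by (intro linear_injective_imp_surjective refl)
  then obtain d where d: "T d = (\<Sum>b\<in>Basis. t b *\<^sub>R b)"
    by (metis surjD)
  have "moment (sphere_fun 1 d) 1 b = t b" if "b \<in> Basis" for b
    using T_inner[OF that, of d] that
    by (simp add: d inner_sum_left inner_Basis if_distrib sum.delta cong: if_cong)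
  then have "moment (sphere_fun 1 d) 1 = t"
    by (intro ext lin t)
  then show ?thesis by (intro that[of d]) simp
qed

subsection \<open>The linearized system\<close>

lemma sphere_fun_1_scale: "sphere_fun 1 (r *\<^sub>R d) x = r * sphere_fun 1 d x"
  by (simp add: sphere_fun_def)

text \<open>The recursion of the candidate solutions, needed to subtract one of them; 6 is twice the
  eigenvalue 3.\<close>

lemma moment_sphere_fun_1:
  "(real k + 1) * (real k + 2) * moment (sphere_fun 1 d) k a
    - real k * (real k - 1) * inner a a * moment (sphere_fun 1 d) (k - 2) a
    = 6 * moment (sphere_fun 1 d) k a"
proof -
  have "L4 (\<lambda>x. 3 * sphere_fun 1 d x)"
    by (intro L4_cmult L4_sphere_fun_1)
  then have "(real k + 1) * (real k + 2) * moment (sphere_fun 1 d) k a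
      - real k * (real k - 1) * inner a a * moment (sphere_fun 1 d) (k - 2) a
      = 2 * moment (\<lambda>x. 3 * sphere_fun 1 d x) k a"
    using weak_solution_sphere_fun_1[of d] by (intro weak_solution_moments) (simp_all add: L4_def)
  then show ?thesis by (simp add: moment_cmult)
qed

context positive_system
begin

text \<open>Dividing the algebraic system for c by \<open>c i\<close> gives \<Sum> \<beta>_ij c_j^2
  = 1. This replaces the off-diagonal sum by 1 - \<beta>_ii c_i^2, and the coefficient of
  \<open>v i\<close> becomes 1 + 2 \<beta>_ii c_i^2.\<close>

lemma coefficient_eq:
  assumes i: "i \<in> I"
  shows "(3 * \<beta> i i * (c i)\<^sup>2 + (\<Sum>j\<in>I - {i}. \<beta> i j * (c j)\<^sup>2)) * v i
      + 2 * (\<Sum>j\<in>I - {i}. \<beta> i j * c i * c j * v j)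
    = v i + 2 * (\<Sum>j\<in>I. C i j * v j)"
proof -
  have "c i * (\<Sum>j\<in>I. \<beta> i j * (c j)\<^sup>2) = c i * 1"
    using c_eq[OF i] by (simp add: sum_distrib_left ac_simps)
  then have 1: "(\<Sum>j\<in>I. \<beta> i j * (c j)\<^sup>2) = 1"
    using c_pos[OF i] by simp
  have 2: "(\<Sum>j\<in>I - {i}. \<beta> i j * (c j)\<^sup>2) = 1 - \<beta> i i * (c i)\<^sup>2"
    using 1 sum.remove[OF fin i, of "\<lambda>j. \<beta> i j * (c j)\<^sup>2"] by simp
  have 3: "(\<Sum>j\<in>I. C i j * v j) = C i i * v i + (\<Sum>j\<in>I - {i}. \<beta> i j * c i * c j * v j)"
    using sum.remove[OF fin i, of "\<lambda>j. C i j * v j"] by (simp add: C_def)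
  show ?thesis
    unfolding 2 3 by (simp add: C_def power2_eq_square algebra_simps)
qed

lemma linearized_solutions_iff:
  "v \<in> linearized_solutions \<beta> c I \<longleftrightarrow>
    (\<forall>i\<in>I. weak_solution_D12 (v i) (\<lambda>x. (v i x + 2 * (\<Sum>j\<in>I. C i j * v j x)) * (bubble x)\<^sup>2))"
proof -
  have "(\<lambda>x. ((3 * \<beta> i i * (c i)\<^sup>2 + (\<Sum>j\<in>I - {i}. \<beta> i j * (c j)\<^sup>2)) * v i x
        + 2 * (\<Sum>j\<in>I - {i}. \<beta> i j * c i * c j * v j x)) * (bubble x)\<^sup>2)
      = (\<lambda>x. (v i x + 2 * (\<Sum>j\<in>I. C i j * v j x)) * (bubble x)\<^sup>2)" if "i \<in> I" for i
    using coefficient_eq[OF that, of "\<lambda>j. v j x" for x] by simp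
  moreover have "u \<in> D12" if "weak_solution_D12 u f" for u f
    using that by (auto simp: weak_solution_D12_def D12_def)
  ultimately show ?thesis
    by (auto simp: linearized_solutions_def)
qed

text \<open>Since Cc = c, the matrix 1 + 2C acts on c as 3, the factor in the scalar equation of
  \<open>sphere_fun 1 d\<close>.\<close>

lemma sphere_fun_solution:
  assumes v: "\<And>i. i \<in> I \<Longrightarrow> AE x in lebesgue. v i x = c i * sphere_fun 1 d x"
  shows "v \<in> linearized_solutions \<beta> c I"
  unfolding linearized_solutions_iff
proof
  fix i assume i: "i \<in> I"
  let ?s = "sphere_fun 1 (c i *\<^sub>R d)"
  show "weak_solution_D12 (v i) (\<lambda>x. (v i x + 2 * (\<Sum>j\<in>I. C i j * v j x)) * (bubble x)\<^sup>2)"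
  proof (rule weak_solution_D12_cong_AE[OF weak_solution_sphere_fun_1[of "c i *\<^sub>R d"]])
    show "AE x in lebesgue. v i x = ?s x"
      using v[OF i] by (simp only: sphere_fun_1_scale)
    have "AE x in lebesgue. \<forall>j\<in>I. v j x = c j * sphere_fun 1 d x"
      using v by (intro AE_finite_allI fin)
    then show "AE x in lebesgue. (v i x + 2 * (\<Sum>j\<in>I. C i j * v j x)) * (bubble x)\<^sup>2 = 3 * ?s x * (bubble x)\<^sup>2"
    proof eventually_elim
      case (elim x)
      have "(\<Sum>j\<in>I. C i j * v j x) = (\<Sum>j\<in>I. C i j * c j) * sphere_fun 1 d x"
        unfolding sum_distrib_right using elim by (intro sum.cong refl) simp
      then show ?case
        using elim i by (simp add: C_eigen sphere_fun_1_scale[unfolded One_nat_def])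
    qed
    have [measurable]: "?s \<in> borel_measurable lebesgue"
      using L4_sphere_fun_1 by (simp add: L4_def)
    have [measurable]: "bubble \<in> borel_measurable lebesgue"
      unfolding bubble_eq[abs_def] by measurable
    show "(\<lambda>x. 3 * ?s x * (bubble x)\<^sup>2) \<in> borel_measurable lebesgue"
      by measurable
  qed
qed

lemma solution_moments:
  assumes v: "v \<in> linearized_solutions \<beta> c I"
  shows "\<And>i. i \<in> I \<Longrightarrow> L4 (v i)"
    and "\<And>i k a. i \<in> I \<Longrightarrow> (real k + 1) * (real k + 2) * moment (v i) k a
      - real k * (real k - 1) * inner a a * moment (v i) (k - 2) a
      = 2 * moment (v i) k a + 4 * (\<Sum>j\<in>I. C i j * moment (v j) k a)"
proof -
  show L: "L4 (v i)" if "i \<in> I" for i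
    using v that unfolding linearized_solutions_iff weak_solution_D12_def
    by (blast intro: D12_gradient_imp_L4)
  fix i k a assume i: "i \<in> I"
  have L1: "L4 (\<lambda>x. 2 * (\<Sum>j\<in>I. C i j * v j x))"
    using L by (intro L4_cmult L4_sum)
  have L2: "L4 (\<lambda>x. v i x + 2 * (\<Sum>j\<in>I. C i j * v j x))"
    by (intro L4_add L1 L i)
  have "moment (\<lambda>x. v i x + 2 * (\<Sum>j\<in>I. C i j * v j x)) k a = moment (v i) k a + 2 * (\<Sum>j\<in>I. C i j * moment (v j) k a)"
    using L by (simp add: moment_add[OF L[OF i] L1] moment_cmult moment_sum L4_cmult)
  then show "(real k + 1) * (real k + 2) * moment (v i) k a
      - real k * (real k - 1) * inner a a * moment (v i) (k - 2) a
      = 2 * moment (v i) k a + 4 * (\<Sum>j\<in>I. C i j * moment (v j) k a)"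
    using v i L2 weak_solution_moments[of "v i" "\<lambda>x. v i x + 2 * (\<Sum>j\<in>I. C i j * v j x)" k a]
    by (simp add: linearized_solutions_iff L4_def)
qed

lemma solution_form:
  assumes v: "v \<in> linearized_solutions \<beta> c I"
  obtains d where "\<And>i. i \<in> I \<Longrightarrow> AE x in lebesgue. v i x = c i * sphere_fun 1 d x"
proof -
  note L = solution_moments(1)[OF v] and M = solution_moments(2)[OF v]
  obtain i0 where i0: "i0 \<in> I"
    using ne by blast
  \<comment> \<open>The proportionality factor to c is read off at one fixed index, so that it is
    visibly linear in a.\<close>
  define t where "t a = moment (v i0) 1 a / c i0" for a
  have m1: "moment (v i) 1 a = t a * c i" if i: "i \<in> I" for i a
  proof -
    \<comment> \<open>For k = 1 the recursion reads 6m = 2m + 4Cm, that is m = Cm.\<close>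
    obtain r where r: "\<And>i. i \<in> I \<Longrightarrow> moment (v i) 1 a = r * c i"
    proof (rule C_fixed_point[of "\<lambda>i. moment (v i) 1 a"])
      fix i assume "i \<in> I"
      from M[OF this, of 1 a] show "moment (v i) 1 a = (\<Sum>j\<in>I. C i j * moment (v j) 1 a)"
        by simp
    qed blast
    have "t a = r"
      using r[OF i0] c_pos[OF i0] by (simp add: t_def)
    with r[OF i] show ?thesis by simp
  qed
  have "linear t"
  proof -
    have "t = (\<lambda>a. (1 / c i0) *\<^sub>R moment (v i0) 1 a)"
      by (simp add: t_def fun_eq_iff)
    then show ?thesis
      by (simp only: linear_compose_scale_right[OF moment_1_linear[OF L[OF i0]]])
  qed
  then obtain d where d: "\<And>a. moment (sphere_fun 1 d) 1 a = t a"
    by (rule gram_represents) blast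
  let ?s = "sphere_fun 1 d"
  define u where "u i x = v i x + - c i * ?s x" for i x
  have Lu: "L4 (u i)" if "i \<in> I" for i
    unfolding u_def using that by (intro L4_add L4_cmult L L4_sphere_fun_1)
  have mu: "moment (u i) k a = moment (v i) k a - c i * moment ?s k a" if "i \<in> I" for i k a
    unfolding u_def
    by (simp only: moment_add[OF L[OF that] L4_cmult[OF L4_sphere_fun_1]] moment_cmult)
  \<comment> \<open>The subtracted part obeys the same recursion: 2 + 4C acts on c as 6.\<close>
  have Mu: "(real k + 1) * (real k + 2) * moment (u i) k a
      - real k * (real k - 1) * inner a a * moment (u i) (k - 2) a
      = 2 * moment (u i) k a + 4 * (\<Sum>j\<in>I. C i j * moment (u j) k a)" if i: "i \<in> I" for i k a
  proof -
    have "(\<Sum>j\<in>I. C i j * moment (u j) k a) = (\<Sum>j\<in>I. C i j * moment (v j) k a) - (\<Sum>j\<in>I. C i j * c j) * moment ?s k a"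
      by (simp add: mu right_diff_distrib sum_subtractf sum_distrib_right mult.assoc)
    then have "(\<Sum>j\<in>I. C i j * moment (u j) k a) = (\<Sum>j\<in>I. C i j * moment (v j) k a) - c i * moment ?s k a"
      by (simp add: C_eigen i)
    moreover have "c i * ((real k + 1) * (real k + 2) * moment ?s k a
        - real k * (real k - 1) * inner a a * moment ?s (k - 2) a) = c i * (6 * moment ?s k a)"
      by (simp only: moment_sphere_fun_1)
    ultimately show ?thesis
      using M[OF i, of k a] by (simp add: mu[OF i] algebra_simps)
  qed
  have zero: "moment (u i) k a = 0" if "i \<in> I" for i k a
    using that
  proof (induction k arbitrary: i rule: less_induct)
    case (less k)
    consider "k = 0" | "k = 1" | "2 \<le> k" by linarith
    then show ?case
    proof cases
      case 1
      show ?thesis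
      proof (rule C_inj[where z = "\<lambda>i. moment (u i) k a", OF _ less.prems])
        fix i assume "i \<in> I"
        \<comment> \<open>At k = 0 the left coefficient is 2 and cancels 2m, leaving Cm = 0.\<close>
        from Mu[OF this, of 0 a] 1 show "(\<Sum>j\<in>I. C i j * moment (u j) k a) = 0"
          by simp
      qed
    next
      case 2
      then show ?thesis
        using mu[OF less.prems, of 1 a] m1[OF less.prems, of a] d[of a] by simp
    next
      case 3
      \<comment> \<open>With m(k-2) = 0 the recursion becomes Cm = \<theta>m, and \<theta> is at
        least 5/2 for k \<ge> 2.\<close>
      define \<theta> where "\<theta> = ((real k + 1) * (real k + 2) - 2) / 4"
      have "(2 + 1) * (2 + 2) \<le> (real k + 1) * (real k + 2)"
        using 3 by (intro mult_mono) auto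
      then have "1 < \<theta>"
        by (simp add: \<theta>_def)
      show ?thesis
      proof (rule C_no_large_eigenvalue[where z = "\<lambda>i. moment (u i) k a", OF _ \<open>1 < \<theta>\<close> less.prems])
        fix i assume i: "i \<in> I"
        have "moment (u i) (k - 2) a = 0"
          using 3 i by (intro less.IH) auto
        with Mu[OF i, of k a] show "\<theta> * moment (u i) k a = (\<Sum>j\<in>I. C i j * moment (u j) k a)"
          by (simp add: \<theta>_def algebra_simps)
      qed
    qed
  qed
  have "AE x in lebesgue. v i x = c i * ?s x" if i: "i \<in> I" for i
  proof -
    have "AE x in lebesgue. u i x = 0"
      using Lu[OF i] zero[OF i] by (intro moments_zero_imp_AE_zero) (auto simp: L4_def)
    then show ?thesis
      by eventually_elim (simp add: u_def)
  qed
  then show ?thesis by (rule that)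
qed

text \<open>The map sending d to the family \<open>c i * sphere_fun 1 d x\<close> is a linear
  isomorphism from R^4 \<times> R onto the solutions modulo null sets; the basis is the image of the
  standard basis.\<close>

theorem linearized_solutions_dim_5: "ae_vector_space_of_dim I (linearized_solutions \<beta> c I) 5"
proof -
  have "card (Basis :: ((real^4) \<times> real) set) = 5"
    by simp
  then obtain e where e: "bij_betw e {..<5::nat} (Basis :: ((real^4) \<times> real) set)"
    using ex_bij_betw_nat_finite[of "Basis :: ((real^4) \<times> real) set"] by (auto simp: atLeast0LessThan)
  define w where "w k i x = c i * sphere_fun 1 (e k) x" for k i x
  define D where "D a = (\<Sum>k<5. a k *\<^sub>R e k)" for a :: "nat \<Rightarrow> real"
  have comb: "(\<Sum>k<5. a k * w k i x) = c i * sphere_fun 1 (D a) x" for a i x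
    by (simp add: w_def D_def sphere_fun_def inner_sum_left sum_distrib_left ac_simps)
  have De: "inner (D a) (e k) = a k" if k: "k < 5" for a k
  proof -
    have "inner (e l) (e k) = (if l = k then 1 else 0)" if "l < 5" for l
    proof -
      have "e l \<in> Basis" "e k \<in> Basis" "e l = e k \<longleftrightarrow> l = k"
        using bij_betwE[OF e] inj_on_eq_iff[OF bij_betw_imp_inj_on[OF e]] k that by auto
      then show ?thesis
        by (simp only: inner_Basis)
    qed
    then have "(\<Sum>l<5. a l * inner (e l) (e k)) = (\<Sum>l<5. if l = k then a l else 0)"
      by (intro sum.cong refl) auto
    then show ?thesis
      using k by (simp add: D_def inner_sum_left)
  qed
  have D_surj: "\<exists>a. d = D a" for d
  proof -
    have "d = (\<Sum>b\<in>Basis. inner d b *\<^sub>R b)"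
      by (simp add: euclidean_representation)
    also have "\<dots> = D (\<lambda>k. inner d (e k))"
      unfolding D_def by (rule sum.reindex_bij_betw[OF e, symmetric])
    finally show ?thesis by blast
  qed
  show ?thesis
    unfolding ae_vector_space_of_dim_def
  proof (intro exI[of _ w] conjI allI impI)
    fix a :: "nat \<Rightarrow> real" and k :: nat
    assume z: "\<forall>i\<in>I. AE x in lebesgue. (\<Sum>k<5. a k * w k i x) = 0" and k: "k < 5"
    obtain i where i: "i \<in> I"
      using ne by blast
    from z i have "AE x in lebesgue. c i * sphere_fun 1 (D a) x = 0"
      by (simp only: comb)
    then have "AE x in lebesgue. inner (D a) (stereo x) = 0"
    proof eventually_elim
      case (elim x)
      then show ?case
        using c_pos[OF i] conf_pos[of x] by (simp add: sphere_fun_def)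
    qed
    then have "D a = 0"
      by (rule AE_inner_stereo_zero)
    then show "a k = 0"
      using De[OF k, of a] by simp
  next
    show "linearized_solutions \<beta> c I = {v. \<exists>a. \<forall>i\<in>I. AE x in lebesgue. v i x = (\<Sum>k<5. a k * w k i x)}"
    proof (intro equalityI subsetI)
      fix v assume "v \<in> linearized_solutions \<beta> c I"
      then obtain d where d: "\<And>i. i \<in> I \<Longrightarrow> AE x in lebesgue. v i x = c i * sphere_fun 1 d x"
        by (rule solution_form) blast
      obtain a where "d = D a"
        using D_surj by blast
      with d show "v \<in> {v. \<exists>a. \<forall>i\<in>I. AE x in lebesgue. v i x = (\<Sum>k<5. a k * w k i x)}"
        unfolding comb by blast
    next
      fix v assume "v \<in> {v. \<exists>a. \<forall>i\<in>I. AE x in lebesgue. v i x = (\<Sum>k<5. a k * w k i x)}"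
      then show "v \<in> linearized_solutions \<beta> c I"
        unfolding comb by (blast intro: sphere_fun_solution)
    qed
  qed
qed

end

section \<open>From groups and matrices to the abstract system\<close>

lemma group_of_eq:
  assumes "q_decomposition q m l" "h \<in> {1..q}"
  shows "group_of m l h = {l (h - 1) + 1..l h}" "l (h - 1) < l h"
proof -
  have step: "l k < l (Suc k)" if "k < q" for k
    using assms(1) that by (simp add: q_decomposition_def)
  have "l k \<le> l q" if "k \<le> q" for k
    using that by (induction k rule: inc_induct) (auto dest: step)
  moreover have "l q = m"
    using assms(1) by (simp add: q_decomposition_def)
  ultimately have "l h \<le> m"
    using assms(2) by force
  then show "group_of m l h = {l (h - 1) + 1..l h}"
    by (auto simp: group_of_def)
  show "l (h - 1) < l h"
  proof -
    have "h - 1 < q" "Suc (h - 1) = h"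
      using assms(2) by auto
    with step[of "h - 1"] show ?thesis by (simp only:)
  qed
qed

lemma invertible_mat_mult_vec_zero:
  fixes A :: "real mat"
  assumes A: "A \<in> carrier_mat n n" and "invertible_mat A"
    and z: "z \<in> carrier_vec n" and Az: "A *\<^sub>v z = 0\<^sub>v n"
  shows "z = 0\<^sub>v n"
proof -
  obtain B where AB: "A * B = 1\<^sub>m (dim_row A)" and BA: "B * A = 1\<^sub>m (dim_row B)"
    using assms(2) by (auto simp: invertible_mat_def inverts_mat_def)
  \<comment> \<open>\<open>invertible_mat\<close> does not state the size of the inverse; it follows
    by comparing column counts in AB = 1 and BA = 1.\<close>
  have "dim_row B = n" "dim_col B = n"
    using arg_cong[OF AB, of dim_col] arg_cong[OF BA, of dim_col] A by auto
  then have B: "B \<in> carrier_mat n n" by auto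
  have "z = (B * A) *\<^sub>v z"
    using BA B z by simp
  also have "\<dots> = B *\<^sub>v (A *\<^sub>v z)"
    using A B z by (simp add: assoc_mult_mat_vec)
  also have "\<dots> = 0\<^sub>v n"
    unfolding Az using B by (intro eq_vecI) auto
  finally show ?thesis .
qed

theorem proposition1p4:
  fixes m q :: nat and \<mu> :: "nat \<Rightarrow> real" and \<beta> :: "nat \<Rightarrow> nat \<Rightarrow> real"
    and l :: "nat \<Rightarrow> nat" and c :: "nat \<Rightarrow> real"
  assumes mu_pos: "\<forall>i\<in>{1..m}. \<mu> i > 0"
    and beta_diag: "\<forall>i\<in>{1..m}. \<beta> i i = \<mu> i"
    and beta_sym: "\<forall>i\<in>{1..m}. \<forall>j\<in>{1..m}. i \<noteq> j \<longrightarrow> \<beta> i j = \<beta> j i"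
    and "1 < q" and "q < m"
    and "q_decomposition q m l"
    and c_pos: "\<forall>h\<in>{1..q}. \<forall>i\<in>group_of m l h. c i > 0"
    and c_eq: "\<forall>h\<in>{1..q}. \<forall>i\<in>group_of m l h.
           (\<Sum>j\<in>group_of m l h. \<beta> i j * c i * (c j)\<^sup>2) = c i"
    and "\<forall>h\<in>{1..q}. invertible_mat (group_matrix \<beta> l h)"
    and "\<forall>h\<in>{1..q}. \<forall>i\<in>group_of m l h. \<forall>j\<in>group_of m l h. \<beta> i j > 0"
  shows "\<forall>h\<in>{1..q}.
           ae_vector_space_of_dim (group_of m l h) (linearized_solutions \<beta> c (group_of m l h)) 5"
proof
  fix h assume h: "h \<in> {1..q}"
  let ?I = "group_of m l h" and ?p = "l (h - 1) + 1"
  define n where "n = l h - l (h - 1)"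
  note I = group_of_eq[OF assms(6) h]
  have sub: "?I \<subseteq> {1..m}"
    by (auto simp: group_of_def)
  interpret positive_system ?I \<beta> c
  proof
    show "finite ?I" "?I \<noteq> {}"
      using I by auto
    show "0 < c i" "(\<Sum>j\<in>?I. \<beta> i j * c i * (c j)\<^sup>2) = c i" if "i \<in> ?I" for i
      using c_pos c_eq h that by blast+
    show "0 < \<beta> i j" if "i \<in> ?I" "j \<in> ?I" for i j
      using assms(10) h that by blast
    show "\<beta> i j = \<beta> j i" if "i \<in> ?I" "j \<in> ?I" for i j
      using beta_sym sub that by (cases "i = j") auto
    fix z :: "nat \<Rightarrow> real" and i
    assume z: "\<And>i. i \<in> ?I \<Longrightarrow> (\<Sum>j\<in>?I. \<beta> i j * z j) = 0" and i: "i \<in> ?I"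
    \<comment> \<open>Matrix position s, counted from 0, corresponds to the group index
      \<open>l (h - 1) + 1 + s\<close>; a family on the group becomes the vector
      \<open>Z\<close>.\<close>
    have bij: "bij_betw (\<lambda>s. ?p + s) {0..<n} ?I"
      unfolding I(1) using I(2) by (intro bij_betw_byWitness[where f' = "\<lambda>j. j - ?p"]) (auto simp: n_def)
    define Z where "Z = vec n (\<lambda>s. z (?p + s))"
    have "group_matrix \<beta> l h *\<^sub>v Z = 0\<^sub>v n"
    proof (rule eq_vecI)
      fix r assume "r < dim_vec (0\<^sub>v n :: real vec)"
      then have r: "r < n" by simp
      have "vec_index (group_matrix \<beta> l h *\<^sub>v Z) r = (\<Sum>s = 0..<n. \<beta> (?p + r) (?p + s) * z (?p + s))"
        using r by (simp add: group_matrix_def Z_def scalar_prod_def n_def)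
      also have "\<dots> = (\<Sum>j\<in>?I. \<beta> (?p + r) j * z j)"
        by (rule sum.reindex_bij_betw[OF bij])
      also have "\<dots> = 0"
        using bij_betwE[OF bij] r by (intro z) simp
      finally show "vec_index (group_matrix \<beta> l h *\<^sub>v Z) r = vec_index (0\<^sub>v n) r"
        using r by simp
    qed (simp add: group_matrix_def n_def)
    moreover have "group_matrix \<beta> l h \<in> carrier_mat n n"
      by (simp add: group_matrix_def n_def)
    moreover have "invertible_mat (group_matrix \<beta> l h)"
      using assms(9) h by blast
    moreover have "Z \<in> carrier_vec n"
      by (simp add: Z_def)
    ultimately have "Z = 0\<^sub>v n"
      using invertible_mat_mult_vec_zero by blast
    have "i \<in> (\<lambda>s. ?p + s) ` {0..<n}"
      using i bij_betw_imp_surj_on[OF bij] by (simp only:)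
    then obtain s where s: "s < n" "i = ?p + s"
      by auto
    with \<open>Z = 0\<^sub>v n\<close> have "vec_index Z s = 0"
      by simp
    with s show "z i = 0"
      by (simp add: Z_def)
  qed
  show "ae_vector_space_of_dim ?I (linearized_solutions \<beta> c ?I) 5"
    by (rule linearized_solutions_dim_5)
qed

end
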